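(* There exists a constant $C<\infty$ such that for all $f\in L^2(\mathbb{R}\times\mathbb{T})$, $$\Vert e^{it\Delta_{\mathbb{R}\times\mathbb{T}}}f\Vert_{\ell^8L^4(\mathbb{R},L^4(\mathbb{R}\times\mathbb{T}))}\le C\,\Vert f\Vert_{L^2(\mathbb{R}\times\mathbb{T})},$$ that is, $$\left(\sum_{\gamma\in\mathbb{Z}}\left(\int_{0}^{1}\int_{\mathbb{R}\times\mathbb{T}}\left\vert \left(e^{i(\gamma+s)\Delta_{\mathbb{R}\times\mathbb{T}}}f\right)(x,y)\right\vert^4\,dx\,dy\,ds\right)^{2}\right)^{1/8}\le C\,\Vert f\Vert_{L^2(\mathbb{R}\times\mathbb{T})}.$$
   Context: $\mathbb{T}=\mathbb{R}/2\pi\mathbb{Z}$. $\Delta_{\mathbb{R}\times\mathbb{T}}=\partial_x^2+\partial_y^2$ for $(x,y)\in\mathbb{R}\times\mathbb{T}$, and $e^{it\Delta_{\mathbb{R}\times\mathbb{T}}}$ is the unitary Schr\"odinger group on $L^2(\mathbb{R}\times\mathbb{T})$, i.e. the Fourier multiplier operator with symbol $e^{-it(\xi^2+k^2)}$, where $(\xi,k)\in\mathbb{R}\times\mathbb{Z}$ are the frequency variables dual to $(x,y)$. For a function $u(t,x,y)$ on $\mathbb{R}\times\mathbb{R}\times\mathbb{T}=(\mathbb{Z}+[0,1))\times\mathbb{R}\times\mathbb{T}$ (time variable first), the mixed norm is defined by $$\Vert u\Vert^a_{\ell^aL^b(\mathbb{R},L^c(\mathbb{R}\times\mathbb{T}))}:=\sum_{\gamma\in\mathbb{Z}}\left(\int_{s\in[0,1)}\left(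 \int_{\mathbb{R}\times\mathbb{T}}\vert u(\gamma+s,x,y)\vert^c\, dx\,dy\right)^{\frac{b}{c}}ds\right)^{\frac{a}{b}}.$$ *)

theory Defs
  imports "HOL-Analysis.Analysis"
begin

text \<open>
  The torus \<open>\<real>/2\<pi>\<int>\<close> is represented by its fundamental domain \<open>[0, 2\<pi>)\<close>: an element of an \<open>L\<^sup>p\<close>
  space over \<open>\<real> \<times> \<T>\<close> is a function on the plane of which only the values on \<open>\<real> \<times> [0, 2\<pi>)\<close> matter.
\<close>

definition cylinder :: "(real \<times> real) measure" where
  "cylinder = lborel \<Otimes>\<^sub>M restrict_space lborel {0..<2 * pi}"

definition frequency_space :: "(real \<times> int) measure" where
  "frequency_space = lborel \<Otimes>\<^sub>M count_space UNIV"

text \<open>Powers with a positive real exponent on \<open>[0, \<infinity>]\<close>.\<close>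

definition ennreal_powr :: "ennreal \<Rightarrow> real \<Rightarrow> ennreal" where
  "ennreal_powr x p = (if x = \<infinity> then \<infinity> else ennreal (enn2real x powr p))"

definition Lp_norm :: "real \<Rightarrow> 'a measure \<Rightarrow> ('a \<Rightarrow> complex) \<Rightarrow> ennreal" where
  "Lp_norm p M f = ennreal_powr (\<integral>\<^sup>+ z. ennreal (cmod (f z) powr p) \<partial>M) (1 / p)"

definition Lp_space :: "real \<Rightarrow> 'a measure \<Rightarrow> ('a \<Rightarrow> complex) set" where
  "Lp_space p M = {f \<in> borel_measurable M. Lp_norm p M f < \<infinity>}"

text \<open>
  The factor \<open>1/2\<pi>\<close> makes the transform unitary from \<open>L\<^sup>2(\<real> \<times> \<T>)\<close> onto \<open>L\<^sup>2(\<real> \<times> \<int>)\<close>; it cancels in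
  Fourier multipliers.
\<close>

definition fourier_integral :: "(real \<times> real \<Rightarrow> complex) \<Rightarrow> real \<times> int \<Rightarrow> complex" where
  "fourier_integral f = (\<lambda>(\<xi>, k).
     (\<integral>(x, y). cis (- (\<xi> * x + of_int k * y)) * f (x, y) \<partial>cylinder) / of_real (2 * pi))"

text \<open>
  The Plancherel extension to \<open>L\<^sup>2(\<real> \<times> \<T>)\<close>: the \<open>L\<^sup>2\<close> limit of the transforms of the truncations of
  \<open>f\<close> to \<open>\<bar>x\<bar> \<le> n\<close>, which lie in \<open>L\<^sup>1 \<inter> L\<^sup>2\<close>.  It is determined up to a null set, and the choice
  operator picks a representative.
\<close>

definition fourier_transform :: "(real \<times> real \<Rightarrow> complex) \<Rightarrow> real \<times> int \<Rightarrow> complex" where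
  "fourier_transform f = (SOME F. F \<in> Lp_space 2 frequency_space \<and>
     (\<lambda>n::nat. Lp_norm 2 frequency_space (\<lambda>q.
        fourier_integral (\<lambda>(x, y). indicator {- real n..real n} x * f (x, y)) q - F q))
       \<longlonglongrightarrow> 0)"

definition fourier_multiplier ::
  "(real \<times> int \<Rightarrow> complex) \<Rightarrow> (real \<times> real \<Rightarrow> complex) \<Rightarrow> real \<times> real \<Rightarrow> complex" where
  "fourier_multiplier m f = (SOME g. g \<in> Lp_space 2 cylinder \<and>
     (AE q in frequency_space. fourier_transform g q = m q * fourier_transform f q))"

text \<open>
  For each time \<open>t\<close> this is some representative of the \<open>L\<^sup>2\<close> class, with no joint measurability in
  \<open>(t, x, y)\<close> built in; the iterated integrals in \<open>mixed_norm\<close> do not depend on the representatives.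
\<close>

definition schrodinger_group ::
  "real \<Rightarrow> (real \<times> real \<Rightarrow> complex) \<Rightarrow> real \<times> real \<Rightarrow> complex" where
  "schrodinger_group t = fourier_multiplier (\<lambda>(\<xi>, k). cis (- t * (\<xi>\<^sup>2 + (of_int k)\<^sup>2)))"

definition mixed_norm ::
  "real \<Rightarrow> real \<Rightarrow> real \<Rightarrow> (real \<Rightarrow> real \<times> real \<Rightarrow> complex) \<Rightarrow> ennreal" where
  "mixed_norm a b c u =
     ennreal_powr
       (\<Sum>\<^sub>\<infinity>\<gamma>\<in>(UNIV :: int set).
          ennreal_powr
            (\<integral>\<^sup>+ s\<in>{0..<1}.
               ennreal_powr (\<integral>\<^sup>+ z. ennreal (cmod (u (of_int \<gamma> + s) z) powr c) \<partial>cylinder) (b / c)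
             \<partial>lborel)
            (a / b))
       (1 / a)"

lemma mixed_norm_8_4_4:
  "mixed_norm 8 4 4 u =
     ennreal_powr
       (\<Sum>\<^sub>\<infinity>\<gamma>\<in>(UNIV :: int set).
          (\<integral>\<^sup>+ s\<in>{0..<1}. (\<integral>\<^sup>+ z. ennreal (cmod (u (of_int \<gamma> + s) z) ^ 4) \<partial>cylinder) \<partial>lborel)\<^sup>2)
       (1 / 8)"
proof -
  have 1: "ennreal_powr x 1 = x" for x
    by (cases x) (auto simp: ennreal_powr_def)
  have 2: "ennreal_powr x 2 = x\<^sup>2" for x
    by (cases x) (auto simp: ennreal_powr_def powr_numeral ennreal_power power_eq_top_ennreal)
  have 3: "cmod w powr 4 = cmod w ^ 4" for w
    by (cases "w = 0") (auto simp: powr_numeral)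
  show ?thesis
    by (simp add: mixed_norm_def 1 2 3)
qed

end

theory Submission
  imports Defs "HOL-Probability.Characteristic_Functions"
begin

text \<open>
  The eighth power of the norm is bounded by a correlation of the quartic mass of \<open>u = e\<^sup>i\<^sup>t\<^sup>\<Delta> f\<close> at two times
  at bounded distance. The correlation is the square of an \<open>L\<^sup>2\<close> norm of \<open>u(t, z)\<^sup>2 u(t', z')\<^sup>2\<close>, a superposition of
  plane waves indexed by four frequencies. Expanding this square against Gaussian weights reduces the
  bound, by the Schur test, to a uniform estimate for the measure of the quadruples of frequencies with
  prescribed momentum of each pair, prescribed total energy and, up to \<open>O(1)\<close>, prescribed energy of each
  pair. For one pair the density of the energy is at most a multiple of \<open>\<rho>(y) = {y}\<^sup>-\<^sup>1\<^sup>/\<^sup>2\<close>, with \<open>{y}\<close> the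
  fractional part, and the two-pair estimate holds because \<open>\<integral> \<rho>(y) \<rho>(V - y) dy\<close> over a unit interval is
  bounded in \<open>V\<close>. Only exact Gaussian integrals and Tonelli's theorem enter, so no dispersive estimate and no
  interpolation is needed. Plancherel's theorem on the cylinder then extends the bound, which is first
  obtained for integrable Fourier data, to all of \<open>L\<^sup>2\<close>.
\<close>

section \<open>The Schur test and Gaussian weights\<close>

text \<open>The exponent 8 is where the problem becomes quadratic: the eighth power sums squares of
  window masses, and a product of two quartic masses is the squared modulus of a product of four
  waves. One pair with exactly prescribed energy admits no uniform bound, because its energy density
  has inverse square root singularities at the integers. With two pairs only the total energy is
  prescribed exactly, and integrating over the share of the first pair smooths the singularities
  out. If that share ranged over all values, the integral would grow with the total energy; the
  Gaussian in the time difference \<open>r\<close> confines the share to \<open>O(1)\<close>, in the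
  sense of a summable weight on unit cells. The other Gaussian weights only make the plane waves
  integrable. Their scale sigma leaves no trace in the bounds, since every
  \<open>gauss_kernel\<close> has total mass 2 pi, so Fatou's lemma lets sigma tend to infinity. The
  Schur test serves a second time for Bessel's inequality, on which the Plancherel theory
  rests.\<close>

lemma
  fixes f :: "'a \<Rightarrow> complex" and g :: "'b \<Rightarrow> complex"
  assumes M: "sigma_finite_measure M" and N: "sigma_finite_measure N"
    and f: "integrable M f" and g: "integrable N g"
  shows integrable_pair_mult: "integrable (M \<Otimes>\<^sub>M N) (\<lambda>(x, y). f x * g y)"
    and integral_pair_mult: "(\<integral>(x, y). f x * g y \<partial>(M \<Otimes>\<^sub>M N)) = integral\<^sup>L M f * integral\<^sup>L N g"
proof -
  interpret M: sigma_finite_measure M by fact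
  interpret N: sigma_finite_measure N by fact
  interpret P: pair_sigma_finite M N ..
  note [measurable] = borel_measurable_integrable[OF f] borel_measurable_integrable[OF g]
  show i: "integrable (M \<Otimes>\<^sub>M N) (\<lambda>(x, y). f x * g y)"
  proof (rule P.Fubini_integrable)
    show "integrable M (\<lambda>x. \<integral>y. norm (case (x, y) of (x, y) \<Rightarrow> f x * g y) \<partial>N)"
      using f by (simp add: norm_mult)
    show "AE x in M. integrable N (\<lambda>y. case (x, y) of (x, y) \<Rightarrow> f x * g y)"
      using g by simp
  qed measurable
  show "(\<integral>(x, y). f x * g y \<partial>(M \<Otimes>\<^sub>M N)) = integral\<^sup>L M f * integral\<^sup>L N g"
    using P.integral_fst'[OF i] by simp
qed

lemma borel_measurable_cnj [measurable (raw)]: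
  "f \<in> borel_measurable M \<Longrightarrow> (\<lambda>x. cnj (f x)) \<in> borel_measurable M"
  by (rule borel_measurable_continuous_on[OF _ , of cnj]) (auto intro: continuous_intros)

lemma ennreal_mult_le_half_sum_squares:
  assumes "0 \<le> a" "0 \<le> b"
  shows "ennreal (a * b) \<le> ennreal (a\<^sup>2 / 2) + ennreal (b\<^sup>2 / 2)"
proof -
  have "a * b \<le> a\<^sup>2 / 2 + b\<^sup>2 / 2"
    using sum_squares_bound[of a b] by simp
  then show ?thesis
    by (simp flip: ennreal_plus add: assms)
qed

text \<open>
  The square on the left expands into a quadratic form in \<open>G\<close> with kernel \<open>\<integral> W E E\<^sup>*\<close>, to which the
  Schur test applies.
\<close>

lemma schur_extension_bound:
  fixes G :: "'a \<Rightarrow> complex" and E :: "'a \<Rightarrow> 'b \<Rightarrow> complex" and W :: "'b \<Rightarrow> real"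
    and k :: "'a \<Rightarrow> 'a \<Rightarrow> ennreal"
  assumes M: "sigma_finite_measure M" and N: "sigma_finite_measure N"
    and G: "integrable M G"
    and E: "(\<lambda>(x, v). E x v) \<in> borel_measurable (M \<Otimes>\<^sub>M N)"
    and E1: "\<And>x v. cmod (E x v) \<le> 1"
    and W: "integrable N W" "\<And>v. 0 \<le> W v"
    and k: "(\<lambda>(x, y). k x y) \<in> borel_measurable (M \<Otimes>\<^sub>M M)"
    and k_sym: "\<And>x y. k x y = k y x"
    and k_int: "\<And>x. (\<integral>\<^sup>+ y. k x y \<partial>M) \<le> C"
    and K: "\<And>x y. ennreal (cmod (\<integral>v. of_real (W v) * (E x v * cnj (E y v)) \<partial>N)) \<le> k x y"
  shows "(\<integral>\<^sup>+ v. ennreal (W v) * ennreal ((cmod (\<integral>x. G x * E x v \<partial>M))\<^sup>2) \<partial>N)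
    \<le> C * (\<integral>\<^sup>+ x. ennreal ((cmod (G x))\<^sup>2) \<partial>M)"
proof -
  interpret M: sigma_finite_measure M by fact
  interpret N: sigma_finite_measure N by fact
  interpret MM: pair_sigma_finite M M ..
  have S: "sigma_finite_measure (M \<Otimes>\<^sub>M M)" ..
  interpret S: sigma_finite_measure "M \<Otimes>\<^sub>M M" by fact
  interpret P: pair_sigma_finite N "M \<Otimes>\<^sub>M M" ..
  note [measurable] = borel_measurable_integrable[OF G] E borel_measurable_integrable[OF W(1)] k
  define H where "H v = (\<integral>x. G x * E x v \<partial>M)" for v
  \<comment> \<open>The integrand of the expanded square. As \<open>E\<close> is bounded by 1, it is
    dominated by \<open>W v\<close> times the moduli of \<open>G\<close> at both points, which is
    integrable on the triple product; this justifies Fubini.\<close>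
  define \<Phi> where "\<Phi> v p = of_real (W v) * (G (fst p) * cnj (G (snd p)) * (E (fst p) v * cnj (E (snd p) v)))" for v p
  have Em: "(\<lambda>x. E x v) \<in> borel_measurable M" if "v \<in> space N" for v
    using that by measurable
  have Ec: "(\<lambda>z. E (f z) (g z)) \<in> borel_measurable L"
    if "f \<in> measurable L M" "g \<in> measurable L N" for L :: "'c measure" and f g
    using measurable_compose[OF measurable_Pair[OF that] E] by simp
  have GE: "integrable M (\<lambda>x. G x * E x v)" if "v \<in> space N" for v
    by (rule Bochner_Integration.integrable_bound[OF G])
      (use that E1 Em in \<open>auto simp: norm_mult mult_left_le intro!: AE_I2 borel_measurable_times\<close>)
  have [measurable]: "H \<in> borel_measurable N"
    unfolding H_def[abs_def] by measurable
  have int_\<Phi>: "integrable (N \<Otimes>\<^sub>M (M \<Otimes>\<^sub>M M)) (\<lambda>(v, p). \<Phi> v p)"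
  proof (rule Bochner_Integration.integrable_bound)
    have "integrable M (\<lambda>x. complex_of_real (cmod (G x)))" using G by simp
    then have "integrable (M \<Otimes>\<^sub>M M) (\<lambda>(x, y). complex_of_real (cmod (G x)) * of_real (cmod (G y)))"
      by (intro integrable_pair_mult M)
    moreover have "integrable N (\<lambda>v. complex_of_real (W v))" using W by simp
    ultimately show "integrable (N \<Otimes>\<^sub>M (M \<Otimes>\<^sub>M M))
       (\<lambda>(v, p). complex_of_real (W v) * (\<lambda>(x, y). complex_of_real (cmod (G x)) * of_real (cmod (G y))) p)"
      by (rule integrable_pair_mult[OF N S, rotated])
    show "(\<lambda>(v, p). \<Phi> v p) \<in> borel_measurable (N \<Otimes>\<^sub>M (M \<Otimes>\<^sub>M M))"
      unfolding \<Phi>_def by (auto intro!: borel_measurable_times Ec borel_measurable_cnj simp: split_beta)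
    show "AE x in N \<Otimes>\<^sub>M (M \<Otimes>\<^sub>M M). cmod (case x of (v, p) \<Rightarrow> \<Phi> v p)
      \<le> cmod (case x of (v, p) \<Rightarrow> complex_of_real (W v) * (\<lambda>(x, y). complex_of_real (cmod (G x)) * of_real (cmod (G y))) p)"
      using E1 by (intro AE_I2) (auto simp: \<Phi>_def norm_mult split_beta intro!: mult_left_le mult_le_one mult_left_mono mult_nonneg_nonneg)
  qed
  have H2: "(\<integral>p. \<Phi> v p \<partial>(M \<Otimes>\<^sub>M M)) = of_real (W v * (cmod (H v))\<^sup>2)" if "v \<in> space N" for v
  proof -
    have "(\<integral>p. \<Phi> v p \<partial>(M \<Otimes>\<^sub>M M)) = of_real (W v) * (\<integral>(x, y). (G x * E x v) * cnj (G y * E y v) \<partial>(M \<Otimes>\<^sub>M M))"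
      unfolding \<Phi>_def by (simp add: case_prod_unfold mult_ac flip: integral_mult_right_zero)
    also have "\<dots> = of_real (W v) * (H v * cnj (H v))"
      unfolding H_def
      by (subst integral_pair_mult[OF M M GE[OF that]]) (auto simp del: complex_cnj_mult simp: GE[OF that])
    finally show ?thesis by (simp only: of_real_mult complex_norm_square)
  qed
  have int_H: "integrable N (\<lambda>v. W v * (cmod (H v))\<^sup>2)"
  proof -
    have "integrable N (\<lambda>v. \<integral>p. \<Phi> v p \<partial>(M \<Otimes>\<^sub>M M))"
      using P.integrable_fst'[OF int_\<Phi>] by simp
    then have "integrable N (\<lambda>v. complex_of_real (W v * (cmod (H v))\<^sup>2))"
      by (rule Bochner_Integration.integrable_cong[THEN iffD1, rotated 2]) (simp_all add: H2)
    then show ?thesis by (simp only: complex_of_real_integrable_eq)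
  qed
  have "(\<integral>\<^sup>+ v. ennreal (W v) * ennreal ((cmod (H v))\<^sup>2) \<partial>N) = ennreal (\<integral>v. W v * (cmod (H v))\<^sup>2 \<partial>N)"
    using int_H W(2) by (subst nn_integral_eq_integral[symmetric]) (auto simp: ennreal_mult intro!: nn_integral_cong)
  also have "\<dots> = ennreal (cmod (\<integral>v. of_real (W v * (cmod (H v))\<^sup>2) \<partial>N))"
    using W(2) by (subst integral_complex_of_real) (simp add: integral_nonneg_AE)
  also have "(\<integral>v. complex_of_real (W v * (cmod (H v))\<^sup>2) \<partial>N) = (\<integral>v. \<integral>p. \<Phi> v p \<partial>(M \<Otimes>\<^sub>M M) \<partial>N)"
    by (intro Bochner_Integration.integral_cong refl) (simp only: H2)
  also have "\<dots> = (\<integral>p. \<integral>v. \<Phi> v p \<partial>N \<partial>(M \<Otimes>\<^sub>M M))"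
    by (rule P.Fubini_integral[symmetric]) (use int_\<Phi> in simp)
  also have "ennreal (cmod \<dots>) \<le> (\<integral>\<^sup>+p. ennreal (cmod (\<integral>v. \<Phi> v p \<partial>N)) \<partial>(M \<Otimes>\<^sub>M M))"
    by (rule integral_norm_bound_ennreal) (use P.integrable_snd[OF int_\<Phi>] in simp)
  \<comment> \<open>The Schur step: the product of the two values of \<open>G\<close> is at most
    half the sum of their squares. By symmetry of \<open>k\<close> both halves are equal, so one
    bound on row integrals suffices.\<close>
  also have "\<dots> \<le> (\<integral>\<^sup>+p. (ennreal ((cmod (G (fst p)))\<^sup>2 / 2) + ennreal ((cmod (G (snd p)))\<^sup>2 / 2)) * k (fst p) (snd p) \<partial>(M \<Otimes>\<^sub>M M))"
  proof (rule nn_integral_mono)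
    fix p
    have "(\<integral>v. \<Phi> v p \<partial>N) = (G (fst p) * cnj (G (snd p))) * (\<integral>v. of_real (W v) * (E (fst p) v * cnj (E (snd p) v)) \<partial>N)"
      unfolding \<Phi>_def by (subst integral_mult_right_zero[symmetric]) (simp add: mult_ac)
    then have "ennreal (cmod (\<integral>v. \<Phi> v p \<partial>N)) = ennreal (cmod (G (fst p)) * cmod (G (snd p))) *
       ennreal (cmod (\<integral>v. of_real (W v) * (E (fst p) v * cnj (E (snd p) v)) \<partial>N))"
      by (simp add: norm_mult ennreal_mult)
    also have "\<dots> \<le> (ennreal ((cmod (G (fst p)))\<^sup>2 / 2) + ennreal ((cmod (G (snd p)))\<^sup>2 / 2)) * k (fst p) (snd p)"
      by (intro mult_mono K ennreal_mult_le_half_sum_squares) auto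
    finally show "ennreal (cmod (\<integral>v. \<Phi> v p \<partial>N)) \<le> \<dots>" .
  qed
  also have "\<dots> = (\<integral>\<^sup>+p. ennreal ((cmod (G (fst p)))\<^sup>2 / 2) * k (fst p) (snd p) \<partial>(M \<Otimes>\<^sub>M M)) +
      (\<integral>\<^sup>+p. ennreal ((cmod (G (snd p)))\<^sup>2 / 2) * k (fst p) (snd p) \<partial>(M \<Otimes>\<^sub>M M))"
    by (subst nn_integral_add[symmetric]) (auto simp: distrib_right)
  also have "(\<integral>\<^sup>+p. ennreal ((cmod (G (snd p)))\<^sup>2 / 2) * k (fst p) (snd p) \<partial>(M \<Otimes>\<^sub>M M)) =
     (\<integral>\<^sup>+p. ennreal ((cmod (G (fst p)))\<^sup>2 / 2) * k (fst p) (snd p) \<partial>(M \<Otimes>\<^sub>M M))"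
  proof -
    have "(\<integral>\<^sup>+p. ennreal ((cmod (G (snd p)))\<^sup>2 / 2) * k (fst p) (snd p) \<partial>(M \<Otimes>\<^sub>M M)) =
      (\<integral>\<^sup>+y. \<integral>\<^sup>+x. ennreal ((cmod (G y))\<^sup>2 / 2) * k x y \<partial>M \<partial>M)"
      by (subst MM.nn_integral_snd[symmetric]) auto
    also have "\<dots> = (\<integral>\<^sup>+y. \<integral>\<^sup>+x. ennreal ((cmod (G y))\<^sup>2 / 2) * k y x \<partial>M \<partial>M)"
      by (simp add: k_sym)
    also have "\<dots> = (\<integral>\<^sup>+p. ennreal ((cmod (G (fst p)))\<^sup>2 / 2) * k (fst p) (snd p) \<partial>(M \<Otimes>\<^sub>M M))"
      by (subst M.nn_integral_fst[symmetric]) auto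
    finally show ?thesis .
  qed
  also have "(\<integral>\<^sup>+p. ennreal ((cmod (G (fst p)))\<^sup>2 / 2) * k (fst p) (snd p) \<partial>(M \<Otimes>\<^sub>M M)) =
      (\<integral>\<^sup>+x. ennreal ((cmod (G x))\<^sup>2 / 2) * (\<integral>\<^sup>+y. k x y \<partial>M) \<partial>M)"
    by (subst M.nn_integral_fst[symmetric]) (auto simp: nn_integral_cmult intro!: nn_integral_cong nn_integral_cmult)
  also have "\<dots> + \<dots> \<le> (\<integral>\<^sup>+x. ennreal ((cmod (G x))\<^sup>2 / 2) * C \<partial>M) + (\<integral>\<^sup>+x. ennreal ((cmod (G x))\<^sup>2 / 2) * C \<partial>M)"
    by (intro add_mono nn_integral_mono mult_left_mono k_int) auto
  also have "\<dots> = (\<integral>\<^sup>+x. ennreal ((cmod (G x))\<^sup>2 / 2) + ennreal ((cmod (G x))\<^sup>2 / 2) \<partial>M) * C"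
    by (simp add: nn_integral_multc nn_integral_add distrib_right)
  also have "\<dots> = C * (\<integral>\<^sup>+ x. ennreal ((cmod (G x))\<^sup>2) \<partial>M)"
    by (simp flip: ennreal_plus add: mult.commute)
  finally show ?thesis unfolding H_def .
qed

section \<open>Gaussian weights and their Fourier transforms\<close>

definition gauss_weight :: "real \<Rightarrow> real \<Rightarrow> real" where
  "gauss_weight \<sigma> x = exp (- (x / \<sigma>)\<^sup>2 / 2)"

text \<open>The Fourier transform of \<open>gauss_weight \<sigma>\<close>, computed in
  \<open>cis_integral_gauss_weight\<close>. As sigma grows it concentrates at 0, so it acts as a
  smeared equality of frequencies.\<close>

definition gauss_kernel :: "real \<Rightarrow> real \<Rightarrow> real" where
  "gauss_kernel \<sigma> p = \<sigma> * sqrt (2 * pi) * exp (- (\<sigma> * p)\<^sup>2 / 2)"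

lemma gauss_measurable [measurable]:
  "gauss_weight \<sigma> \<in> borel_measurable borel" "gauss_kernel \<sigma> \<in> borel_measurable borel"
  by (auto simp: gauss_weight_def[abs_def] gauss_kernel_def[abs_def])

lemma gauss_weight_nonneg [simp]: "0 \<le> gauss_weight \<sigma> x"
  and gauss_weight_le_1: "gauss_weight \<sigma> x \<le> 1"
  by (auto simp: gauss_weight_def)

lemma gauss_kernel_nonneg: "0 < \<sigma> \<Longrightarrow> 0 \<le> gauss_kernel \<sigma> p"
  by (auto simp: gauss_kernel_def)

lemma gauss_kernel_minus [simp]: "gauss_kernel \<sigma> (- p) = gauss_kernel \<sigma> p"
  by (auto simp: gauss_kernel_def)

lemma gauss_weight_eq_normal_density:
  "0 < \<sigma> \<Longrightarrow> gauss_weight \<sigma> x = \<sigma> * sqrt (2 * pi) * normal_density 0 \<sigma> x"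
  by (auto simp: gauss_weight_def normal_density_def real_sqrt_mult power_divide)

lemma gauss_kernel_eq_normal_density:
  "0 < \<sigma> \<Longrightarrow> gauss_kernel \<sigma> p = 2 * pi * normal_density 0 (1 / \<sigma>) p"
proof -
  assume "0 < \<sigma>"
  have "2 * pi = sqrt (2 * pi) * sqrt (2 * pi)" by simp
  then show ?thesis
    using \<open>0 < \<sigma>\<close> by (simp add: gauss_kernel_def normal_density_def real_sqrt_mult real_sqrt_divide power_divide field_simps)
qed

lemma integrable_gauss_weight: "0 < \<sigma> \<Longrightarrow> integrable lborel (gauss_weight \<sigma>)"
  using gauss_weight_eq_normal_density[of \<sigma>] by (subst Bochner_Integration.integrable_cong[OF refl]) auto

text \<open>The mass does not depend on sigma. All kernel estimates inherit their uniformity in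
  sigma from this.\<close>

lemma nn_integral_gauss_kernel:
  assumes "0 < \<sigma>"
  shows "(\<integral>\<^sup>+ p. ennreal (gauss_kernel \<sigma> p) \<partial>lborel) = ennreal (2 * pi)"
proof -
  have "(\<integral>\<^sup>+ p. ennreal (gauss_kernel \<sigma> p) \<partial>lborel) = (\<integral>\<^sup>+ p. ennreal (2 * pi * normal_density 0 (1 / \<sigma>) p) \<partial>lborel)"
    by (simp only: gauss_kernel_eq_normal_density[OF assms])
  also have "\<dots> = ennreal (2 * pi)"
    using assms by (subst nn_integral_eq_integral) auto
  finally show ?thesis .
qed

lemma nn_integral_gauss_kernel_diff:
  assumes "0 < \<sigma>"
  shows "(\<integral>\<^sup>+ p. ennreal (gauss_kernel \<sigma> (a - p)) \<partial>lborel) = ennreal (2 * pi)"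
proof -
  have "(\<integral>\<^sup>+ p. ennreal (gauss_kernel \<sigma> p) \<partial>lborel) = ennreal \<bar>-1\<bar> * (\<integral>\<^sup>+ p. ennreal (gauss_kernel \<sigma> (a + (-1) * p)) \<partial>lborel)"
    by (subst nn_integral_real_affine[where t = a and c = "-1"]) auto
  then show ?thesis by (simp add: nn_integral_gauss_kernel assms)
qed

text \<open>A rescaling of the characteristic function of the standard normal distribution.\<close>

lemma cis_integral_gauss_weight:
  assumes "0 < \<sigma>"
  shows "(\<integral>x. of_real (gauss_weight \<sigma> x) * cis (p * x) \<partial>lborel) = of_real (gauss_kernel \<sigma> p)"
proof -
  have "complex_of_real (exp (- (\<sigma> * p)\<^sup>2 / 2)) = char std_normal_distribution (\<sigma> * p)"
    by (simp add: char_std_normal_distribution)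
  also have "\<dots> = (\<integral>x. of_real (std_normal_density x) * cis (\<sigma> * p * x) \<partial>lborel)"
    unfolding char_def by (subst integral_density) (auto simp: cis_conv_exp scaleR_conv_of_real)
  also have "\<dots> = (\<integral>x. (1 / sqrt (2 * pi)) *\<^sub>R (of_real (exp (- x\<^sup>2 / 2)) * cis (\<sigma> * p * x)) \<partial>lborel)"
    by (simp add: std_normal_density_def scaleR_conv_of_real mult_ac)
  also have "\<dots> = of_real (1 / sqrt (2 * pi)) * (\<integral>x. of_real (exp (- x\<^sup>2 / 2)) * cis (\<sigma> * p * x) \<partial>lborel)"
    by (subst integral_scaleR_right) (simp add: scaleR_conv_of_real)
  finally have 1: "(\<integral>x. of_real (exp (- x\<^sup>2 / 2)) * cis (\<sigma> * p * x) \<partial>lborel) =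
      of_real (sqrt (2 * pi) * exp (- (\<sigma> * p)\<^sup>2 / 2))"
    by (simp add: field_simps)
  have "(\<integral>x. of_real (gauss_weight \<sigma> x) * cis (p * x) \<partial>lborel) =
     \<bar>\<sigma>\<bar> *\<^sub>R (\<integral>x. of_real (gauss_weight \<sigma> (0 + \<sigma> * x)) * cis (p * (0 + \<sigma> * x)) \<partial>lborel)"
    using assms by (intro lborel_integral_real_affine) auto
  also have "\<dots> = \<sigma> *\<^sub>R (\<integral>x. of_real (exp (- x\<^sup>2 / 2)) * cis (\<sigma> * p * x) \<partial>lborel)"
    using assms by (simp add: gauss_weight_def mult_ac)
  finally show ?thesis
    unfolding 1 by (simp add: gauss_kernel_def scaleR_conv_of_real)
qed

lemma integrable_cis_gauss_weight:
  assumes "0 < \<sigma>"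
  shows "integrable lborel (\<lambda>x. of_real (gauss_weight \<sigma> x) * cis (p * x))"
  by (rule Bochner_Integration.integrable_bound[OF integrable_gauss_weight[OF assms]])
    (auto simp: norm_mult cis_conv_exp)

section \<open>Counting frequency pairs by energy\<close>

text \<open>The weight rho of the overview. It takes values in \<open>ennreal\<close> so that at
  integers it is infinite, where real division would give 0; upper bounds by it then hold trivially
  at the singular energies.\<close>

definition frac_rsqrt :: "real \<Rightarrow> ennreal" where
  "frac_rsqrt y = inverse (ennreal (sqrt (frac y)))"

lemma frac_measurable [measurable]: "frac \<in> borel_measurable (borel :: real measure)"
  unfolding frac_def[abs_def] by measurable

lemma frac_rsqrt_measurable [measurable]: "frac_rsqrt \<in> borel_measurable borel"
  unfolding frac_rsqrt_def[abs_def] by measurable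

lemma frac_add_of_int: "frac (of_int c + x) = frac (x :: real)"
  by (simp add: frac_def)

lemma frac_diff_of_int: "frac (x - of_int c) = frac (x :: real)"
  by (simp add: frac_def)

text \<open>Telescoping: the term at \<open>m + 1\<close> is at most twice the increment of the
  square root from \<open>m\<close> to \<open>m + 1\<close>.\<close>

lemma sum_inverse_sqrt_le: "(\<Sum>i=1..m. 1 / sqrt (real i)) \<le> 2 * sqrt (real m)"
proof (induction m)
  case (Suc m)
  have "1 / sqrt (real (Suc m)) \<le> 2 * (sqrt (real (Suc m)) - sqrt (real m))"
  proof -
    let ?a = "sqrt (real (Suc m))" and ?b = "sqrt (real m)"
    have "?a\<^sup>2 - ?b\<^sup>2 = 1" by simp
    then have "(?a - ?b) * (?a + ?b) = 1" by (simp add: power2_eq_square algebra_simps)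
    moreover have "(?a - ?b) * (?a + ?b) \<le> (?a - ?b) * (2 * ?a)"
      by (rule mult_left_mono) auto
    ultimately have "1 \<le> 2 * (?a - ?b) * ?a"
      by (simp only: mult_ac)
    then show ?thesis by (simp add: divide_simps mult_ac)
  qed
  then show ?case using Suc by simp
qed simp

text \<open>For \<open>j < m\<close> one has y - j^2 >= m^2 - j^2 >= m (m - j). This pulls 1 / sqrt
  m out of the sum and leaves the sum of the inverse roots of 1, ..., m, which is at most 2 sqrt
  m.\<close>

lemma sum_rsqrt_diff_squares_le:
  assumes "real m ^ 2 \<le> y"
  shows "(\<Sum>j<m. 1 / sqrt (y - (real j)\<^sup>2)) \<le> 2"
proof (cases "m = 0")
  case False
  have "(\<Sum>j<m. 1 / sqrt (y - (real j)\<^sup>2)) \<le> (\<Sum>j<m. 1 / sqrt (real m) * (1 / sqrt (real (m - j))))"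
  proof (rule sum_mono)
    fix j assume "j \<in> {..<m}"
    then have j: "j < m" by simp
    have "real m * real (m - j) = real m ^ 2 - real m * real j"
      using j by (simp add: of_nat_diff power2_eq_square algebra_simps)
    also have "\<dots> \<le> y - (real j)\<^sup>2"
    proof -
      have "real j * real j \<le> real m * real j" using j by (intro mult_right_mono) auto
      then show ?thesis using assms by (simp add: power2_eq_square)
    qed
    finally have "sqrt (real m) * sqrt (real (m - j)) \<le> sqrt (y - (real j)\<^sup>2)"
      by (simp flip: real_sqrt_mult)
    moreover have "0 < sqrt (real m) * sqrt (real (m - j))" using j by simp
    ultimately show "1 / sqrt (y - (real j)\<^sup>2) \<le> 1 / sqrt (real m) * (1 / sqrt (real (m - j)))"
      by (simp add: frac_le)
  qed
  also have "\<dots> = 1 / sqrt (real m) * (\<Sum>j<m. 1 / sqrt (real (m - j)))"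
    by (simp add: sum_distrib_left)
  also have "(\<Sum>j<m. 1 / sqrt (real (m - j))) = (\<Sum>i=1..m. 1 / sqrt (real i))"
    by (rule sum.reindex_bij_witness[of _ "\<lambda>i. m - i" "\<lambda>j. m - j"]) auto
  also have "1 / sqrt (real m) * \<dots> \<le> 1 / sqrt (real m) * (2 * sqrt (real m))"
    by (intro mult_left_mono sum_inverse_sqrt_le) auto
  finally show ?thesis using False by simp
qed auto

text \<open>Only the terms with |j| = m, the integer part of sqrt y, can be singular. As m^2 is an
  integer not exceeding y, there y - m^2 is at least the fractional part of y. The remaining terms
  of each sign contribute at most 2, so the total is at most 4 + 2 rho(y), and rho is at least
  1.\<close>

lemma sum_int_rsqrt_le:
  "(\<integral>\<^sup>+ j. indicator {j. (real_of_int j)\<^sup>2 < y} j * ennreal (1 / sqrt (y - (of_int j)\<^sup>2)) \<partial>count_space (UNIV :: int set))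
    \<le> 6 * frac_rsqrt y"
proof (cases "y > 0 \<and> frac y > 0")
  case True
  define m where "m = nat \<lfloor>sqrt y\<rfloor>"
  define g where "g j = 1 / sqrt (y - (real j)\<^sup>2)" for j
  have m0: "0 \<le> \<lfloor>sqrt y\<rfloor>" using True by simp
  have m: "real m = of_int \<lfloor>sqrt y\<rfloor>" using m0 by (simp add: m_def)
  have "real m \<le> sqrt y" unfolding m by simp
  then have "(real m)\<^sup>2 \<le> (sqrt y)\<^sup>2" by (intro power_mono) auto
  then have m2: "(real m)\<^sup>2 \<le> y" using True by simp
  have "int (m ^ 2) \<le> \<lfloor>y\<rfloor>" using m2 by (simp add: le_floor_iff)
  then have "real m ^ 2 \<le> of_int \<lfloor>y\<rfloor>" by (metis of_int_le_iff of_int_of_nat_eq of_nat_power)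
  then have gm: "g m \<le> 1 / sqrt (frac y)"
    using True unfolding g_def frac_def by (intro frac_le) (auto simp: frac_def)
  have sub: "{j::int. (real_of_int j)\<^sup>2 < y} \<subseteq> {- int m..int m}"
  proof
    fix j :: int assume "j \<in> {j. (real_of_int j)\<^sup>2 < y}"
    then have "\<bar>of_int j\<bar> < sqrt y" by (metis mem_Collect_eq real_less_rsqrt power2_abs)
    then have "\<bar>j\<bar> \<le> \<lfloor>sqrt y\<rfloor>" by (simp add: le_floor_iff)
    then show "j \<in> {- int m..int m}" using m0 by (auto simp: m_def)
  qed
  have gn: "0 \<le> g j" if "j \<le> m" for j
  proof -
    have "(real j)\<^sup>2 \<le> (real m)\<^sup>2" using that by (intro power_mono) auto
    then show ?thesis using m2 unfolding g_def by (simp only: zero_le_divide_1_iff real_sqrt_ge_0_iff)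
  qed
  have "(\<integral>\<^sup>+ j. indicator {j. (real_of_int j)\<^sup>2 < y} j * ennreal (1 / sqrt (y - (of_int j)\<^sup>2)) \<partial>count_space UNIV)
     \<le> (\<integral>\<^sup>+ j. indicator {- int m..int m} j * ennreal (g (nat \<bar>j\<bar>)) \<partial>count_space UNIV)"
    using sub by (intro nn_integral_mono) (auto simp: g_def split: split_indicator)
  also have "\<dots> = (\<Sum>j\<in>{- int m..int m}. indicator {- int m..int m} j * ennreal (g (nat \<bar>j\<bar>)))"
    by (rule nn_integral_count_space') (auto split: split_indicator)
  also have "\<dots> = (\<Sum>j\<in>{- int m..int m}. ennreal (g (nat \<bar>j\<bar>)))"
    by (rule sum.cong) auto
  also have "\<dots> = ennreal (\<Sum>j\<in>{- int m..int m}. g (nat \<bar>j\<bar>))"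
    by (rule sum_ennreal) (auto intro!: gn)
  also have "\<dots> \<le> ennreal (6 * (1 / sqrt (frac y)))"
  proof (rule ennreal_leI)
    \<comment> \<open>The index 0 is counted in both halves, hence only an inequality.\<close>
    have "(\<Sum>j\<in>{- int m..int m}. g (nat \<bar>j\<bar>)) \<le> (\<Sum>j\<in>{- int m..0}. g (nat \<bar>j\<bar>)) + (\<Sum>j\<in>{0..int m}. g (nat \<bar>j\<bar>))"
    proof -
      have "{- int m..int m} = {- int m..0} \<union> {0..int m}" by auto
      then show ?thesis
        using sum.union_inter[of "{- int m..0}" "{0..int m}" "\<lambda>j. g (nat \<bar>j\<bar>)"] gn[of 0]
        by simp
    qed
    also have "(\<Sum>j\<in>{- int m..0}. g (nat \<bar>j\<bar>)) = (\<Sum>j\<le>m. g j)"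
      by (rule sum.reindex_bij_witness[of _ "\<lambda>j. - int j" "\<lambda>j. nat (- j)"]) auto
    also have "(\<Sum>j\<in>{0..int m}. g (nat \<bar>j\<bar>)) = (\<Sum>j\<le>m. g j)"
      by (rule sum.reindex_bij_witness[of _ "\<lambda>j. int j" "\<lambda>j. nat j"]) auto
    also have "(\<Sum>j\<le>m. g j) = (\<Sum>j<m. g j) + g m"
      by (simp add: lessThan_Suc_atMost[symmetric])
    also have "(\<Sum>j<m. g j) \<le> 2" unfolding g_def by (rule sum_rsqrt_diff_squares_le[OF m2])
    finally have "(\<Sum>j\<in>{- int m..int m}. g (nat \<bar>j\<bar>)) \<le> 4 + 2 * (1 / sqrt (frac y))"
      using gm by linarith
    also have "1 \<le> 1 / sqrt (frac y)" using True frac_lt_1[of y] by simp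
    then have "4 + 2 * (1 / sqrt (frac y)) \<le> 6 * (1 / sqrt (frac y))" by linarith
    finally show "(\<Sum>j\<in>{- int m..int m}. g (nat \<bar>j\<bar>)) \<le> 6 * (1 / sqrt (frac y))" .
  qed
  also have "\<dots> = 6 * frac_rsqrt y"
    using True by (simp add: frac_rsqrt_def inverse_ennreal ennreal_mult' flip: inverse_eq_divide)
  finally show ?thesis .
next
  case False
  show ?thesis
  proof (cases "y > 0")
    case True
    then have "frac y = 0" using False frac_ge_0[of y] by linarith
    then have "frac_rsqrt y = inverse (ennreal (sqrt 0))" unfolding frac_rsqrt_def by (rule arg_cong)
    then have "frac_rsqrt y = \<infinity>" by simp
    then show ?thesis by (simp add: ennreal_mult_top)
  next
    case False
    then have "\<not> (real_of_int j)\<^sup>2 < y" for j by (smt (verit) zero_le_power2)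
    then show ?thesis by simp
  qed
qed

text \<open>Substitution of y = 4 a^2 + beta on each half-line: there da = dy / (4 sqrt (y - beta)),
  and the two half-lines together give the factor 1 / 2.\<close>

lemma nn_integral_quadratic_le:
  fixes h :: "real \<Rightarrow> ennreal"
  assumes [measurable]: "h \<in> borel_measurable borel"
  shows "(\<integral>\<^sup>+ a. h (4 * a\<^sup>2 + \<beta>) \<partial>lborel) \<le>
    (\<integral>\<^sup>+ y. indicator {\<beta><..} y * (h y * ennreal (1 / (2 * sqrt (y - \<beta>)))) \<partial>lborel)"
proof -
  define I where "I = (\<integral>\<^sup>+ y. indicator {\<beta><..} y * (h y * ennreal (1 / (4 * sqrt (y - \<beta>)))) \<partial>lborel)"
  \<comment> \<open>The substitution rule is applied on compact intervals starting at 0; monotone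
    convergence then reaches the half-line. The interval of length 0 is handled separately as a null
    set.\<close>
  have piece: "(\<integral>\<^sup>+ a. h (4 * a\<^sup>2 + \<beta>) * indicator {0..real n} a \<partial>lborel) \<le> I" for n
  proof (cases "n = 0")
    case True
    have "AE a in lborel. (a::real) \<noteq> 0" by (rule AE_lborel_singleton)
    then have "AE a in lborel. h (4 * a\<^sup>2 + \<beta>) * indicator {0..real n} a = 0"
      by eventually_elim (auto simp: True)
    then have "(\<integral>\<^sup>+ a. h (4 * a\<^sup>2 + \<beta>) * indicator {0..real n} a \<partial>lborel) = 0"
      by (subst nn_integral_0_iff_AE) auto
    then show ?thesis by simp
  next
    case False
    let ?f = "\<lambda>y. h y * ennreal (1 / (4 * sqrt (y - \<beta>)))"
    let ?g = "\<lambda>a. 4 * a\<^sup>2 + \<beta>"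
    have "(\<integral>\<^sup>+ a. h (4 * a\<^sup>2 + \<beta>) * indicator {0..real n} a \<partial>lborel) =
       (\<integral>\<^sup>+ a. ?f (?g a) * ennreal (8 * a) * indicator {0..real n} a \<partial>lborel)"
    proof (rule nn_integral_cong_AE)
      have "AE a in lborel. (a::real) \<noteq> 0" by (rule AE_lborel_singleton)
      then show "AE a in lborel. h (4 * a\<^sup>2 + \<beta>) * indicator {0..real n} a = ?f (?g a) * ennreal (8 * a) * indicator {0..real n} a"
      proof eventually_elim
        case (elim a)
        then show ?case
          by (cases "a > 0") (auto simp: real_sqrt_mult mult.assoc simp flip: ennreal_mult split: split_indicator)
      qed
    qed
    also have "\<dots> = (\<integral>\<^sup>+ y. ?f y * indicator {?g 0..?g (real n)} y \<partial>lborel)"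
      by (rule nn_integral_substitution_aux[symmetric])
        (use False in \<open>auto intro!: derivative_eq_intros continuous_intros\<close>)
    also have "\<dots> \<le> I" unfolding I_def
    proof (rule nn_integral_mono_AE)
      have "AE y in lborel. (y::real) \<noteq> \<beta>" by (rule AE_lborel_singleton)
      then show "AE y in lborel. ?f y * indicator {?g 0..?g (real n)} y \<le> indicator {\<beta><..} y * ?f y"
        by eventually_elim (auto split: split_indicator)
    qed
    finally show ?thesis .
  qed
  have half: "(\<integral>\<^sup>+ a. h (4 * a\<^sup>2 + \<beta>) * indicator {0..} a \<partial>lborel) \<le> I"
  proof -
    have "(\<integral>\<^sup>+ a. h (4 * a\<^sup>2 + \<beta>) * indicator {0..} a \<partial>lborel) =
      (\<integral>\<^sup>+ a. (SUP n. h (4 * a\<^sup>2 + \<beta>) * indicator {0..real n} a) \<partial>lborel)"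
    proof (rule nn_integral_cong)
      fix a :: real
      obtain n where n: "a \<le> real n" using real_arch_simple by blast
      show "h (4 * a\<^sup>2 + \<beta>) * indicator {0..} a = (SUP n. h (4 * a\<^sup>2 + \<beta>) * indicator {0..real n} a)"
        by (rule antisym; (rule SUP_upper2[of n] SUP_least)) (use n in \<open>auto split: split_indicator\<close>)
    qed
    also have "\<dots> = (SUP n. \<integral>\<^sup>+ a. h (4 * a\<^sup>2 + \<beta>) * indicator {0..real n} a \<partial>lborel)"
      by (rule nn_integral_monotone_convergence_SUP)
        (auto simp: incseq_def le_fun_def split: split_indicator)
    also have "\<dots> \<le> I" by (rule SUP_least) (rule piece)
    finally show ?thesis .
  qed
  have "(\<integral>\<^sup>+ a. h (4 * a\<^sup>2 + \<beta>) \<partial>lborel) \<le>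
    (\<integral>\<^sup>+ a. h (4 * a\<^sup>2 + \<beta>) * indicator {0..} a + h (4 * a\<^sup>2 + \<beta>) * indicator {0..} (- a) \<partial>lborel)"
    by (rule nn_integral_mono) (auto split: split_indicator)
  also have "\<dots> = (\<integral>\<^sup>+ a. h (4 * a\<^sup>2 + \<beta>) * indicator {0..} a \<partial>lborel) +
     (\<integral>\<^sup>+ a. h (4 * a\<^sup>2 + \<beta>) * indicator {0..} (- a) \<partial>lborel)"
    by (rule nn_integral_add) auto
  also have "(\<integral>\<^sup>+ a. h (4 * a\<^sup>2 + \<beta>) * indicator {0..} (- a) \<partial>lborel) = (\<integral>\<^sup>+ a. h (4 * a\<^sup>2 + \<beta>) * indicator {0..} a \<partial>lborel)"
    by (subst nn_integral_real_affine[where t = 0 and c = "-1"]) auto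
  also have "\<dots> + \<dots> \<le> I + I" by (intro add_mono half)
  also have "\<dots> = (\<integral>\<^sup>+ y. indicator {\<beta><..} y * (h y * ennreal (1 / (2 * sqrt (y - \<beta>)))) \<partial>lborel)"
  proof -
    have "I + I = (\<integral>\<^sup>+ y. indicator {\<beta><..} y * (h y * ennreal (1 / (4 * sqrt (y - \<beta>)))) +
       indicator {\<beta><..} y * (h y * ennreal (1 / (4 * sqrt (y - \<beta>)))) \<partial>lborel)"
      unfolding I_def by (rule nn_integral_add[symmetric]) auto
    also have "\<dots> = (\<integral>\<^sup>+ y. indicator {\<beta><..} y * (h y * ennreal (1 / (2 * sqrt (y - \<beta>)))) \<partial>lborel)"
      by (intro nn_integral_cong)
        (auto simp flip: distrib_left ennreal_plus split: split_indicator)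
    finally show ?thesis .
  qed
  finally show ?thesis .
qed

section \<open>Convolution of inverse square root singularities\<close>

lemma nn_integral_rsqrt:
  assumes "0 \<le> c"
  shows "(\<integral>\<^sup>+ x. ennreal (1 / sqrt x) * indicator {0..c} x \<partial>lborel) \<le> ennreal (2 * sqrt c)"
proof (cases "c = 0")
  case True
  have "AE x in lborel. (x::real) \<noteq> 0" by (rule AE_lborel_singleton)
  then have "AE x in lborel. ennreal (1 / sqrt x) * indicator {0..c} x = 0"
    by eventually_elim (auto simp: True)
  then have "(\<integral>\<^sup>+ x. ennreal (1 / sqrt x) * indicator {0..c} x \<partial>lborel) = 0"
    by (subst nn_integral_0_iff_AE) auto
  then show ?thesis by simp
next
  case False
  let ?g = "\<lambda>a::real. a\<^sup>2"
  have "(\<integral>\<^sup>+ x. ennreal (1 / sqrt x) * indicator {?g 0..?g (sqrt c)} x \<partial>lborel) =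
    (\<integral>\<^sup>+ a. ennreal (1 / sqrt (?g a)) * ennreal (2 * a) * indicator {0..sqrt c} a \<partial>lborel)"
    by (rule nn_integral_substitution_aux)
        (use False assms in \<open>auto intro!: derivative_eq_intros continuous_intros\<close>)
  also have "\<dots> \<le> (\<integral>\<^sup>+ a. ennreal 2 * indicator {0..sqrt c} a \<partial>lborel)"
    by (rule nn_integral_mono) (auto simp flip: ennreal_mult split: split_indicator)
  also have "\<dots> = ennreal 2 * ennreal (sqrt c)"
    using assms by (subst nn_integral_cmult_indicator) auto
  also have "\<dots> = ennreal (2 * sqrt c)" using assms by (subst ennreal_mult) auto
  finally show ?thesis using assms by simp
qed

lemma nn_integral_rsqrt_reflect:
  assumes "0 \<le> c"
  shows "(\<integral>\<^sup>+ x. ennreal (1 / sqrt (d - x)) * indicator {d - c..d} x \<partial>lborel) \<le> ennreal (2 * sqrt c)"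
proof -
  have "(\<integral>\<^sup>+ x. ennreal (1 / sqrt (d - x)) * indicator {d - c..d} x \<partial>lborel) =
    (\<integral>\<^sup>+ x. ennreal (1 / sqrt x) * indicator {0..c} x \<partial>lborel)"
    by (subst nn_integral_real_affine[where t = d and c = "-1"]) (auto intro!: nn_integral_cong split: split_indicator)
  then show ?thesis using nn_integral_rsqrt[OF assms] by simp
qed

text \<open>The larger of \<open>x\<close> and \<open>z\<close> is at least half of
  \<open>x + z\<close>, so its inverse root is bounded by the prefactor while the other factor is
  kept. This separates a product of two singularities into a sum, which is useful because
  \<open>x + z\<close> will be constant.\<close>

lemma rsqrt_mult_le:
  fixes x z :: real
  assumes "0 < x" "0 < z"
  shows "1 / sqrt x * (1 / sqrt z) \<le> sqrt (2 / (x + z)) * (1 / sqrt x + 1 / sqrt z)"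
proof -
  have *: "1 / sqrt u \<le> sqrt (2 / (x + z))" if "(x + z) / 2 \<le> u" for u
  proof -
    have "1 / u \<le> 2 / (x + z)" using that assms by (simp add: divide_simps split: if_splits)
    then have "sqrt (1 / u) \<le> sqrt (2 / (x + z))" by (rule real_sqrt_le_mono)
    then show ?thesis by (simp add: real_sqrt_divide)
  qed
  consider "(x + z) / 2 \<le> x" | "(x + z) / 2 \<le> z" by argo
  then show ?thesis
  proof cases
    case 1
    have "1 / sqrt x * (1 / sqrt z) \<le> sqrt (2 / (x + z)) * (1 / sqrt z)"
      using * 1 assms by (intro mult_right_mono) auto
    also have "\<dots> \<le> sqrt (2 / (x + z)) * (1 / sqrt x + 1 / sqrt z)"
      using assms by (intro mult_left_mono) auto
    finally show ?thesis .
  next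
    case 2
    have "1 / sqrt x * (1 / sqrt z) \<le> 1 / sqrt x * sqrt (2 / (x + z))"
      using * 2 assms by (intro mult_left_mono) auto
    also have "\<dots> \<le> sqrt (2 / (x + z)) * (1 / sqrt x + 1 / sqrt z)"
      using assms by (subst mult.commute, intro mult_left_mono) auto
    finally show ?thesis .
  qed
qed

text \<open>With theta the fractional part of \<open>V\<close>, the fractional part of
  \<open>V - x\<close> is theta - x below theta and 1 + theta - x above it, so in
  \<open>rsqrt_mult_le\<close> the sum of the arguments is the constant theta or 1 + theta. Below
  theta the prefactor sqrt (2 / theta) is compensated by integrals of size 2 sqrt theta, even when
  theta tends to 0 and the two singularities merge. The reflection in \<open>V - x\<close> is
  essential: with \<open>V + x\<close> in its place the integral would diverge logarithmically as
  \<open>V\<close> tends to 0 from above.\<close>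

lemma frac_rsqrt_cell_convolution:
  "(\<integral>\<^sup>+ x. indicator {0..<1} x * (frac_rsqrt x * frac_rsqrt (V - x)) \<partial>lborel) \<le> 16"
proof -
  define \<theta> where "\<theta> = frac V"
  have \<theta>: "0 \<le> \<theta>" "\<theta> < 1" by (auto simp: \<theta>_def frac_lt_1)
  \<comment> \<open>\<open>?A\<close> majorises below theta and \<open>?B\<close> above it. The left
    ends are written in the form \<open>d - c\<close> of \<open>nn_integral_rsqrt_reflect\<close>.
    For theta = 0 the prefactor of \<open>?A\<close> is 0 by the convention for division, which is
    consistent because no positive \<open>x\<close> lies below theta.\<close>
  let ?A = "\<lambda>x. ennreal (sqrt (2 / \<theta>)) * (ennreal (1 / sqrt x) * indicator {0..\<theta>} x + ennreal (1 / sqrt (\<theta> - x)) * indicator {\<theta> - \<theta>..\<theta>} x)"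
  let ?B = "\<lambda>x. ennreal (sqrt 2) * (ennreal (1 / sqrt x) * indicator {0..1} x + ennreal (1 / sqrt (1 + \<theta> - x)) * indicator {1 + \<theta> - 1..1 + \<theta>} x)"
  have "(\<integral>\<^sup>+ x. indicator {0..<1} x * (frac_rsqrt x * frac_rsqrt (V - x)) \<partial>lborel) \<le> (\<integral>\<^sup>+ x. ?A x + ?B x \<partial>lborel)"
  proof (rule nn_integral_mono_AE)
    have "AE x in lborel. (x::real) \<noteq> 0" "AE x in lborel. (x::real) \<noteq> \<theta>" by (rule AE_lborel_singleton)+
    then show "AE x in lborel. indicator {0..<1} x * (frac_rsqrt x * frac_rsqrt (V - x)) \<le> ?A x + ?B x"
    proof eventually_elim
      case (elim x)
      show ?case
      proof (cases "0 < x \<and> x < 1")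
        case True
        then have fx: "frac x = x" by (simp add: frac_eq)
        have V: "V = of_int \<lfloor>V\<rfloor> + \<theta>" by (simp add: \<theta>_def frac_def)
        have main: "frac_rsqrt x * frac_rsqrt (V - x) \<le>
           ennreal (sqrt (2 / (x + z))) * (ennreal (1 / sqrt x) + ennreal (1 / sqrt z))"
          if z: "frac (V - x) = z" "0 < z" for z
        proof -
          have "frac_rsqrt x * frac_rsqrt (V - x) = ennreal (1 / sqrt x * (1 / sqrt z))"
            using True z by (simp add: frac_rsqrt_def fx inverse_ennreal inverse_eq_divide flip: ennreal_mult)
          also have "\<dots> \<le> ennreal (sqrt (2 / (x + z)) * (1 / sqrt x + 1 / sqrt z))"
            using True z by (intro ennreal_leI rsqrt_mult_le) auto
          also have "\<dots> = ennreal (sqrt (2 / (x + z))) * (ennreal (1 / sqrt x) + ennreal (1 / sqrt z))"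
            using True z by (subst ennreal_mult) auto
          finally show ?thesis .
        qed
        show ?thesis
        proof (cases "x < \<theta>")
          case less: True
          have "frac (V - x) = frac (of_int \<lfloor>V\<rfloor> + (\<theta> - x))" using V by (simp add: algebra_simps)
          also have "\<dots> = \<theta> - x" unfolding frac_add_of_int using less True \<theta> by (simp add: frac_eq)
          finally have z: "frac (V - x) = \<theta> - x" .
          have "indicator {0..<1} x * (frac_rsqrt x * frac_rsqrt (V - x)) \<le> ?A x"
            using main[OF z] less True by simp
          then show ?thesis by (rule order.trans) simp
        next
          case False
          then have gt: "\<theta> < x" using elim by simp
          have "frac (V - x) = frac (of_int (\<lfloor>V\<rfloor> - 1) + (1 + \<theta> - x))" using V by (simp add: algebra_simps)
          also have "\<dots> = 1 + \<theta> - x" unfolding frac_add_of_int using gt True \<theta> by (simp add: frac_eq)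
          finally have z: "frac (V - x) = 1 + \<theta> - x" .
          \<comment> \<open>Here the two arguments add up to 1 + theta, which is at least 1, so the
            prefactor never exceeds sqrt 2.\<close>
          have "indicator {0..<1} x * (frac_rsqrt x * frac_rsqrt (V - x)) \<le>
             ennreal (sqrt (2 / (1 + \<theta>))) * (ennreal (1 / sqrt x) + ennreal (1 / sqrt (1 + \<theta> - x)))"
            using main[OF z] gt True \<theta> by (simp add: add.assoc[symmetric])
          also have "\<dots> \<le> ennreal (sqrt 2) * (ennreal (1 / sqrt x) + ennreal (1 / sqrt (1 + \<theta> - x)))"
            using \<theta> by (intro mult_right_mono ennreal_leI real_sqrt_le_mono) (auto simp: divide_simps)
          also have "\<dots> = ?B x" using gt True \<theta> by simp
          also have "\<dots> \<le> ?A x + ?B x" by simp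
          finally show ?thesis .
        qed
      qed (use elim in \<open>auto split: split_indicator\<close>)
    qed
  qed
  also have "\<dots> = ennreal (sqrt (2 / \<theta>)) * ((\<integral>\<^sup>+ x. ennreal (1 / sqrt x) * indicator {0..\<theta>} x \<partial>lborel) + (\<integral>\<^sup>+ x. ennreal (1 / sqrt (\<theta> - x)) * indicator {\<theta> - \<theta>..\<theta>} x \<partial>lborel))
     + ennreal (sqrt 2) * ((\<integral>\<^sup>+ x. ennreal (1 / sqrt x) * indicator {0..1} x \<partial>lborel) + (\<integral>\<^sup>+ x. ennreal (1 / sqrt (1 + \<theta> - x)) * indicator {1 + \<theta> - 1..1 + \<theta>} x \<partial>lborel))"
    by (simp add: nn_integral_add nn_integral_cmult)
  also have "\<dots> \<le> ennreal (sqrt (2 / \<theta>)) * (ennreal (2 * sqrt \<theta>) + ennreal (2 * sqrt \<theta>)) + ennreal (sqrt 2) * (ennreal (2 * sqrt 1) + ennreal (2 * sqrt 1))"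
    by (intro add_mono mult_left_mono nn_integral_rsqrt nn_integral_rsqrt_reflect \<theta>) auto
  also have "\<dots> = ennreal (sqrt (2 / \<theta>) * (4 * sqrt \<theta>) + sqrt 2 * 4)"
  proof -
    have "ennreal (2 * sqrt \<theta>) + ennreal (2 * sqrt \<theta>) = ennreal (4 * sqrt \<theta>)"
      and "ennreal (2 * sqrt 1) + ennreal (2 * sqrt 1) = ennreal 4"
      using \<theta> by (simp_all flip: ennreal_plus)
    then show ?thesis using \<theta> by (simp only:) (subst ennreal_plus, auto simp: ennreal_mult)
  qed
  also have "\<dots> \<le> ennreal 16"
  proof (rule ennreal_leI)
    have "sqrt (2 / \<theta>) * (4 * sqrt \<theta>) \<le> 4 * sqrt 2"
      using \<theta> by (cases "\<theta> = 0") (auto simp: real_sqrt_divide)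
    moreover have "sqrt 2 \<le> sqrt 4" by (rule real_sqrt_le_mono) simp
    ultimately show "sqrt (2 / \<theta>) * (4 * sqrt \<theta>) + sqrt 2 * 4 \<le> 16" by simp
  qed
  finally show ?thesis by simp
qed

lemma nn_integral_unit_cells:
  fixes f :: "real \<Rightarrow> ennreal"
  assumes [measurable]: "f \<in> borel_measurable borel"
  shows "(\<integral>\<^sup>+ x. f x \<partial>lborel) =
    (\<integral>\<^sup>+ c. (\<integral>\<^sup>+ x. indicator {0..<1} x * f (of_int c + x) \<partial>lborel) \<partial>count_space (UNIV :: int set))"
proof -
  have "(\<integral>\<^sup>+ x. f x \<partial>lborel) = (\<integral>\<^sup>+ x. (\<integral>\<^sup>+ c. indicator {of_int c..<of_int c + 1} x * f x \<partial>count_space (UNIV :: int set)) \<partial>lborel)"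
  proof (rule nn_integral_cong)
    fix x :: real
    have "(\<integral>\<^sup>+ c. indicator {of_int c..<of_int c + 1} x * f x \<partial>count_space (UNIV :: int set)) =
       (\<Sum>c\<in>{\<lfloor>x\<rfloor>}. indicator {of_int c..<of_int c + 1} x * f x)"
    proof (rule nn_integral_count_space')
      fix c :: int assume "c \<notin> {\<lfloor>x\<rfloor>}"
      then have "x \<notin> {of_int c..<of_int c + 1}" using floor_unique[of c x] by auto
      then show "indicator {of_int c..<of_int c + 1} x * f x = 0" by simp
    qed auto
    then show "f x = (\<integral>\<^sup>+ c. indicator {of_int c..<of_int c + 1} x * f x \<partial>count_space (UNIV :: int set))"
      by simp
  qed
  also have "\<dots> = (\<integral>\<^sup>+ c. (\<integral>\<^sup>+ x. indicator {of_int c..<of_int c + 1} x * f x \<partial>lborel) \<partial>count_space (UNIV :: int set))"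
    by (rule nn_integral_count_space_nn_integral) auto
  also have "\<dots> = (\<integral>\<^sup>+ c. (\<integral>\<^sup>+ x. indicator {0..<1} x * f (of_int c + x) \<partial>lborel) \<partial>count_space (UNIV :: int set))"
  proof (rule nn_integral_cong)
    fix c :: int
    show "(\<integral>\<^sup>+ x. indicator {of_int c..<of_int c + 1} x * f x \<partial>lborel) = (\<integral>\<^sup>+ x. indicator {0..<1} x * f (of_int c + x) \<partial>lborel)"
      by (subst nn_integral_real_affine[where t = "of_int c" and c = 1])
        (auto intro!: nn_integral_cong split: split_indicator)
  qed
  finally show ?thesis .
qed

lemma sum_int_inverse_square_finite:
  "(\<integral>\<^sup>+ j. ennreal (1 / (1 + (real_of_int j)\<^sup>2)) \<partial>count_space (UNIV :: int set)) < \<infinity>"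
proof -
  let ?g = "\<lambda>j::int. ennreal (1 / (1 + (real_of_int j)\<^sup>2))"
  have "summable (\<lambda>n. 1 / (1 + (real n)\<^sup>2))"
  proof (rule summable_comparison_test')
    show "summable (\<lambda>n. inverse ((real n)\<^sup>2))" by (rule inverse_power_summable) simp
    show "norm (1 / (1 + (real n)\<^sup>2)) \<le> inverse ((real n)\<^sup>2)" if "n \<ge> 1" for n
      using that by (auto simp: inverse_eq_divide intro!: frac_le)
  qed
  then have fin: "(\<integral>\<^sup>+ n. ennreal (1 / (1 + (real n)\<^sup>2)) \<partial>count_space (UNIV :: nat set)) < \<infinity>"
    unfolding nn_integral_count_space_nat
    by (subst suminf_ennreal2) auto
  have "(\<integral>\<^sup>+ j. ?g j \<partial>count_space UNIV) \<le> (\<integral>\<^sup>+ j. ?g j * indicator (range int) j + ?g j * indicator (range (\<lambda>n. - int n)) j \<partial>count_space UNIV)"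
  proof (rule nn_integral_mono)
    fix j :: int
    have "j \<in> range int \<or> j \<in> range (\<lambda>n. - int n)"
      by (cases j rule: int_cases2) auto
    then show "?g j \<le> ?g j * indicator (range int) j + ?g j * indicator (range (\<lambda>n. - int n)) j"
      by auto
  qed
  also have "\<dots> = (\<integral>\<^sup>+ j. ?g j \<partial>count_space (range int)) + (\<integral>\<^sup>+ j. ?g j \<partial>count_space (range (\<lambda>n. - int n)))"
    by (subst nn_integral_add) (auto simp: nn_integral_count_space_indicator)
  also have "(\<integral>\<^sup>+ j. ?g j \<partial>count_space (range int)) = (\<integral>\<^sup>+ n. ?g (int n) \<partial>count_space UNIV)"
    by (rule nn_integral_bij_count_space[symmetric]) (auto simp: bij_betw_def)
  also have "(\<integral>\<^sup>+ j. ?g j \<partial>count_space (range (\<lambda>n. - int n))) = (\<integral>\<^sup>+ n. ?g (- int n) \<partial>count_space UNIV)"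
    by (rule nn_integral_bij_count_space[symmetric]) (auto simp: bij_betw_def inj_on_def)
  finally show ?thesis using fin by (simp add: less_top[symmetric] top_unique) (auto simp: top_unique)
qed

text \<open>Only the inequality 1 + u <= exp u enters; the resulting quadratic decay is already
  summable over unit cells.\<close>

lemma gauss_kernel_one_le:
  "gauss_kernel 1 p \<le> sqrt (2 * pi) / (1 + p\<^sup>2 / 2)"
proof -
  have "1 + p\<^sup>2 / 2 \<le> exp (p\<^sup>2 / 2)" by (rule exp_ge_add_one_self)
  moreover have "0 < 1 + p\<^sup>2 / 2" by (simp add: add_pos_nonneg)
  ultimately have "exp (- (p\<^sup>2 / 2)) \<le> 1 / (1 + p\<^sup>2 / 2)"
    by (simp only: exp_minus inverse_eq_divide) (intro frac_le, auto)
  then have "sqrt (2 * pi) * exp (- (p\<^sup>2 / 2)) \<le> sqrt (2 * pi) * (1 / (1 + p\<^sup>2 / 2))"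
    by (rule mult_left_mono) simp
  then show ?thesis by (simp add: gauss_kernel_def)
qed

text \<open>On the cell of \<open>c\<close> the integer n = floor (2 alpha) - c differs from 2p,
  where \<open>p\<close> is the argument of the kernel, by at most 1. Hence n^2 <= 8 p^2 + 2, and 1
  + n^2 <= 16 (1 + p^2 / 2); the factor 16 is what matches the term 8 p^2.\<close>

lemma gauss_kernel_cell_le:
  assumes "0 \<le> x" "x < 1"
  shows "gauss_kernel 1 (\<alpha> - (of_int c + x) / 2) \<le> 16 * sqrt (2 * pi) * (1 / (1 + (of_int (\<lfloor>2 * \<alpha>\<rfloor> - c))\<^sup>2))"
proof -
  define p where "p = \<alpha> - (of_int c + x) / 2"
  let ?p = p and ?n = "real_of_int (\<lfloor>2 * \<alpha>\<rfloor> - c)"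
  define e where "e = ?n - 2 * ?p"
  have "\<bar>e\<bar> \<le> 1" unfolding e_def p_def using assms
    by (simp add: field_simps abs_le_iff) linarith
  then have "e\<^sup>2 \<le> 1" by (simp add: abs_square_le_1)
  moreover have "?n = 2 * ?p + e" by (simp add: e_def)
  then have "?n\<^sup>2 \<le> 2 * (2 * ?p)\<^sup>2 + 2 * e\<^sup>2"
    using sum_squares_bound[of "2 * ?p" e] by (simp only: power2_sum)
  ultimately have "1 + ?n\<^sup>2 \<le> 16 * (1 + ?p\<^sup>2 / 2)" by (simp add: power_mult_distrib)
  moreover have "0 < 1 + ?n\<^sup>2" "0 < 1 + ?p\<^sup>2 / 2" by (simp_all add: add_pos_nonneg)
  ultimately have "1 / (1 + ?p\<^sup>2 / 2) \<le> 16 * (1 / (1 + ?n\<^sup>2))"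
    by (simp add: divide_simps mult.commute)
  then have "sqrt (2 * pi) * (1 / (1 + ?p\<^sup>2 / 2)) \<le> sqrt (2 * pi) * (16 * (1 / (1 + ?n\<^sup>2)))"
    by (rule mult_left_mono) auto
  then show ?thesis using gauss_kernel_one_le[of ?p] by (simp add: mult_ac flip: p_def)
qed

text \<open>The weight rho has period 1, so every unit cell contributes the same convolution, at
  most 16, times the largest Gaussian value on the cell. These values sum to a bound independent of
  alpha, since alpha only translates the index by an integer.\<close>

lemma convolution_bound:
  obtains C :: real where "0 \<le> C"
    "\<And>\<alpha> V. (\<integral>\<^sup>+ y. ennreal (gauss_kernel 1 (\<alpha> - y / 2)) * (frac_rsqrt y * frac_rsqrt (V - y)) \<partial>lborel) \<le> ennreal C"
proof -
  let ?D = "\<integral>\<^sup>+ j. ennreal (1 / (1 + (real_of_int j)\<^sup>2)) \<partial>count_space (UNIV :: int set)"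
  let ?C = "ennreal (16 * sqrt (2 * pi)) * ?D * 16"
  have fin: "?C < \<infinity>" using sum_int_inverse_square_finite by (simp add: ennreal_mult_less_top)
  have "(\<integral>\<^sup>+ y. ennreal (gauss_kernel 1 (\<alpha> - y / 2)) * (frac_rsqrt y * frac_rsqrt (V - y)) \<partial>lborel) \<le> ?C" for \<alpha> V
  proof -
    let ?d = "\<lambda>c. ennreal (16 * sqrt (2 * pi)) * ennreal (1 / (1 + (real_of_int (\<lfloor>2 * \<alpha>\<rfloor> - c))\<^sup>2))"
    have "(\<integral>\<^sup>+ y. ennreal (gauss_kernel 1 (\<alpha> - y / 2)) * (frac_rsqrt y * frac_rsqrt (V - y)) \<partial>lborel) =
      (\<integral>\<^sup>+ c. (\<integral>\<^sup>+ x. indicator {0..<1} x * (ennreal (gauss_kernel 1 (\<alpha> - (of_int c + x) / 2)) *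
         (frac_rsqrt (of_int c + x) * frac_rsqrt (V - (of_int c + x)))) \<partial>lborel) \<partial>count_space (UNIV :: int set))"
      by (rule nn_integral_unit_cells) measurable
    also have "\<dots> \<le> (\<integral>\<^sup>+ c. ?d c * 16 \<partial>count_space (UNIV :: int set))"
    proof (rule nn_integral_mono)
      fix c :: int
      have "(\<integral>\<^sup>+ x. indicator {0..<1} x * (ennreal (gauss_kernel 1 (\<alpha> - (of_int c + x) / 2)) *
           (frac_rsqrt (of_int c + x) * frac_rsqrt (V - (of_int c + x)))) \<partial>lborel) \<le>
         (\<integral>\<^sup>+ x. ?d c * (indicator {0..<1} x * (frac_rsqrt x * frac_rsqrt (V - x))) \<partial>lborel)"
      proof (rule nn_integral_mono)
        fix x :: real
        have per: "frac_rsqrt (of_int c + x) = frac_rsqrt x" "frac_rsqrt (V - (of_int c + x)) = frac_rsqrt (V - x)"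
          using frac_diff_of_int[of "V - x" c] by (simp_all add: frac_rsqrt_def frac_add_of_int algebra_simps)
        have "ennreal (gauss_kernel 1 (\<alpha> - (of_int c + x) / 2)) \<le> ?d c" if "x \<in> {0..<1}"
        proof -
          have "?d c = ennreal (16 * sqrt (2 * pi) * (1 / (1 + (of_int (\<lfloor>2 * \<alpha>\<rfloor> - c))\<^sup>2)))"
            by (rule ennreal_mult[symmetric]) auto
          then show ?thesis using that gauss_kernel_cell_le[of x \<alpha> c] by (simp only: ennreal_leI atLeastLessThan_iff)
        qed
        then show "indicator {0..<1} x * (ennreal (gauss_kernel 1 (\<alpha> - (of_int c + x) / 2)) *
           (frac_rsqrt (of_int c + x) * frac_rsqrt (V - (of_int c + x)))) \<le>
            ?d c * (indicator {0..<1} x * (frac_rsqrt x * frac_rsqrt (V - x)))"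
          unfolding per by (auto intro!: mult_right_mono split: split_indicator)
      qed
      also have "\<dots> = ?d c * (\<integral>\<^sup>+ x. indicator {0..<1} x * (frac_rsqrt x * frac_rsqrt (V - x)) \<partial>lborel)"
        by (rule nn_integral_cmult) measurable
      also have "\<dots> \<le> ?d c * 16" by (intro mult_left_mono frac_rsqrt_cell_convolution) auto
      finally show "(\<integral>\<^sup>+ x. indicator {0..<1} x * (ennreal (gauss_kernel 1 (\<alpha> - (of_int c + x) / 2)) *
           (frac_rsqrt (of_int c + x) * frac_rsqrt (V - (of_int c + x)))) \<partial>lborel) \<le> ?d c * 16" .
    qed
    also have "\<dots> = ennreal (16 * sqrt (2 * pi)) * (\<integral>\<^sup>+ c. ennreal (1 / (1 + (real_of_int (\<lfloor>2 * \<alpha>\<rfloor> - c))\<^sup>2)) \<partial>count_space (UNIV :: int set)) * 16"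
      by (simp add: nn_integral_multc nn_integral_cmult)
    also have "(\<integral>\<^sup>+ c. ennreal (1 / (1 + (real_of_int (\<lfloor>2 * \<alpha>\<rfloor> - c))\<^sup>2)) \<partial>count_space (UNIV :: int set)) = ?D"
      by (rule nn_integral_bij_count_space[where f = "\<lambda>j. ennreal (1 / (1 + (real_of_int j)\<^sup>2))"])
        (auto intro!: bij_betwI[where g = "\<lambda>c. \<lfloor>2 * \<alpha>\<rfloor> - c"])
    finally show ?thesis .
  qed
  moreover from fin have "?C = ennreal (enn2real ?C)" by simp
  ultimately show ?thesis by (intro that[of "enn2real ?C"]) auto
qed

text \<open>Here \<open>y\<close> and \<open>z\<close> stand for the energies of the two pairs up to
  shift and scale. In the variables \<open>y\<close> and V = y + z, the integral over
  \<open>y\<close> is \<open>convolution_bound\<close> at fixed total \<open>V\<close>, and the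
  remaining Gaussian in V / 2 has mass 4 pi for every sigma.\<close>

lemma two_frequency_bound:
  obtains C :: real where "0 \<le> C"
    "\<And>\<sigma> \<alpha> \<beta>. 0 < \<sigma> \<Longrightarrow> (\<integral>\<^sup>+ y. frac_rsqrt y * (ennreal (gauss_kernel 1 (\<alpha> - y / 2)) *
        (\<integral>\<^sup>+ z. frac_rsqrt z * ennreal (gauss_kernel \<sigma> (\<beta> - (y + z) / 2)) \<partial>lborel)) \<partial>lborel) \<le> ennreal C"
proof -
  from convolution_bound obtain C where C: "0 \<le> C"
    "\<And>\<alpha> V. (\<integral>\<^sup>+ y. ennreal (gauss_kernel 1 (\<alpha> - y / 2)) * (frac_rsqrt y * frac_rsqrt (V - y)) \<partial>lborel) \<le> ennreal C"
    by blast
  have "(\<integral>\<^sup>+ y. frac_rsqrt y * (ennreal (gauss_kernel 1 (\<alpha> - y / 2)) *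
        (\<integral>\<^sup>+ z. frac_rsqrt z * ennreal (gauss_kernel \<sigma> (\<beta> - (y + z) / 2)) \<partial>lborel)) \<partial>lborel) \<le> ennreal (4 * pi * C)"
    if \<sigma>: "0 < \<sigma>" for \<sigma> \<alpha> \<beta>
  proof -
    have "(\<integral>\<^sup>+ y. frac_rsqrt y * (ennreal (gauss_kernel 1 (\<alpha> - y / 2)) *
        (\<integral>\<^sup>+ z. frac_rsqrt z * ennreal (gauss_kernel \<sigma> (\<beta> - (y + z) / 2)) \<partial>lborel)) \<partial>lborel) =
      (\<integral>\<^sup>+ y. frac_rsqrt y * (ennreal (gauss_kernel 1 (\<alpha> - y / 2)) *
        (\<integral>\<^sup>+ V. frac_rsqrt (V - y) * ennreal (gauss_kernel \<sigma> (\<beta> - V / 2)) \<partial>lborel)) \<partial>lborel)"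
    proof (rule nn_integral_cong)
      fix y :: real
      have "(\<integral>\<^sup>+ z. frac_rsqrt z * ennreal (gauss_kernel \<sigma> (\<beta> - (y + z) / 2)) \<partial>lborel) =
        (\<integral>\<^sup>+ V. frac_rsqrt (V - y) * ennreal (gauss_kernel \<sigma> (\<beta> - V / 2)) \<partial>lborel)"
        by (subst nn_integral_real_affine[where t = "- y" and c = 1]) (auto simp: algebra_simps)
      then show "frac_rsqrt y * (ennreal (gauss_kernel 1 (\<alpha> - y / 2)) *
        (\<integral>\<^sup>+ z. frac_rsqrt z * ennreal (gauss_kernel \<sigma> (\<beta> - (y + z) / 2)) \<partial>lborel)) =
        frac_rsqrt y * (ennreal (gauss_kernel 1 (\<alpha> - y / 2)) *
        (\<integral>\<^sup>+ V. frac_rsqrt (V - y) * ennreal (gauss_kernel \<sigma> (\<beta> - V / 2)) \<partial>lborel))" by simp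
    qed
    also have "\<dots> = (\<integral>\<^sup>+ y. (\<integral>\<^sup>+ V. ennreal (gauss_kernel \<sigma> (\<beta> - V / 2)) *
       (ennreal (gauss_kernel 1 (\<alpha> - y / 2)) * (frac_rsqrt y * frac_rsqrt (V - y))) \<partial>lborel) \<partial>lborel)"
      by (intro nn_integral_cong) (simp add: mult_ac flip: nn_integral_cmult)
    also have "\<dots> = (\<integral>\<^sup>+ V. (\<integral>\<^sup>+ y. ennreal (gauss_kernel \<sigma> (\<beta> - V / 2)) *
       (ennreal (gauss_kernel 1 (\<alpha> - y / 2)) * (frac_rsqrt y * frac_rsqrt (V - y))) \<partial>lborel) \<partial>lborel)"
      by (rule lborel_pair.Fubini') measurable
    also have "\<dots> = (\<integral>\<^sup>+ V. ennreal (gauss_kernel \<sigma> (\<beta> - V / 2)) * (\<integral>\<^sup>+ y.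
       (ennreal (gauss_kernel 1 (\<alpha> - y / 2)) * (frac_rsqrt y * frac_rsqrt (V - y))) \<partial>lborel) \<partial>lborel)"
      by (intro nn_integral_cong nn_integral_cmult) measurable
    also have "\<dots> \<le> (\<integral>\<^sup>+ V. ennreal (gauss_kernel \<sigma> (\<beta> - V / 2)) * ennreal C \<partial>lborel)"
      by (intro nn_integral_mono mult_left_mono C) auto
    also have "\<dots> = (\<integral>\<^sup>+ V. ennreal (gauss_kernel \<sigma> (\<beta> - V / 2)) \<partial>lborel) * ennreal C"
      by (rule nn_integral_multc) measurable
    also have "(\<integral>\<^sup>+ V. ennreal (gauss_kernel \<sigma> (\<beta> - V / 2)) \<partial>lborel) = ennreal 2 * (\<integral>\<^sup>+ p. ennreal (gauss_kernel \<sigma> (\<beta> - p)) \<partial>lborel)"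
      by (subst nn_integral_real_affine[where t = 0 and c = 2]) auto
    also have "\<dots> * ennreal C = ennreal (4 * pi * C)"
      using C(1) by (simp add: nn_integral_gauss_kernel_diff[OF \<sigma>] flip: ennreal_mult del: ennreal_numeral)
    finally show ?thesis .
  qed
  then show ?thesis using C(1) by (intro that[of "4 * pi * C"]) auto
qed

section \<open>Frequency space and the energy density of one pair\<close>

lemma sigma_finite_frequency_space: "sigma_finite_measure frequency_space"
proof -
  interpret C: sigma_finite_measure "count_space (UNIV :: int set)"
    by (rule sigma_finite_measure_count_space)
  interpret pair_sigma_finite "lborel :: real measure" "count_space (UNIV :: int set)" ..
  show ?thesis unfolding frequency_space_def ..
qed

lemma nn_integral_frequency_space:
  assumes "f \<in> borel_measurable frequency_space"
  shows "(\<integral>\<^sup>+ q. f q \<partial>frequency_space) = (\<integral>\<^sup>+ k. (\<integral>\<^sup>+ \<xi>. f (\<xi>, k) \<partial>lborel) \<partial>count_space UNIV)"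
proof -
  interpret C: sigma_finite_measure "count_space (UNIV :: int set)"
    by (rule sigma_finite_measure_count_space)
  interpret pair_sigma_finite "lborel :: real measure" "count_space (UNIV :: int set)" ..
  show ?thesis
    using assms unfolding frequency_space_def by (intro nn_integral_snd[symmetric]) simp
qed

lemma measurable_frequency_space_components [measurable]:
  "fst \<in> borel_measurable frequency_space" "snd \<in> measurable frequency_space (count_space UNIV)"
  by (auto simp: frequency_space_def)

lemma space_frequency_space [simp]: "space frequency_space = UNIV"
  by (simp add: frequency_space_def space_pair_measure)

text \<open>
  With \<open>p = \<xi>\<^sub>1 + \<xi>\<^sub>2\<close>, \<open>l = k\<^sub>1 + k\<^sub>2\<close> and \<open>a\<close> the deviation of \<open>\<xi>\<^sub>1\<close> from \<open>p / 2\<close>, twice the energy equals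
  \<open>4 a\<^sup>2 + (2 k\<^sub>1 - l)\<^sup>2 + p\<^sup>2 + l\<^sup>2\<close>.
\<close>

lemma nn_integral_pair_energy_le:
  fixes h :: "real \<Rightarrow> real \<Rightarrow> ennreal"
  assumes h [measurable]: "(\<lambda>(p, n). h p n) \<in> borel_measurable (borel \<Otimes>\<^sub>M borel)"
  shows "(\<integral>\<^sup>+ q\<^sub>1. \<integral>\<^sup>+ q\<^sub>2. indicator {l} (snd q\<^sub>1 + snd q\<^sub>2) *
       h (fst q\<^sub>1 + fst q\<^sub>2) ((fst q\<^sub>1)\<^sup>2 + (of_int (snd q\<^sub>1))\<^sup>2 + ((fst q\<^sub>2)\<^sup>2 + (of_int (snd q\<^sub>2))\<^sup>2)) \<partial>frequency_space \<partial>frequency_space)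
     \<le> 3 * (\<integral>\<^sup>+ p. \<integral>\<^sup>+ y. frac_rsqrt y * h p ((y + (p\<^sup>2 + (of_int l)\<^sup>2)) / 2) \<partial>lborel \<partial>lborel)"
proof -
  interpret F: sigma_finite_measure frequency_space by (rule sigma_finite_frequency_space)
  have "(\<integral>\<^sup>+ q\<^sub>2. indicator {l} (snd q\<^sub>1 + snd q\<^sub>2) *
       h (fst q\<^sub>1 + fst q\<^sub>2) ((fst q\<^sub>1)\<^sup>2 + (of_int (snd q\<^sub>1))\<^sup>2 + ((fst q\<^sub>2)\<^sup>2 + (of_int (snd q\<^sub>2))\<^sup>2)) \<partial>frequency_space)
     = (\<integral>\<^sup>+ p. h p ((fst q\<^sub>1)\<^sup>2 + (of_int (snd q\<^sub>1))\<^sup>2 + ((p - fst q\<^sub>1)\<^sup>2 + (of_int (l - snd q\<^sub>1))\<^sup>2)) \<partial>lborel)" for q\<^sub>1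
  proof -
    let ?f = "\<lambda>\<xi> k. h (fst q\<^sub>1 + \<xi>) ((fst q\<^sub>1)\<^sup>2 + (of_int (snd q\<^sub>1))\<^sup>2 + (\<xi>\<^sup>2 + (of_int k)\<^sup>2))"
    have "(\<integral>\<^sup>+ q\<^sub>2. indicator {l} (snd q\<^sub>1 + snd q\<^sub>2) * ?f (fst q\<^sub>2) (snd q\<^sub>2) \<partial>frequency_space)
      = (\<integral>\<^sup>+ k. (\<integral>\<^sup>+ \<xi>. indicator {l} (snd q\<^sub>1 + k) * ?f \<xi> k \<partial>lborel) \<partial>count_space UNIV)"
      by (subst nn_integral_frequency_space) auto
    \<comment> \<open>The indicator forces the second mode to be \<open>l\<close> minus the first,
      so the sum over modes has a single term.\<close>
    also have "\<dots> = (\<Sum>k\<in>{l - snd q\<^sub>1}. (\<integral>\<^sup>+ \<xi>. indicator {l} (snd q\<^sub>1 + k) * ?f \<xi> k \<partial>lborel))"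
      by (rule nn_integral_count_space') (auto simp: algebra_simps)
    also have "\<dots> = (\<integral>\<^sup>+ \<xi>. ?f \<xi> (l - snd q\<^sub>1) \<partial>lborel)" by simp
    also have "\<dots> = (\<integral>\<^sup>+ p. h p ((fst q\<^sub>1)\<^sup>2 + (of_int (snd q\<^sub>1))\<^sup>2 + ((p - fst q\<^sub>1)\<^sup>2 + (of_int (l - snd q\<^sub>1))\<^sup>2)) \<partial>lborel)"
      by (subst nn_integral_real_affine[where t = "- fst q\<^sub>1" and c = 1]) (auto simp: algebra_simps)
    finally show ?thesis .
  qed
  then have "(\<integral>\<^sup>+ q\<^sub>1. \<integral>\<^sup>+ q\<^sub>2. indicator {l} (snd q\<^sub>1 + snd q\<^sub>2) *
       h (fst q\<^sub>1 + fst q\<^sub>2) ((fst q\<^sub>1)\<^sup>2 + (of_int (snd q\<^sub>1))\<^sup>2 + ((fst q\<^sub>2)\<^sup>2 + (of_int (snd q\<^sub>2))\<^sup>2)) \<partial>frequency_space \<partial>frequency_space)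
     = (\<integral>\<^sup>+ q\<^sub>1. \<integral>\<^sup>+ p. h p ((fst q\<^sub>1)\<^sup>2 + (of_int (snd q\<^sub>1))\<^sup>2 + ((p - fst q\<^sub>1)\<^sup>2 + (of_int (l - snd q\<^sub>1))\<^sup>2)) \<partial>lborel \<partial>frequency_space)"
    by simp
  also have "\<dots> = (\<integral>\<^sup>+ k. \<integral>\<^sup>+ \<xi>. \<integral>\<^sup>+ p. h p (\<xi>\<^sup>2 + (of_int k)\<^sup>2 + ((p - \<xi>)\<^sup>2 + (of_int (l - k))\<^sup>2)) \<partial>lborel \<partial>lborel \<partial>count_space UNIV)"
    by (subst nn_integral_frequency_space) auto
  also have "\<dots> = (\<integral>\<^sup>+ k. \<integral>\<^sup>+ p. \<integral>\<^sup>+ \<xi>. h p (\<xi>\<^sup>2 + (of_int k)\<^sup>2 + ((p - \<xi>)\<^sup>2 + (of_int (l - k))\<^sup>2)) \<partial>lborel \<partial>lborel \<partial>count_space UNIV)"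
    by (intro nn_integral_cong lborel_pair.Fubini') measurable
  also have "\<dots> = (\<integral>\<^sup>+ p. \<integral>\<^sup>+ k. \<integral>\<^sup>+ \<xi>. h p (\<xi>\<^sup>2 + (of_int k)\<^sup>2 + ((p - \<xi>)\<^sup>2 + (of_int (l - k))\<^sup>2)) \<partial>lborel \<partial>count_space UNIV \<partial>lborel)"
    by (rule nn_integral_count_space_nn_integral[symmetric]) auto
  also have "\<dots> \<le> (\<integral>\<^sup>+ p. 3 * (\<integral>\<^sup>+ y. frac_rsqrt y * h p ((y + (p\<^sup>2 + (of_int l)\<^sup>2)) / 2) \<partial>lborel) \<partial>lborel)"
  proof (rule nn_integral_mono)
    fix p :: real
    let ?h = "\<lambda>y. h p ((y + (p\<^sup>2 + (of_int l)\<^sup>2)) / 2)"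
    let ?s = "\<lambda>y j. indicator {j. (real_of_int j)\<^sup>2 < y} j * ennreal (1 / sqrt (y - (of_int j)\<^sup>2))"
    have "(\<integral>\<^sup>+ k. \<integral>\<^sup>+ \<xi>. h p (\<xi>\<^sup>2 + (of_int k)\<^sup>2 + ((p - \<xi>)\<^sup>2 + (of_int (l - k))\<^sup>2)) \<partial>lborel \<partial>count_space UNIV)
      = (\<integral>\<^sup>+ k. \<integral>\<^sup>+ a. ?h (4 * a\<^sup>2 + (of_int (2 * k - l))\<^sup>2) \<partial>lborel \<partial>count_space UNIV)"
    proof (rule nn_integral_cong)
      fix k :: int
      have e: "(p / 2 + a)\<^sup>2 + (of_int k)\<^sup>2 + ((p - (p / 2 + a))\<^sup>2 + (of_int (l - k))\<^sup>2) =
         (4 * a\<^sup>2 + (of_int (2 * k - l))\<^sup>2 + (p\<^sup>2 + (of_int l)\<^sup>2)) / 2" for a :: real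
        by (simp add: power2_eq_square field_simps)
      show "(\<integral>\<^sup>+ \<xi>. h p (\<xi>\<^sup>2 + (of_int k)\<^sup>2 + ((p - \<xi>)\<^sup>2 + (of_int (l - k))\<^sup>2)) \<partial>lborel) =
        (\<integral>\<^sup>+ a. ?h (4 * a\<^sup>2 + (of_int (2 * k - l))\<^sup>2) \<partial>lborel)"
        by (subst nn_integral_real_affine[where t = "p / 2" and c = 1]) (auto simp only: e[symmetric], auto)
    qed
    also have "\<dots> \<le> (\<integral>\<^sup>+ k. \<integral>\<^sup>+ y. indicator {(of_int (2 * k - l))\<^sup>2<..} y *
        (?h y * ennreal (1 / (2 * sqrt (y - (of_int (2 * k - l))\<^sup>2)))) \<partial>lborel \<partial>count_space UNIV)"
      by (intro nn_integral_mono nn_integral_quadratic_le) measurable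
    also have "\<dots> = (\<integral>\<^sup>+ y. \<integral>\<^sup>+ k. indicator {(of_int (2 * k - l))\<^sup>2<..} y *
        (?h y * ennreal (1 / (2 * sqrt (y - (of_int (2 * k - l))\<^sup>2)))) \<partial>count_space UNIV \<partial>lborel)"
      by (rule nn_integral_count_space_nn_integral[symmetric]) auto
    also have "\<dots> \<le> (\<integral>\<^sup>+ y. 3 * (frac_rsqrt y * ?h y) \<partial>lborel)"
    proof (rule nn_integral_mono)
      fix y :: real
      have "(\<integral>\<^sup>+ k. indicator {(of_int (2 * k - l))\<^sup>2<..} y *
        (?h y * ennreal (1 / (2 * sqrt (y - (of_int (2 * k - l))\<^sup>2)))) \<partial>count_space UNIV)
        = (\<integral>\<^sup>+ k. ?h y * ennreal (1 / 2) * ?s y (2 * k - l) \<partial>count_space UNIV)"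
      proof -
        have "ennreal (1 / (2 * r)) = ennreal (1 / 2) * ennreal (1 / r)" if "0 \<le> r" for r :: real
          using that by (subst ennreal_mult[symmetric]) auto
        note half = this
        show ?thesis
        proof (rule nn_integral_cong)
          fix k :: int
          let ?R = "sqrt (y - (of_int (2 * k - l))\<^sup>2)"
          show "indicator {(of_int (2 * k - l))\<^sup>2<..} y * (?h y * ennreal (1 / (2 * ?R))) =
            ?h y * ennreal (1 / 2) * ?s y (2 * k - l)"
          proof (cases "(of_int (2 * k - l))\<^sup>2 < y")
            case True
            then have "ennreal (1 / (2 * ?R)) = ennreal (1 / 2) * ennreal (1 / ?R)"
              by (intro half) simp
            then show ?thesis using True by (simp only: indicator_simps mem_Collect_eq greaterThan_iff mult_1 mult.assoc)
          qed simp
        qed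
      qed
      also have "\<dots> = ?h y * ennreal (1 / 2) * (\<integral>\<^sup>+ k. ?s y (2 * k - l) \<partial>count_space (UNIV :: int set))"
        by (rule nn_integral_cmult) simp
      \<comment> \<open>The values \<open>2 * k - l\<close> run injectively through one parity
        class; enlarging it to all integers only increases the sum. The bound 6 rho then combines
        with the factor 1 / 2 of the substitution to the constant 3.\<close>
      also have "(\<integral>\<^sup>+ k. ?s y (2 * k - l) \<partial>count_space (UNIV :: int set)) = (\<integral>\<^sup>+ j. ?s y j \<partial>count_space (range (\<lambda>k. 2 * k - l)))"
        by (rule nn_integral_bij_count_space) (auto simp: bij_betw_def inj_on_def)
      also have "\<dots> \<le> (\<integral>\<^sup>+ j. ?s y j \<partial>count_space UNIV)"
        by (subst nn_integral_count_space_indicator) (auto intro!: nn_integral_mono split: split_indicator)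
      also have "\<dots> \<le> 6 * frac_rsqrt y" by (rule sum_int_rsqrt_le)
      also have "?h y * ennreal (1 / 2) * (6 * frac_rsqrt y) = ennreal (1 / 2) * ennreal 6 * (frac_rsqrt y * ?h y)"
        by (simp add: mult_ac)
      also have "ennreal (1 / 2) * ennreal 6 = 3" by (subst ennreal_mult[symmetric]) auto
      finally show "(\<integral>\<^sup>+ k. indicator {(of_int (2 * k - l))\<^sup>2<..} y *
        (?h y * ennreal (1 / (2 * sqrt (y - (of_int (2 * k - l))\<^sup>2)))) \<partial>count_space UNIV) \<le> 3 * (frac_rsqrt y * ?h y)"
        by (simp add: mult_left_mono)
    qed
    also have "\<dots> = 3 * (\<integral>\<^sup>+ y. frac_rsqrt y * ?h y \<partial>lborel)"
      by (rule nn_integral_cmult) measurable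
    finally show "(\<integral>\<^sup>+ k. \<integral>\<^sup>+ \<xi>. h p (\<xi>\<^sup>2 + (of_int k)\<^sup>2 + ((p - \<xi>)\<^sup>2 + (of_int (l - k))\<^sup>2)) \<partial>lborel \<partial>count_space UNIV) \<le>
      3 * (\<integral>\<^sup>+ y. frac_rsqrt y * ?h y \<partial>lborel)" .
  qed
  also have "\<dots> = 3 * (\<integral>\<^sup>+ p. \<integral>\<^sup>+ y. frac_rsqrt y * h p ((y + (p\<^sup>2 + (of_int l)\<^sup>2)) / 2) \<partial>lborel \<partial>lborel)"
    by (rule nn_integral_cmult) measurable
  finally show ?thesis .
qed

section \<open>The two-point function of a free wave\<close>

definition circle :: "real measure" where
  "circle = restrict_space lborel {0..<2 * pi}"

lemma cylinder_eq: "cylinder = lborel \<Otimes>\<^sub>M circle"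
  by (simp add: cylinder_def circle_def)

lemma finite_measure_circle: "finite_measure circle"
  unfolding circle_def by (rule finite_measureI) (simp add: emeasure_restrict_space space_restrict_space)

lemma sigma_finite_circle: "sigma_finite_measure circle"
  using finite_measure_circle by (simp add: finite_measure.axioms)

lemma sigma_finite_cylinder: "sigma_finite_measure cylinder"
proof -
  interpret C: sigma_finite_measure circle by (rule sigma_finite_circle)
  interpret pair_sigma_finite "lborel :: real measure" circle ..
  show ?thesis unfolding cylinder_eq ..
qed

lemma measurable_circle: "f \<in> measurable borel M \<Longrightarrow> f \<in> measurable circle M"
  unfolding circle_def by (rule measurable_restrict_space1) simp

lemma measurable_cylinder_components [measurable]:
  "fst \<in> borel_measurable cylinder" "snd \<in> borel_measurable cylinder"
proof -
  show "fst \<in> borel_measurable cylinder" unfolding cylinder_eq by simp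
  have "snd \<in> measurable cylinder circle" unfolding cylinder_eq by simp
  from measurable_compose[OF this measurable_circle[of "\<lambda>y. y"]] show "snd \<in> borel_measurable cylinder"
    by simp
qed

lemma cis_measurable [measurable (raw)]:
  "f \<in> borel_measurable M \<Longrightarrow> (\<lambda>x. cis (f x)) \<in> borel_measurable M"
  by (rule borel_measurable_continuous_on[of cis]) (auto intro: continuous_intros)

lemma integrable_cis_circle: "integrable circle (\<lambda>y. cis (a * y))"
proof -
  interpret finite_measure circle by (rule finite_measure_circle)
  show ?thesis by (rule integrable_const_bound[where B = 1]) (auto intro!: measurable_circle)
qed

text \<open>Passes from the half-open fundamental domain to the closed interval, on which the
  fundamental theorem of calculus is available; the end point is a null set.\<close>

lemma integral_circle:
  fixes f :: "real \<Rightarrow> complex"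
  assumes "continuous_on {0..2 * pi} f"
  shows "(\<integral>y. f y \<partial>circle) = integral {0..2 * pi} f"
proof -
  have "(\<integral>y. f y \<partial>circle) = (\<integral>y. indicator {0..<2 * pi} y *\<^sub>R f y \<partial>lborel)"
    unfolding circle_def by (subst integral_restrict_space) auto
  also have "\<dots> = (\<integral>y. indicator {0..2 * pi} y *\<^sub>R f y \<partial>lborel)"
  proof (rule integral_cong_AE)
    have "(\<lambda>y. indicator {0..2 * pi} y *\<^sub>R f y) \<in> borel_measurable borel"
      by (rule borel_measurable_continuous_on_indicator) (use assms in auto)
    then show m: "(\<lambda>y. indicator {0..2 * pi} y *\<^sub>R f y) \<in> borel_measurable lborel" by simp
    have "(\<lambda>y. indicator {0..<2 * pi} y *\<^sub>R (indicator {0..2 * pi} y *\<^sub>R f y)) \<in> borel_measurable lborel"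
      using m by measurable
    moreover have "(\<lambda>y. indicator {0..<2 * pi} y *\<^sub>R (indicator {0..2 * pi} y *\<^sub>R f y)) = (\<lambda>y. indicator {0..<2 * pi} y *\<^sub>R f y)"
      by (auto split: split_indicator)
    ultimately show "(\<lambda>y. indicator {0..<2 * pi} y *\<^sub>R f y) \<in> borel_measurable lborel" by simp
    have "AE y in lborel. y \<noteq> 2 * pi" by (rule AE_lborel_singleton)
    then show "AE y in lborel. indicator {0..<2 * pi} y *\<^sub>R f y = indicator {0..2 * pi} y *\<^sub>R f y"
      by eventually_elim (auto split: split_indicator)
  qed
  also have "\<dots> = integral {0..2 * pi} f"
    using set_borel_integral_eq_integral(2)[OF borel_integrable_atLeastAtMost'[OF assms]]
    by (simp add: set_lebesgue_integral_def)
  finally show ?thesis .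
qed

lemma integral_cis_circle:
  "(\<integral>y. cis (of_int n * y) \<partial>circle) = of_real (2 * pi * indicator {0} n)"
proof (cases "n = 0")
  case True
  then show ?thesis
    by (subst integral_circle) (auto intro!: continuous_intros simp: scaleR_conv_of_real)
next
  case False
  let ?F = "\<lambda>y. cis (of_int n * y) / (\<i> * of_int n)"
  have "((\<lambda>y. cis (of_int n * y)) has_integral (?F (2 * pi) - ?F 0)) {0..2 * pi}"
  proof (rule fundamental_theorem_of_calculus)
    fix y :: real
    have "((\<lambda>z. exp (\<i> * of_int n * z) / (\<i> * of_int n)) has_field_derivative exp (\<i> * of_int n * of_real y)) (at (of_real y))"
      using False by (auto intro!: derivative_eq_intros)
    then have "((\<lambda>y. exp (\<i> * of_int n * of_real y) / (\<i> * of_int n)) has_vector_derivative exp (\<i> * of_int n * of_real y)) (at y within {0..2 * pi})"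
      by (rule has_vector_derivative_real_field)
    then show "(?F has_vector_derivative cis (of_int n * y)) (at y within {0..2 * pi})"
      by (simp add: cis_conv_exp mult.assoc)
  qed simp
  then have "integral {0..2 * pi} (\<lambda>y. cis (of_int n * y)) = ?F (2 * pi) - ?F 0" by (rule integral_unique)
  also have "\<dots> = 0" using cis_multiple_2pi[of "of_int n"] by (simp add: mult_ac)
  finally show ?thesis using False by (subst integral_circle) (auto intro!: continuous_intros)
qed

definition energy :: "real \<times> int \<Rightarrow> real" where
  "energy q = (fst q)\<^sup>2 + (of_int (snd q))\<^sup>2"

definition phase :: "real \<Rightarrow> real \<times> real \<Rightarrow> real \<times> int \<Rightarrow> real" where
  "phase t z q = fst q * fst z + of_int (snd q) * snd z - t * energy q"

text \<open>This carries no normalising factor: it is 2 pi times the wave with Fourier data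
  \<open>F\<close>, see \<open>inverse_fourier_dispersion\<close>.\<close>

definition free_wave :: "(real \<times> int \<Rightarrow> complex) \<Rightarrow> real \<Rightarrow> real \<times> real \<Rightarrow> complex" where
  "free_wave F t z = (\<integral>q. F q * cis (phase t z q) \<partial>frequency_space)"

lemma of_int_measurable [measurable (raw)]:
  "f \<in> measurable M (count_space UNIV) \<Longrightarrow> (\<lambda>x. real_of_int (f x)) \<in> borel_measurable M"
  by (rule measurable_compose[of f M "count_space UNIV"]) auto

lemma energy_measurable [measurable]: "energy \<in> borel_measurable frequency_space"
  unfolding energy_def[abs_def] by measurable

lemma phase_measurable [measurable (raw)]:
  assumes [measurable]: "f \<in> borel_measurable M" "g \<in> measurable M cylinder" "h \<in> measurable M frequency_space"
  shows "(\<lambda>x. phase (f x) (g x) (h x)) \<in> borel_measurable M"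
  unfolding phase_def by measurable

lemma free_wave_measurable [measurable (raw)]:
  assumes [measurable]: "F \<in> borel_measurable frequency_space" "f \<in> borel_measurable M" "g \<in> measurable M cylinder"
  shows "(\<lambda>x. free_wave F (f x) (g x)) \<in> borel_measurable M"
proof -
  interpret sigma_finite_measure frequency_space by (rule sigma_finite_frequency_space)
  show ?thesis unfolding free_wave_def by measurable
qed

text \<open>The weight acts in \<open>x\<close> only. In \<open>y\<close> the circle has finite
  measure and its modes are exactly orthogonal, which produces the indicator.\<close>

lemma integral_gauss_cylinder:
  assumes "0 < \<sigma>"
  shows "integrable cylinder (\<lambda>z. of_real (gauss_weight \<sigma> (fst z)) * cis (a * fst z + of_int n * snd z))" (is ?i)
    and "(\<integral>z. of_real (gauss_weight \<sigma> (fst z)) * cis (a * fst z + of_int n * snd z) \<partial>cylinder) =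
      of_real (gauss_kernel \<sigma> a * (2 * pi * indicator {0} n))" (is ?v)
proof -
  have e: "(\<lambda>z. of_real (gauss_weight \<sigma> (fst z)) * cis (a * fst z + of_int n * snd z)) =
    (\<lambda>(x, y). (of_real (gauss_weight \<sigma> x) * cis (a * x)) * cis (of_int n * y))"
    by (auto simp: mult.assoc cis_mult)
  note A = sigma_finite_lborel sigma_finite_circle integrable_cis_gauss_weight[OF assms] integrable_cis_circle
  show ?i unfolding e cylinder_eq by (rule integrable_pair_mult[OF A])
  show ?v unfolding e cylinder_eq integral_pair_mult[OF A]
    by (simp add: cis_integral_gauss_weight[OF assms] integral_cis_circle)
qed

section \<open>The Schur kernel of products of four plane waves\<close>

definition pair_momentum :: "(real \<times> int) \<times> (real \<times> int) \<Rightarrow> real" where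
  "pair_momentum w = fst (fst w) + fst (snd w)"

definition pair_mode :: "(real \<times> int) \<times> (real \<times> int) \<Rightarrow> int" where
  "pair_mode w = snd (fst w) + snd (snd w)"

definition pair_energy :: "(real \<times> int) \<times> (real \<times> int) \<Rightarrow> real" where
  "pair_energy w = energy (fst w) + energy (snd w)"

abbreviation frequency_pairs :: "((real \<times> int) \<times> (real \<times> int)) measure" where
  "frequency_pairs \<equiv> frequency_space \<Otimes>\<^sub>M frequency_space"

abbreviation frequency_quads where
  "frequency_quads \<equiv> frequency_pairs \<Otimes>\<^sub>M frequency_pairs"

text \<open>
  A point \<open>((r, t), z, z')\<close> carries the two space-time points \<open>(t + r, z)\<close> and \<open>(t, z')\<close>; the Gaussian
  weight keeps \<open>r\<close> bounded, and its other scale \<open>\<sigma>\<close> tends to infinity.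
\<close>

definition two_point_space :: "((real \<times> real) \<times> ((real \<times> real) \<times> (real \<times> real))) measure" where
  "two_point_space = (lborel \<Otimes>\<^sub>M lborel) \<Otimes>\<^sub>M (cylinder \<Otimes>\<^sub>M cylinder)"

definition two_point_weight :: "real \<Rightarrow> (real \<times> real) \<times> ((real \<times> real) \<times> (real \<times> real)) \<Rightarrow> real" where
  "two_point_weight \<sigma> = (\<lambda>((r, t), z, z').
     gauss_weight 1 r * gauss_weight \<sigma> t * (gauss_weight \<sigma> (fst z) * gauss_weight \<sigma> (fst z')))"

text \<open>The plane waves in the product of the squares of the free wave at (t + r, z) and at (t,
  z'). The pair \<open>fst w\<close> belongs to the first point and \<open>snd w\<close> to the
  second.\<close>

definition quad_wave where
  "quad_wave w = (\<lambda>((r, t), z, z').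
     cis (phase (t + r) z (fst (fst w))) * cis (phase (t + r) z (snd (fst w))) *
     (cis (phase t z' (fst (snd w))) * cis (phase t z' (snd (snd w)))))"

lemma pair_measurable [measurable]:
  "pair_momentum \<in> borel_measurable frequency_pairs"
  "pair_mode \<in> measurable frequency_pairs (count_space UNIV)"
  "pair_energy \<in> borel_measurable frequency_pairs"
proof -
  show "pair_momentum \<in> borel_measurable frequency_pairs" "pair_energy \<in> borel_measurable frequency_pairs"
    unfolding pair_momentum_def[abs_def] pair_energy_def[abs_def] by measurable
  have "(\<lambda>w. (snd (fst w), snd (snd w))) \<in> measurable frequency_pairs (count_space UNIV \<Otimes>\<^sub>M count_space (UNIV :: int set))"
    by measurable
  moreover have "(\<lambda>p. fst p + snd p) \<in> measurable (count_space UNIV \<Otimes>\<^sub>M count_space (UNIV :: int set)) (count_space UNIV)"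
    by (simp add: pair_measure_countable)
  ultimately have "(\<lambda>w. fst (snd (fst w), snd (snd w)) + snd (snd (fst w), snd (snd w))) \<in> measurable frequency_pairs (count_space UNIV)"
    by (rule measurable_compose)
  then show "pair_mode \<in> measurable frequency_pairs (count_space UNIV)"
    by (simp add: pair_mode_def[abs_def])
qed

lemma sigma_finite_pair_measure:
  assumes "sigma_finite_measure M" "sigma_finite_measure N"
  shows "sigma_finite_measure (M \<Otimes>\<^sub>M N)"
proof -
  interpret M: sigma_finite_measure M by fact
  interpret N: sigma_finite_measure N by fact
  interpret pair_sigma_finite M N ..
  show ?thesis ..
qed

lemmas sigma_finite_spaces = sigma_finite_lborel sigma_finite_cylinder sigma_finite_frequency_space
  sigma_finite_pair_measure

text \<open>The time \<open>t\<close> moves both points and is therefore dual to the total energy,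
  whereas \<open>r\<close> moves the first point only and is dual to the energy of the first pair.
  This is why the weight in \<open>t\<close> can have scale sigma while the bounded range of
  \<open>r\<close> leaves the energy of one pair free up to \<open>O(1)\<close>.\<close>

lemma quad_wave_product:
  "quad_wave w ((r, t), z, z') * cnj (quad_wave w' ((r, t), z, z')) =
    cis ((pair_energy (fst w') - pair_energy (fst w)) * r) *
    cis ((pair_energy (fst w') - pair_energy (fst w) + (pair_energy (snd w') - pair_energy (snd w))) * t) *
    (cis ((pair_momentum (fst w) - pair_momentum (fst w')) * fst z + of_int (pair_mode (fst w) - pair_mode (fst w')) * snd z) *
     cis ((pair_momentum (snd w) - pair_momentum (snd w')) * fst z' + of_int (pair_mode (snd w) - pair_mode (snd w')) * snd z'))"
  unfolding quad_wave_def
  by (simp add: cis_cnj cis_mult)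
    (simp add: phase_def pair_energy_def pair_momentum_def pair_mode_def algebra_simps)

text \<open>The Fourier transform of \<open>two_point_weight\<close> at a difference of frequencies.
  For large sigma it approximates the constraints of equal momentum and mode of each pair and equal
  total energy, together with nearly equal energy of the first pair.\<close>

definition quad_kernel where
  "quad_kernel \<sigma> w w' = (gauss_kernel 1 (pair_energy (fst w') - pair_energy (fst w)) *
      gauss_kernel \<sigma> (pair_energy (fst w') - pair_energy (fst w) + (pair_energy (snd w') - pair_energy (snd w)))) *
     ((gauss_kernel \<sigma> (pair_momentum (fst w) - pair_momentum (fst w')) * (2 * pi * indicator {0} (pair_mode (fst w) - pair_mode (fst w')))) *
      (gauss_kernel \<sigma> (pair_momentum (snd w) - pair_momentum (snd w')) * (2 * pi * indicator {0} (pair_mode (snd w) - pair_mode (snd w')))))"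

lemma two_point_weight_integral:
  assumes \<sigma>: "0 < \<sigma>"
  shows "(\<integral>v. of_real (two_point_weight \<sigma> v) * (quad_wave w v * cnj (quad_wave w' v)) \<partial>two_point_space) =
      of_real (quad_kernel \<sigma> w w')"
    and "integrable two_point_space (two_point_weight \<sigma>)"
proof -
  let ?T = "\<lambda>p p'. (\<lambda>(r, t). (of_real (gauss_weight 1 r) * cis (p * r)) * (of_real (gauss_weight \<sigma> t) * cis (p' * t)))"
  let ?Z = "\<lambda>s m s' m'. (\<lambda>(z, z'). (of_real (gauss_weight \<sigma> (fst z)) * cis (s * fst z + of_int m * snd z)) *
    (of_real (gauss_weight \<sigma> (fst z')) * cis (s' * fst z' + of_int m' * snd z')))"
  let ?V = "(lborel \<Otimes>\<^sub>M lborel) \<Otimes>\<^sub>M (cylinder \<Otimes>\<^sub>M cylinder)"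
  have fact1: "integrable ?V (\<lambda>(a, b). ?T p p' a * ?Z s m s' m' b)" (is "?I p p' s m s' m'")
    and fact2: "(\<integral>(a, b). ?T p p' a * ?Z s m s' m' b \<partial>?V) =
     of_real ((gauss_kernel 1 p * gauss_kernel \<sigma> p') * ((gauss_kernel \<sigma> s * (2 * pi * indicator {0} m)) * (gauss_kernel \<sigma> s' * (2 * pi * indicator {0} m'))))"
    for p p' s m s' m'
  proof -
    note A = sigma_finite_lborel sigma_finite_lborel integrable_cis_gauss_weight[OF zero_less_one, of p] integrable_cis_gauss_weight[OF \<sigma>, of p']
    note B = sigma_finite_cylinder sigma_finite_cylinder integral_gauss_cylinder(1)[OF \<sigma>, of s m] integral_gauss_cylinder(1)[OF \<sigma>, of s' m']
    note C = sigma_finite_pair_measure[OF sigma_finite_lborel sigma_finite_lborel] sigma_finite_pair_measure[OF sigma_finite_cylinder sigma_finite_cylinder]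
      integrable_pair_mult[OF A] integrable_pair_mult[OF B]
    show "?I p p' s m s' m'" by (rule integrable_pair_mult[OF C])
    show "(\<integral>(a, b). ?T p p' a * ?Z s m s' m' b \<partial>?V) =
     of_real ((gauss_kernel 1 p * gauss_kernel \<sigma> p') * ((gauss_kernel \<sigma> s * (2 * pi * indicator {0} m)) * (gauss_kernel \<sigma> s' * (2 * pi * indicator {0} m'))))"
      unfolding integral_pair_mult[OF C] integral_pair_mult[OF A] integral_pair_mult[OF B]
        cis_integral_gauss_weight[OF \<sigma>] cis_integral_gauss_weight[OF zero_less_one] integral_gauss_cylinder(2)[OF \<sigma>]
      by (simp only: of_real_mult)
  qed
  show "(\<integral>v. of_real (two_point_weight \<sigma> v) * (quad_wave w v * cnj (quad_wave w' v)) \<partial>two_point_space) =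
      of_real (quad_kernel \<sigma> w w')"
    unfolding two_point_space_def quad_kernel_def
    by (subst fact2[symmetric], intro Bochner_Integration.integral_cong refl)
      (auto simp only: split_paired_all prod.case two_point_weight_def quad_wave_product of_real_mult mult_ac)
  \<comment> \<open>With all frequencies equal to 0 the integrand is the weight itself.\<close>
  from fact1[of 0 0 0 0 0 0] have "integrable two_point_space (\<lambda>v. complex_of_real (two_point_weight \<sigma> v))"
    unfolding two_point_space_def
    by (rule Bochner_Integration.integrable_cong[THEN iffD1, rotated 2]) (auto simp: two_point_weight_def)
  then show "integrable two_point_space (two_point_weight \<sigma>)" by (simp only: complex_of_real_integrable_eq)
qed

lemma quad_kernel_measurable [measurable]:
  "(\<lambda>(w, w'). quad_kernel \<sigma> w w') \<in> borel_measurable (frequency_quads \<Otimes>\<^sub>M frequency_quads)"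
proof -
  have [measurable]: "(\<lambda>x. indicator {0} (f x - g x) :: real) \<in> borel_measurable M"
    if [measurable]: "f \<in> measurable M (count_space UNIV)" "g \<in> measurable M (count_space UNIV)"
    for f g :: "'z \<Rightarrow> int" and M
  proof -
    have "(\<lambda>x. indicator {0} (f x - g x) :: real) = (\<lambda>x. indicator {0} (real_of_int (f x) - real_of_int (g x)))"
      by (auto simp: indicator_def)
    then show ?thesis by simp
  qed
  show ?thesis unfolding quad_kernel_def by measurable
qed

lemma quad_kernel_sym: "quad_kernel \<sigma> w w' = quad_kernel \<sigma> w' w"
proof -
  have ev: "gauss_kernel s (a - b) = gauss_kernel s (b - a)" for s a b
    using gauss_kernel_minus[of s "a - b"] by simp
  have ev2: "gauss_kernel s (a - b + (c - d)) = gauss_kernel s (b - a + (d - c))" for s a b c d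
    using ev[of s "a + c" "b + d"] by (simp add: algebra_simps)
  have ind: "indicator {0::int} (a - b) = (indicator {0} (b - a) :: real)" for a b
    by (auto simp: indicator_def)
  show ?thesis unfolding quad_kernel_def
    using ev ev2 ind by metis
qed

lemma quad_kernel_nonneg: "0 < \<sigma> \<Longrightarrow> 0 \<le> quad_kernel \<sigma> w w'"
  unfolding quad_kernel_def by (intro mult_nonneg_nonneg gauss_kernel_nonneg) auto

lemma nn_integral_pair_measure:
  assumes "sigma_finite_measure N" "f \<in> borel_measurable (M \<Otimes>\<^sub>M N)"
  shows "(\<integral>\<^sup>+ x. f x \<partial>(M \<Otimes>\<^sub>M N)) = (\<integral>\<^sup>+ x. \<integral>\<^sup>+ y. f (x, y) \<partial>N \<partial>M)"
proof -
  interpret N: sigma_finite_measure N by fact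
  show ?thesis by (rule N.nn_integral_fst[OF assms(2), symmetric])
qed

lemma nn_integral_frequency_pairs_le:
  fixes h :: "real \<Rightarrow> real \<Rightarrow> ennreal"
  assumes h [measurable]: "(\<lambda>(p, n). h p n) \<in> borel_measurable (borel \<Otimes>\<^sub>M borel)"
  shows "(\<integral>\<^sup>+ w. indicator {l} (pair_mode w) * h (pair_momentum w) (pair_energy w) \<partial>frequency_pairs)
     \<le> 3 * (\<integral>\<^sup>+ p. \<integral>\<^sup>+ y. frac_rsqrt y * h p ((y + (p\<^sup>2 + (of_int l)\<^sup>2)) / 2) \<partial>lborel \<partial>lborel)"
  using nn_integral_pair_energy_le[OF h, of l]
  by (subst nn_integral_pair_measure[OF sigma_finite_frequency_space])
    (auto simp: pair_mode_def pair_momentum_def pair_energy_def energy_def)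

lemma pair_mode_borel_measurable [measurable]: "pair_mode \<in> borel_measurable frequency_pairs"
  using measurable_compose[OF pair_measurable(2), of "\<lambda>x. x" borel] by simp

text \<open>The row bound for the Schur test. \<open>nn_integral_frequency_pairs_le\<close> reduces
  each pair to its momentum and one energy variable. For fixed momenta the two energy integrals are
  \<open>two_frequency_bound\<close>; afterwards each momentum integral is the mass 2 pi of a
  Gaussian.\<close>

lemma quad_kernel_integral_bound:
  obtains C :: real where "0 \<le> C"
    "\<And>\<sigma> w. 0 < \<sigma> \<Longrightarrow> (\<integral>\<^sup>+ w'. ennreal (quad_kernel \<sigma> w w') \<partial>frequency_quads) \<le> ennreal C"
proof -
  obtain C where C: "0 \<le> C" and
    bound: "\<And>\<sigma> \<alpha> \<beta>. 0 < \<sigma> \<Longrightarrow> (\<integral>\<^sup>+ y. frac_rsqrt y * (ennreal (gauss_kernel 1 (\<alpha> - y / 2)) *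
        (\<integral>\<^sup>+ z. frac_rsqrt z * ennreal (gauss_kernel \<sigma> (\<beta> - (y + z) / 2)) \<partial>lborel)) \<partial>lborel) \<le> ennreal C"
    by (rule two_frequency_bound) blast
  \<comment> \<open>The factor \<open>(2 * pi)\<^sup>2\<close> comes from the two circle integrals
    inside \<open>quad_kernel\<close>, each 3 from the energy density of a pair, and each
    \<open>2 * pi\<close> from integrating over a momentum.\<close>
  define D where "D = ennreal ((2 * pi)\<^sup>2) * (3 * (3 * (ennreal (2 * pi) * (ennreal (2 * pi) * ennreal C))))"
  have "(\<integral>\<^sup>+ w'. ennreal (quad_kernel \<sigma> w w') \<partial>frequency_quads) \<le> D" if \<sigma>: "0 < \<sigma>" for \<sigma> w
  proof -
    define s\<^sub>1 s\<^sub>2 n\<^sub>1 n\<^sub>2 l\<^sub>1 l\<^sub>2 where defs: "s\<^sub>1 = pair_momentum (fst w)" "s\<^sub>2 = pair_momentum (snd w)"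
      "n\<^sub>1 = pair_energy (fst w)" "n\<^sub>2 = pair_energy (snd w)" "l\<^sub>1 = pair_mode (fst w)" "l\<^sub>2 = pair_mode (snd w)"
    let ?g = "\<lambda>s x. ennreal (gauss_kernel s x)"
    let ?B = "\<lambda>v u. (indicator {l\<^sub>2} (pair_mode u) * (?g \<sigma> (s\<^sub>2 - pair_momentum u) * ?g \<sigma> (n\<^sub>1 + n\<^sub>2 - pair_energy v - pair_energy u)))"
    let ?A = "\<lambda>v. (indicator {l\<^sub>1} (pair_mode v) * (?g \<sigma> (s\<^sub>1 - pair_momentum v) * ?g 1 (n\<^sub>1 - pair_energy v)))"
    \<comment> \<open>The bound for the integral over the second pair, as a function of the total
      energy \<open>m\<close> that the first pair leaves to it.\<close>
    let ?J = "\<lambda>m. 3 * (\<integral>\<^sup>+ p. \<integral>\<^sup>+ z. frac_rsqrt z * (?g \<sigma> (s\<^sub>2 - p) * ?g \<sigma> (m - (z + (p\<^sup>2 + (of_int l\<^sub>2)\<^sup>2)) / 2)) \<partial>lborel \<partial>lborel)"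
    have J [measurable]: "?J \<in> borel_measurable borel" by measurable
    have "(\<integral>\<^sup>+ w'. ennreal (quad_kernel \<sigma> w w') \<partial>frequency_quads) =
      (\<integral>\<^sup>+ w'. ennreal ((2 * pi)\<^sup>2) * ((?A (fst w')) *
        (?B (fst w') (snd w'))) \<partial>frequency_quads)"
    proof (rule nn_integral_cong)
      fix w' :: "((real \<times> int) \<times> (real \<times> int)) \<times> ((real \<times> int) \<times> (real \<times> int))"
      have i: "indicator {0} (l - m) = (indicator {l} m :: real)" "indicator {l} m = ennreal (indicator {l} m)" for l m :: int
        by (auto simp: indicator_def)
      have g1: "gauss_kernel 1 (pair_energy (fst w') - n\<^sub>1) = gauss_kernel 1 (n\<^sub>1 - pair_energy (fst w'))"
        using gauss_kernel_minus[of 1 "n\<^sub>1 - pair_energy (fst w')"] by simp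
      have g2: "gauss_kernel \<sigma> (pair_energy (fst w') - n\<^sub>1 + (pair_energy (snd w') - n\<^sub>2)) =
         gauss_kernel \<sigma> (n\<^sub>1 + n\<^sub>2 - pair_energy (fst w') - pair_energy (snd w'))"
        using gauss_kernel_minus[of \<sigma> "n\<^sub>1 + n\<^sub>2 - pair_energy (fst w') - pair_energy (snd w')"] by (simp add: algebra_simps)
      have "quad_kernel \<sigma> w w' = (2 * pi)\<^sup>2 * ((indicator {l\<^sub>1} (pair_mode (fst w')) * (gauss_kernel \<sigma> (s\<^sub>1 - pair_momentum (fst w')) * gauss_kernel 1 (n\<^sub>1 - pair_energy (fst w')))) *
        (indicator {l\<^sub>2} (pair_mode (snd w')) * (gauss_kernel \<sigma> (s\<^sub>2 - pair_momentum (snd w')) * gauss_kernel \<sigma> (n\<^sub>1 + n\<^sub>2 - pair_energy (fst w') - pair_energy (snd w')))))"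
        unfolding quad_kernel_def defs[symmetric] g1 g2 i(1) by (simp add: power2_eq_square mult_ac)
      then show "ennreal (quad_kernel \<sigma> w w') = ennreal ((2 * pi)\<^sup>2) * ((?A (fst w')) *
        (?B (fst w') (snd w')))"
        unfolding i(2) using \<sigma>
        by (simp only: ennreal_mult mult_nonneg_nonneg gauss_kernel_nonneg zero_less_one indicator_pos_le zero_le_power2)
    qed
    also have "\<dots> = ennreal ((2 * pi)\<^sup>2) * (\<integral>\<^sup>+ w'. ((?A (fst w')) *
        (?B (fst w') (snd w'))) \<partial>frequency_quads)"
      by (rule nn_integral_cmult) measurable
    also have "\<dots> = ennreal ((2 * pi)\<^sup>2) * (\<integral>\<^sup>+ w\<^sub>1. \<integral>\<^sup>+ w\<^sub>2. (?A w\<^sub>1) *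
        (?B w\<^sub>1 w\<^sub>2) \<partial>frequency_pairs \<partial>frequency_pairs)"
    proof -
      have "(\<lambda>w'. (?A (fst w')) *
        (?B (fst w') (snd w')))
        \<in> borel_measurable frequency_quads" by measurable
      from nn_integral_pair_measure[OF sigma_finite_pair_measure[OF sigma_finite_frequency_space sigma_finite_frequency_space] this]
      show ?thesis by (simp only: fst_conv snd_conv)
    qed
    also have "\<dots> = ennreal ((2 * pi)\<^sup>2) * (\<integral>\<^sup>+ w\<^sub>1. (?A w\<^sub>1) *
        (\<integral>\<^sup>+ w\<^sub>2. indicator {l\<^sub>2} (pair_mode w\<^sub>2) * (?g \<sigma> (s\<^sub>2 - pair_momentum w\<^sub>2) * ?g \<sigma> (n\<^sub>1 + n\<^sub>2 - pair_energy w\<^sub>1 - pair_energy w\<^sub>2)) \<partial>frequency_pairs) \<partial>frequency_pairs)"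
      by (intro arg_cong2[where f = "(*)"] refl nn_integral_cong nn_integral_cmult) measurable
    also have "\<dots> \<le> ennreal ((2 * pi)\<^sup>2) * (\<integral>\<^sup>+ w\<^sub>1. (?A w\<^sub>1) *
        ?J (n\<^sub>1 + n\<^sub>2 - pair_energy w\<^sub>1) \<partial>frequency_pairs)"
      by (intro mult_left_mono nn_integral_mono nn_integral_frequency_pairs_le) auto
    also have "\<dots> = ennreal ((2 * pi)\<^sup>2) * (\<integral>\<^sup>+ w\<^sub>1. indicator {l\<^sub>1} (pair_mode w\<^sub>1) * (?g \<sigma> (s\<^sub>1 - pair_momentum w\<^sub>1) * ?g 1 (n\<^sub>1 - pair_energy w\<^sub>1) *
        ?J (n\<^sub>1 + n\<^sub>2 - pair_energy w\<^sub>1)) \<partial>frequency_pairs)"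
      by (simp add: mult.assoc)
    \<comment> \<open>The pair bound is applied again, now with \<open>?J\<close> as part of the
      integrand. It depends on the first pair through its energy alone, so it is admissible as a
      factor of \<open>h\<close>.\<close>
    also have "\<dots> \<le> ennreal ((2 * pi)\<^sup>2) * (3 * (\<integral>\<^sup>+ p. \<integral>\<^sup>+ y. frac_rsqrt y * (?g \<sigma> (s\<^sub>1 - p) * ?g 1 (n\<^sub>1 - (y + (p\<^sup>2 + (of_int l\<^sub>1)\<^sup>2)) / 2) *
        ?J (n\<^sub>1 + n\<^sub>2 - (y + (p\<^sup>2 + (of_int l\<^sub>1)\<^sup>2)) / 2)) \<partial>lborel \<partial>lborel))"
      by (intro mult_left_mono nn_integral_frequency_pairs_le) auto
    also have "\<dots> \<le> ennreal ((2 * pi)\<^sup>2) * (3 * (\<integral>\<^sup>+ p. ?g \<sigma> (s\<^sub>1 - p) * (3 * (ennreal (2 * pi) * ennreal C)) \<partial>lborel))"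
    proof (intro mult_left_mono nn_integral_mono)
      fix p :: real
      \<comment> \<open>The kinetic energies of the centres of mass enter only through
        \<open>\<alpha>\<close> and \<open>\<beta>\<close>. Since \<open>two_frequency_bound\<close>
        is uniform in both, the dependence on momenta and modes disappears.\<close>
      define \<alpha> where "\<alpha> = n\<^sub>1 - (p\<^sup>2 + (of_int l\<^sub>1)\<^sup>2) / 2"
      define \<beta> where "\<beta> p' = n\<^sub>1 + n\<^sub>2 - (p\<^sup>2 + (of_int l\<^sub>1)\<^sup>2) / 2 - (p'\<^sup>2 + (of_int l\<^sub>2)\<^sup>2) / 2" for p' :: real
      have [measurable]: "\<beta> \<in> borel_measurable borel" unfolding \<beta>_def[abs_def] by measurable
    let ?L = "\<lambda>y. frac_rsqrt y * (?g \<sigma> (s\<^sub>1 - p) * ?g 1 (n\<^sub>1 - (y + (p\<^sup>2 + (of_int l\<^sub>1)\<^sup>2)) / 2) * ?J (n\<^sub>1 + n\<^sub>2 - (y + (p\<^sup>2 + (of_int l\<^sub>1)\<^sup>2)) / 2))"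
    let ?K = "\<lambda>p y. (frac_rsqrt y * (?g 1 (\<alpha> - y / 2) * (\<integral>\<^sup>+ z. frac_rsqrt z * ?g \<sigma> (\<beta> p - (y + z) / 2) \<partial>lborel)))"
      have "(\<integral>\<^sup>+ y. (?L y) \<partial>lborel) =
        (\<integral>\<^sup>+ y. (3 * ?g \<sigma> (s\<^sub>1 - p)) * (\<integral>\<^sup>+ p'. ?g \<sigma> (s\<^sub>2 - p') * (?K p' y) \<partial>lborel) \<partial>lborel)"
      proof (rule nn_integral_cong)
        fix y :: real
        have 1: "n\<^sub>1 - (y + (p\<^sup>2 + (of_int l\<^sub>1)\<^sup>2)) / 2 = \<alpha> - y / 2" by (simp add: \<alpha>_def field_simps)
        have 2: "n\<^sub>1 + n\<^sub>2 - (y + (p\<^sup>2 + (of_int l\<^sub>1)\<^sup>2)) / 2 - (z + (p'\<^sup>2 + (of_int l\<^sub>2)\<^sup>2)) / 2 = \<beta> p' - (y + z) / 2" for z p'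
          by (simp add: \<beta>_def field_simps)
        have "(?L y) = (3 * ?g \<sigma> (s\<^sub>1 - p)) * ((frac_rsqrt y * ?g 1 (\<alpha> - y / 2)) *
            (\<integral>\<^sup>+ p'. \<integral>\<^sup>+ z. frac_rsqrt z * (?g \<sigma> (s\<^sub>2 - p') * ?g \<sigma> (\<beta> p' - (y + z) / 2)) \<partial>lborel \<partial>lborel))"
          unfolding 1 2 by (simp only: mult_ac)
        also have "(\<integral>\<^sup>+ p'. \<integral>\<^sup>+ z. frac_rsqrt z * (?g \<sigma> (s\<^sub>2 - p') * ?g \<sigma> (\<beta> p' - (y + z) / 2)) \<partial>lborel \<partial>lborel) =
          (\<integral>\<^sup>+ p'. ?g \<sigma> (s\<^sub>2 - p') * (\<integral>\<^sup>+ z. frac_rsqrt z * ?g \<sigma> (\<beta> p' - (y + z) / 2) \<partial>lborel) \<partial>lborel)"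
          by (intro nn_integral_cong) (simp add: mult.left_commute flip: nn_integral_cmult)
        also have "(frac_rsqrt y * ?g 1 (\<alpha> - y / 2)) * \<dots> = (\<integral>\<^sup>+ p'. (frac_rsqrt y * ?g 1 (\<alpha> - y / 2)) * (?g \<sigma> (s\<^sub>2 - p') * (\<integral>\<^sup>+ z. frac_rsqrt z * ?g \<sigma> (\<beta> p' - (y + z) / 2) \<partial>lborel)) \<partial>lborel)"
          by (rule nn_integral_cmult[symmetric]) measurable
        also have "\<dots> = (\<integral>\<^sup>+ p'. ?g \<sigma> (s\<^sub>2 - p') * (?K p' y) \<partial>lborel)"
          by (simp only: mult_ac)
        finally show "(?L y) = (3 * ?g \<sigma> (s\<^sub>1 - p)) * (\<integral>\<^sup>+ p'. ?g \<sigma> (s\<^sub>2 - p') * (?K p' y) \<partial>lborel)" .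
      qed
      also have "\<dots> = (3 * ?g \<sigma> (s\<^sub>1 - p)) * (\<integral>\<^sup>+ y. (\<integral>\<^sup>+ p'. ?g \<sigma> (s\<^sub>2 - p') * (?K p' y) \<partial>lborel) \<partial>lborel)"
        by (rule nn_integral_cmult) measurable
      also have "(\<integral>\<^sup>+ y. (\<integral>\<^sup>+ p'. ?g \<sigma> (s\<^sub>2 - p') * (?K p' y) \<partial>lborel) \<partial>lborel) =
         (\<integral>\<^sup>+ p'. (\<integral>\<^sup>+ y. ?g \<sigma> (s\<^sub>2 - p') * (?K p' y) \<partial>lborel) \<partial>lborel)"
        by (rule lborel_pair.Fubini') measurable
      also have "\<dots> = (\<integral>\<^sup>+ p'. ?g \<sigma> (s\<^sub>2 - p') * (\<integral>\<^sup>+ y. (?K p' y) \<partial>lborel) \<partial>lborel)"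
        by (intro nn_integral_cong nn_integral_cmult) measurable
      also have "\<dots> \<le> (\<integral>\<^sup>+ p'. ?g \<sigma> (s\<^sub>2 - p') * ennreal C \<partial>lborel)"
        by (intro nn_integral_mono mult_left_mono bound \<sigma>) auto
      also have "\<dots> = ennreal (2 * pi) * ennreal C"
        by (subst nn_integral_multc) (auto simp: nn_integral_gauss_kernel_diff[OF \<sigma>])
      finally show "(\<integral>\<^sup>+ y. (?L y) \<partial>lborel) \<le> ?g \<sigma> (s\<^sub>1 - p) * (3 * (ennreal (2 * pi) * ennreal C))"
        by (simp only: mult.assoc mult.left_commute[of "?g \<sigma> (s\<^sub>1 - p)" 3] mult_left_mono zero_le)
    qed auto
    also have "\<dots> = D"
      by (subst nn_integral_multc) (auto simp: nn_integral_gauss_kernel_diff[OF \<sigma>] D_def mult_ac)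
    finally show ?thesis .
  qed
  moreover have "D < \<infinity>" by (auto simp: D_def ennreal_mult_less_top)
  then have "D = ennreal (enn2real D)" by simp
  ultimately show ?thesis by (intro that[of "enn2real D"]) auto
qed

lemma quad_wave_measurable:
  "(\<lambda>(w, v). quad_wave w v) \<in> borel_measurable (frequency_quads \<Otimes>\<^sub>M two_point_space)"
  unfolding quad_wave_def two_point_space_def case_prod_unfold by measurable

lemma free_wave_square:
  assumes F: "integrable frequency_space F"
  shows "integrable frequency_pairs (\<lambda>(q, q'). F q * F q')"
    and "(\<integral>(q, q'). (F q * cis (phase t z q)) * (F q' * cis (phase t z q')) \<partial>frequency_pairs) = (free_wave F t z)\<^sup>2"
    and "integrable frequency_pairs (\<lambda>(q, q'). (F q * cis (phase t z q)) * (F q' * cis (phase t z q')))"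
proof -
  note S = sigma_finite_frequency_space sigma_finite_frequency_space
  show "integrable frequency_pairs (\<lambda>(q, q'). F q * F q')" by (rule integrable_pair_mult[OF S F F])
  have i: "integrable frequency_space (\<lambda>q. F q * cis (phase t z q))"
    by (rule Bochner_Integration.integrable_bound[OF F]) (use F in \<open>auto simp: norm_mult phase_def\<close>)
  show "integrable frequency_pairs (\<lambda>(q, q'). (F q * cis (phase t z q)) * (F q' * cis (phase t z q')))"
    by (rule integrable_pair_mult[OF S i i])
  show "(\<integral>(q, q'). (F q * cis (phase t z q)) * (F q' * cis (phase t z q')) \<partial>frequency_pairs) = (free_wave F t z)\<^sup>2"
    by (subst integral_pair_mult[OF S i i]) (simp add: free_wave_def power2_eq_square)
qed

text \<open>The Schur test on quadruples of frequencies with \<open>G\<close> the fourfold tensor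
  power of \<open>F\<close>. Its squared norm is the fourth power of that of \<open>F\<close>, and
  the superposition of the \<open>quad_wave\<close>s factors into the squares of the free wave at
  the two points.\<close>

lemma two_point_bound:
  obtains C :: real where "0 \<le> C"
    "\<And>\<sigma> F. 0 < \<sigma> \<Longrightarrow> integrable frequency_space F \<Longrightarrow>
      (\<integral>\<^sup>+ v. ennreal (two_point_weight \<sigma> v) * ennreal ((case v of ((r, t), z, z') \<Rightarrow> cmod (free_wave F (t + r) z) ^ 4 * cmod (free_wave F t z') ^ 4)) \<partial>two_point_space)
      \<le> ennreal C * (\<integral>\<^sup>+ q. ennreal ((cmod (F q))\<^sup>2) \<partial>frequency_space) ^ 4"
proof -
  obtain C where C: "0 \<le> C" and
    bound: "\<And>\<sigma> w. 0 < \<sigma> \<Longrightarrow> (\<integral>\<^sup>+ w'. ennreal (quad_kernel \<sigma> w w') \<partial>frequency_quads) \<le> ennreal C"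
    by (rule quad_kernel_integral_bound) blast
  have "(\<integral>\<^sup>+ v. ennreal (two_point_weight \<sigma> v) * ennreal ((case v of ((r, t), z, z') \<Rightarrow> cmod (free_wave F (t + r) z) ^ 4 * cmod (free_wave F t z') ^ 4)) \<partial>two_point_space)
      \<le> ennreal C * (\<integral>\<^sup>+ q. ennreal ((cmod (F q))\<^sup>2) \<partial>frequency_space) ^ 4"
    if \<sigma>: "0 < \<sigma>" and F: "integrable frequency_space F" for \<sigma> F
  proof -
    note [measurable] = borel_measurable_integrable[OF F]
    note S1 = sigma_finite_frequency_space
    note S2 = sigma_finite_pair_measure[OF S1 S1]
    define G where "G w = (\<lambda>(q, q'). F q * F q') (fst w) * (\<lambda>(q, q'). F q * F q') (snd w)" for w
    have G: "integrable frequency_quads G"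
      using integrable_pair_mult[OF S2 S2 free_wave_square(1)[OF F] free_wave_square(1)[OF F]]
      by (simp add: G_def[abs_def] case_prod_unfold)
    have "(\<integral>\<^sup>+ v. ennreal (two_point_weight \<sigma> v) * ennreal ((cmod (\<integral>w. G w * quad_wave w v \<partial>frequency_quads))\<^sup>2) \<partial>two_point_space)
       \<le> ennreal C * (\<integral>\<^sup>+ w. ennreal ((cmod (G w))\<^sup>2) \<partial>frequency_quads)"
    proof (rule schur_extension_bound[where k = "\<lambda>w w'. ennreal (quad_kernel \<sigma> w w')"])
      show "sigma_finite_measure frequency_quads" by (rule sigma_finite_pair_measure[OF S2 S2])
      show "sigma_finite_measure two_point_space" unfolding two_point_space_def
        by (intro sigma_finite_spaces)
      show "cmod (quad_wave w v) \<le> 1" for w v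
        by (auto simp: quad_wave_def norm_mult case_prod_unfold)
      show "0 \<le> two_point_weight \<sigma> v" for v by (auto simp: two_point_weight_def case_prod_unfold)
      show "(\<integral>\<^sup>+ y. ennreal (quad_kernel \<sigma> x y) \<partial>frequency_quads) \<le> ennreal C" for x by (rule bound[OF \<sigma>])
      show "ennreal (cmod (\<integral>v. of_real (two_point_weight \<sigma> v) * (quad_wave x v * cnj (quad_wave y v)) \<partial>two_point_space)) \<le> ennreal (quad_kernel \<sigma> x y)" for x y
        unfolding two_point_weight_integral(1)[OF \<sigma>] using quad_kernel_nonneg[OF \<sigma>] by simp
      show "(\<lambda>(x, y). ennreal (quad_kernel \<sigma> x y)) \<in> borel_measurable (frequency_quads \<Otimes>\<^sub>M frequency_quads)"
        by measurable
    qed (simp_all add: G quad_wave_measurable two_point_weight_integral(2)[OF \<sigma>] quad_kernel_sym[of \<sigma>])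
    moreover have "(\<integral>w. G w * quad_wave w v \<partial>frequency_quads) =
      (case v of ((r, t), z, z') \<Rightarrow> (free_wave F (t + r) z)\<^sup>2 * (free_wave F t z')\<^sup>2)" for v
    proof -
      obtain r t z z' where v: "v = ((r, t), z, z')" by (metis surj_pair)
      have "(\<integral>w. G w * quad_wave w v \<partial>frequency_quads) = (\<integral>(w, w').
         (\<lambda>(q, q'). (F q * cis (phase (t + r) z q)) * (F q' * cis (phase (t + r) z q'))) w *
         (\<lambda>(q, q'). (F q * cis (phase t z' q)) * (F q' * cis (phase t z' q'))) w' \<partial>frequency_quads)"
        by (simp add: G_def quad_wave_def v case_prod_unfold mult_ac)
      also have "\<dots> = (free_wave F (t + r) z)\<^sup>2 * (free_wave F t z')\<^sup>2"
        by (subst integral_pair_mult[OF S2 S2 free_wave_square(3)[OF F] free_wave_square(3)[OF F]])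
          (simp only: free_wave_square(2)[OF F])
      finally show ?thesis by (simp add: v)
    qed
    moreover have "(cmod (case v of ((r, t), z, z') \<Rightarrow> (free_wave F (t + r) z)\<^sup>2 * (free_wave F t z')\<^sup>2))\<^sup>2 =
       (case v of ((r, t), z, z') \<Rightarrow> cmod (free_wave F (t + r) z) ^ 4 * cmod (free_wave F t z') ^ 4)" for v
      by (auto simp: case_prod_unfold norm_mult norm_power power_mult_distrib simp flip: power_mult)
    moreover have "(\<integral>\<^sup>+ w. ennreal ((cmod (G w))\<^sup>2) \<partial>frequency_quads) = (\<integral>\<^sup>+ q. ennreal ((cmod (F q))\<^sup>2) \<partial>frequency_space) ^ 4"
    proof -
      let ?X = "\<integral>\<^sup>+ q. ennreal ((cmod (F q))\<^sup>2) \<partial>frequency_space"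
      let ?f = "\<lambda>q. ennreal ((cmod (F q))\<^sup>2)"
      have "(\<integral>\<^sup>+ w. ennreal ((cmod (G w))\<^sup>2) \<partial>frequency_quads) =
         (\<integral>\<^sup>+ w. (?f (fst (fst w)) * ?f (snd (fst w))) * (?f (fst (snd w)) * ?f (snd (snd w))) \<partial>frequency_quads)"
        by (simp add: G_def case_prod_unfold norm_mult power_mult_distrib ennreal_mult)
      also have "\<dots> = (\<integral>\<^sup>+ w. (?f (fst w) * ?f (snd w)) * (\<integral>\<^sup>+ w'. ?f (fst w') * ?f (snd w') \<partial>frequency_pairs) \<partial>frequency_pairs)"
        by (subst nn_integral_pair_measure[OF S2]) (auto simp: nn_integral_cmult)
      also have "\<dots> = (\<integral>\<^sup>+ w'. ?f (fst w') * ?f (snd w') \<partial>frequency_pairs)\<^sup>2"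
        by (subst nn_integral_multc) (auto simp: power2_eq_square)
      also have "(\<integral>\<^sup>+ w'. ?f (fst w') * ?f (snd w') \<partial>frequency_pairs) = ?X\<^sup>2"
        by (subst nn_integral_pair_measure[OF S1]) (auto simp: nn_integral_cmult nn_integral_multc power2_eq_square)
      finally show ?thesis by (simp flip: power_mult)
    qed
    ultimately show ?thesis by simp
  qed
  then show ?thesis using C that by blast
qed

section \<open>Quartic mass and its correlation in time\<close>

definition quartic_mass :: "(real \<times> int \<Rightarrow> complex) \<Rightarrow> real \<Rightarrow> ennreal" where
  "quartic_mass F t = (\<integral>\<^sup>+ z. ennreal (cmod (free_wave F t z) ^ 4) \<partial>cylinder)"

lemma quartic_mass_measurable [measurable (raw)]:
  assumes [measurable]: "F \<in> borel_measurable frequency_space" "f \<in> borel_measurable M"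
  shows "(\<lambda>x. quartic_mass F (f x)) \<in> borel_measurable M"
proof -
  interpret sigma_finite_measure cylinder by (rule sigma_finite_cylinder)
  show ?thesis unfolding quartic_mass_def by measurable
qed

lemma gauss_weight_tendsto_1: "(\<lambda>n. gauss_weight (real (Suc n)) x) \<longlonglongrightarrow> 1"
proof -
  have "(\<lambda>n. inverse (real (Suc n))) \<longlonglongrightarrow> 0" by (rule LIMSEQ_inverse_real_of_nat)
  then have "(\<lambda>n. exp (- (x * inverse (real (Suc n)))\<^sup>2 / 2)) \<longlonglongrightarrow> exp (- (x * 0)\<^sup>2 / 2)"
    by (intro tendsto_intros) auto
  moreover have "gauss_weight (real (Suc n)) x = exp (- (x * inverse (real (Suc n)))\<^sup>2 / 2)" for n
    by (simp only: gauss_weight_def divide_inverse[of x])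
  ultimately show ?thesis by (simp del: of_nat_Suc)
qed

text \<open>Letting sigma tend to infinity in \<open>two_point_bound\<close>: every Gaussian tends
  to 1 except the one in \<open>r\<close>, whose scale is fixed. Fatou's lemma applies because the
  bound does not involve sigma.\<close>

lemma quartic_mass_correlation_bound:
  obtains C :: real where "0 \<le> C"
    "\<And>F. integrable frequency_space F \<Longrightarrow>
      (\<integral>\<^sup>+ t. quartic_mass F t * (\<integral>\<^sup>+ r. ennreal (gauss_weight 1 r) * quartic_mass F (t + r) \<partial>lborel) \<partial>lborel)
      \<le> ennreal C * (\<integral>\<^sup>+ q. ennreal ((cmod (F q))\<^sup>2) \<partial>frequency_space) ^ 4"
proof -
  obtain C where C: "0 \<le> C" and
    bound: "\<And>\<sigma> F. 0 < \<sigma> \<Longrightarrow> integrable frequency_space F \<Longrightarrow>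
      (\<integral>\<^sup>+ v. ennreal (two_point_weight \<sigma> v) * ennreal ((case v of ((r, t), z, z') \<Rightarrow> cmod (free_wave F (t + r) z) ^ 4 * cmod (free_wave F t z') ^ 4)) \<partial>two_point_space)
      \<le> ennreal C * (\<integral>\<^sup>+ q. ennreal ((cmod (F q))\<^sup>2) \<partial>frequency_space) ^ 4"
    by (rule two_point_bound) blast
  have "(\<integral>\<^sup>+ t. quartic_mass F t * (\<integral>\<^sup>+ r. ennreal (gauss_weight 1 r) * quartic_mass F (t + r) \<partial>lborel) \<partial>lborel)
      \<le> ennreal C * (\<integral>\<^sup>+ q. ennreal ((cmod (F q))\<^sup>2) \<partial>frequency_space) ^ 4"
    if F: "integrable frequency_space F" for F
  proof -
    note [measurable] = borel_measurable_integrable[OF F]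
    let ?m = "\<lambda>t z. ennreal (cmod (free_wave F t z) ^ 4)"
    let ?h = "\<lambda>v. ennreal (case v of ((r, t), z, z') \<Rightarrow> cmod (free_wave F (t + r) z) ^ 4 * cmod (free_wave F t z') ^ 4)"
    note cyl = sigma_finite_cylinder
    let ?N = "\<lambda>r t. (\<integral>\<^sup>+ z. (\<integral>\<^sup>+ z'. ennreal (gauss_weight 1 r) * (?m (t + r) z * ?m t z') \<partial>cylinder) \<partial>cylinder)"
    have meas: "(\<lambda>v. ennreal (gauss_weight 1 (fst (fst v))) * (?m (snd (fst v) + fst (fst v)) (fst (snd v)) * ?m (snd (fst v)) (snd (snd v)))) \<in> borel_measurable two_point_space"
      unfolding two_point_space_def by measurable
    have "(\<integral>\<^sup>+ t. quartic_mass F t * (\<integral>\<^sup>+ r. ennreal (gauss_weight 1 r) * quartic_mass F (t + r) \<partial>lborel) \<partial>lborel) =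
      (\<integral>\<^sup>+ t. (\<integral>\<^sup>+ r. ennreal (gauss_weight 1 r) * (quartic_mass F (t + r) * quartic_mass F t) \<partial>lborel) \<partial>lborel)"
      by (intro nn_integral_cong) (simp add: mult_ac flip: nn_integral_cmult)
    also have "\<dots> = (\<integral>\<^sup>+ r. (\<integral>\<^sup>+ t. ennreal (gauss_weight 1 r) * (quartic_mass F (t + r) * quartic_mass F t) \<partial>lborel) \<partial>lborel)"
      by (rule lborel_pair.Fubini') measurable
    also have "\<dots> = (\<integral>\<^sup>+ r. (\<integral>\<^sup>+ t. (?N r t) \<partial>lborel) \<partial>lborel)"
      unfolding quartic_mass_def by (intro nn_integral_cong) (simp add: nn_integral_cmult nn_integral_multc)
    also have "\<dots> = (\<integral>\<^sup>+ v. ennreal (gauss_weight 1 (fst (fst v))) * (?m (snd (fst v) + fst (fst v)) (fst (snd v)) * ?m (snd (fst v)) (snd (snd v))) \<partial>two_point_space)"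
    proof -
      have "(\<integral>\<^sup>+ v. ennreal (gauss_weight 1 (fst (fst v))) * (?m (snd (fst v) + fst (fst v)) (fst (snd v)) * ?m (snd (fst v)) (snd (snd v))) \<partial>two_point_space) =
        (\<integral>\<^sup>+ a. \<integral>\<^sup>+ b. ennreal (gauss_weight 1 (fst a)) * (?m (snd a + fst a) (fst b) * ?m (snd a) (snd b)) \<partial>(cylinder \<Otimes>\<^sub>M cylinder) \<partial>(lborel \<Otimes>\<^sub>M lborel))"
        using nn_integral_pair_measure[OF sigma_finite_pair_measure[OF cyl cyl] meas[unfolded two_point_space_def]]
        unfolding two_point_space_def by (simp only: fst_conv snd_conv)
      also have "\<dots> = (\<integral>\<^sup>+ a. \<integral>\<^sup>+ z. \<integral>\<^sup>+ z'. ennreal (gauss_weight 1 (fst a)) * (?m (snd a + fst a) z * ?m (snd a) z') \<partial>cylinder \<partial>cylinder \<partial>(lborel \<Otimes>\<^sub>M lborel))"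
        by (intro nn_integral_cong, subst nn_integral_pair_measure[OF cyl]) (auto simp: space_pair_measure)
      also have "\<dots> = (\<integral>\<^sup>+ r. (\<integral>\<^sup>+ t. (?N r t) \<partial>lborel) \<partial>lborel)"
      proof -
        interpret sigma_finite_measure cylinder by (rule cyl)
        have "(\<lambda>a. \<integral>\<^sup>+ z. \<integral>\<^sup>+ z'. ennreal (gauss_weight 1 (fst a)) * (?m (snd a + fst a) z * ?m (snd a) z') \<partial>cylinder \<partial>cylinder) \<in> borel_measurable (lborel \<Otimes>\<^sub>M lborel)"
          by measurable
        from nn_integral_pair_measure[OF sigma_finite_lborel this] show ?thesis by (simp only: fst_conv snd_conv)
      qed
      finally show ?thesis by simp
    qed
    also have "\<dots> = (\<integral>\<^sup>+ v. liminf (\<lambda>n. ennreal (two_point_weight (real (Suc n)) v) * ?h v) \<partial>two_point_space)"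
    proof (rule nn_integral_cong)
      fix v :: "(real \<times> real) \<times> ((real \<times> real) \<times> (real \<times> real))"
      obtain r t z z' where v: "v = ((r, t), z, z')" by (metis surj_pair)
      have "(\<lambda>n. two_point_weight (real (Suc n)) v) \<longlonglongrightarrow> gauss_weight 1 r * 1 * (1 * 1)"
        unfolding two_point_weight_def v by (simp only: prod.case) (intro tendsto_intros gauss_weight_tendsto_1)
      then have "(\<lambda>n. ennreal (two_point_weight (real (Suc n)) v) * ?h v) \<longlonglongrightarrow> ennreal (gauss_weight 1 r) * ?h v"
        by (subst (1 2) mult.commute, intro ennreal_tendsto_cmult tendsto_ennrealI) auto
      then have lim: "liminf (\<lambda>n. ennreal (two_point_weight (real (Suc n)) v) * ?h v) = ennreal (gauss_weight 1 r) * ?h v"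
        by (intro lim_imp_Liminf) auto
      show "ennreal (gauss_weight 1 (fst (fst v))) * (?m (snd (fst v) + fst (fst v)) (fst (snd v)) * ?m (snd (fst v)) (snd (snd v))) =
          liminf (\<lambda>n. ennreal (two_point_weight (real (Suc n)) v) * ?h v)"
        unfolding lim by (simp add: v ennreal_mult)
    qed
    also have "\<dots> \<le> liminf (\<lambda>n. \<integral>\<^sup>+ v. ennreal (two_point_weight (real (Suc n)) v) * ?h v \<partial>two_point_space)"
      by (rule nn_integral_liminf, unfold two_point_weight_def two_point_space_def case_prod_unfold) measurable
    also have "\<dots> \<le> liminf (\<lambda>n::nat. ennreal C * (\<integral>\<^sup>+ q. ennreal ((cmod (F q))\<^sup>2) \<partial>frequency_space) ^ 4)"
      by (intro Liminf_mono always_eventually allI bound F) auto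
    finally show ?thesis by (simp add: Liminf_const)
  qed
  then show ?thesis using C that by blast
qed

text \<open>Two times in one unit window differ by at most 1, where
  \<open>exp (1/2) * gauss_weight 1 r\<close> is at least 1. The square of a window mass is thus
  dominated by the part of the correlation integral over that window, and the windows tile the time
  axis.\<close>

lemma window_energy_bound:
  obtains C :: real where "0 \<le> C"
    "\<And>F. integrable frequency_space F \<Longrightarrow>
      (\<integral>\<^sup>+ \<gamma>. (\<integral>\<^sup>+ s. quartic_mass F (of_int \<gamma> + s) * indicator {0..<1} s \<partial>lborel)\<^sup>2 \<partial>count_space (UNIV :: int set))
      \<le> ennreal C * (\<integral>\<^sup>+ q. ennreal ((cmod (F q))\<^sup>2) \<partial>frequency_space) ^ 4"
proof -
  obtain C where C: "0 \<le> C" and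
    bound: "\<And>F. integrable frequency_space F \<Longrightarrow>
      (\<integral>\<^sup>+ t. quartic_mass F t * (\<integral>\<^sup>+ r. ennreal (gauss_weight 1 r) * quartic_mass F (t + r) \<partial>lborel) \<partial>lborel)
      \<le> ennreal C * (\<integral>\<^sup>+ q. ennreal ((cmod (F q))\<^sup>2) \<partial>frequency_space) ^ 4"
    by (rule quartic_mass_correlation_bound) blast
  have "(\<integral>\<^sup>+ \<gamma>. (\<integral>\<^sup>+ s. quartic_mass F (of_int \<gamma> + s) * indicator {0..<1} s \<partial>lborel)\<^sup>2 \<partial>count_space (UNIV :: int set))
      \<le> ennreal (exp (1/2) * C) * (\<integral>\<^sup>+ q. ennreal ((cmod (F q))\<^sup>2) \<partial>frequency_space) ^ 4"
    if F: "integrable frequency_space F" for F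
  proof -
    note [measurable] = borel_measurable_integrable[OF F]
    let ?I = "quartic_mass F"
    let ?i = "\<lambda>\<gamma>::int. indicator {of_int \<gamma>..<of_int \<gamma> + 1::real} :: real \<Rightarrow> ennreal"
    let ?R = "\<lambda>t. \<integral>\<^sup>+ r. ennreal (gauss_weight 1 r) * ?I (t + r) \<partial>lborel"
    have sq: "(\<integral>\<^sup>+ s. ?I (of_int \<gamma> + s) * indicator {0..<1} s \<partial>lborel)\<^sup>2 \<le>
      (\<integral>\<^sup>+ t. ?i \<gamma> t * (ennreal (exp (1/2)) * (?I t * ?R t)) \<partial>lborel)" for \<gamma> :: int
    proof -
      have shift: "(\<integral>\<^sup>+ s. ?I (of_int \<gamma> + s) * indicator {0..<1} s \<partial>lborel) = (\<integral>\<^sup>+ t. ?I t * ?i \<gamma> t \<partial>lborel)"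
        by (subst (2) nn_integral_real_affine[where t = "of_int \<gamma>" and c = 1])
          (auto intro!: nn_integral_cong split: split_indicator)
      have "(\<integral>\<^sup>+ t. ?I t * ?i \<gamma> t \<partial>lborel)\<^sup>2 = (\<integral>\<^sup>+ t. (?I t * ?i \<gamma> t) * (\<integral>\<^sup>+ t'. ?I t' * ?i \<gamma> t' \<partial>lborel) \<partial>lborel)"
        by (subst nn_integral_multc) (auto simp: power2_eq_square)
      also have "\<dots> \<le> (\<integral>\<^sup>+ t. ?i \<gamma> t * (ennreal (exp (1/2)) * (?I t * ?R t)) \<partial>lborel)"
      proof (rule nn_integral_mono)
        fix t :: real
        show "(?I t * ?i \<gamma> t) * (\<integral>\<^sup>+ t'. ?I t' * ?i \<gamma> t' \<partial>lborel) \<le> ?i \<gamma> t * (ennreal (exp (1/2)) * (?I t * ?R t))"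
        proof (cases "t \<in> {of_int \<gamma>..<of_int \<gamma> + 1}")
          case True
          have "(\<integral>\<^sup>+ t'. ?I t' * ?i \<gamma> t' \<partial>lborel) = (\<integral>\<^sup>+ r. ?I (t + r) * ?i \<gamma> (t + r) \<partial>lborel)"
            by (subst nn_integral_real_affine[where t = t and c = 1]) auto
          also have "\<dots> \<le> (\<integral>\<^sup>+ r. ennreal (exp (1/2)) * (ennreal (gauss_weight 1 r) * ?I (t + r)) \<partial>lborel)"
          proof (rule nn_integral_mono)
            fix r :: real
            show "?I (t + r) * ?i \<gamma> (t + r) \<le> ennreal (exp (1/2)) * (ennreal (gauss_weight 1 r) * ?I (t + r))"
            proof (cases "t + r \<in> {of_int \<gamma>..<of_int \<gamma> + 1}")
              case r: True
              have "\<bar>r\<bar> \<le> 1" using True r by (auto simp: abs_le_iff)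
              then have "r\<^sup>2 \<le> 1" by (simp add: abs_square_le_1)
              then have "1 \<le> exp (1/2) * gauss_weight 1 r"
                by (simp add: gauss_weight_def flip: exp_add)
              then have "1 \<le> ennreal (exp (1/2)) * ennreal (gauss_weight 1 r)"
                by (simp flip: ennreal_mult)
              then have "1 * ?I (t + r) \<le> ennreal (exp (1/2)) * ennreal (gauss_weight 1 r) * ?I (t + r)"
                by (rule mult_right_mono) auto
              then show ?thesis using r by (simp add: mult.assoc)
            qed simp
          qed
          also have "\<dots> = ennreal (exp (1/2)) * ?R t" by (rule nn_integral_cmult) measurable
          finally have "?I t * (\<integral>\<^sup>+ t'. ?I t' * ?i \<gamma> t' \<partial>lborel) \<le> ?I t * (ennreal (exp (1/2)) * ?R t)"
            by (rule mult_left_mono) auto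
          then show ?thesis using True by (simp add: mult_ac)
        qed simp
      qed
      finally show ?thesis unfolding shift .
    qed
    have "(\<integral>\<^sup>+ \<gamma>. (\<integral>\<^sup>+ s. ?I (of_int \<gamma> + s) * indicator {0..<1} s \<partial>lborel)\<^sup>2 \<partial>count_space (UNIV :: int set)) \<le>
      (\<integral>\<^sup>+ \<gamma>. (\<integral>\<^sup>+ t. ?i \<gamma> t * (ennreal (exp (1/2)) * (?I t * ?R t)) \<partial>lborel) \<partial>count_space (UNIV :: int set))"
      by (intro nn_integral_mono sq)
    also have "\<dots> = (\<integral>\<^sup>+ \<gamma>. (\<integral>\<^sup>+ s. indicator {0..<1} s * (ennreal (exp (1/2)) * (?I (of_int \<gamma> + s) * ?R (of_int \<gamma> + s))) \<partial>lborel) \<partial>count_space (UNIV :: int set))"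
    proof (rule nn_integral_cong)
      fix \<gamma> :: int
      show "(\<integral>\<^sup>+ t. ?i \<gamma> t * (ennreal (exp (1/2)) * (?I t * ?R t)) \<partial>lborel) =
        (\<integral>\<^sup>+ s. indicator {0..<1} s * (ennreal (exp (1/2)) * (?I (of_int \<gamma> + s) * ?R (of_int \<gamma> + s))) \<partial>lborel)"
        by (subst nn_integral_real_affine[where t = "of_int \<gamma>" and c = 1])
          (auto intro!: nn_integral_cong split: split_indicator)
    qed
    also have "\<dots> = (\<integral>\<^sup>+ t. ennreal (exp (1/2)) * (?I t * ?R t) \<partial>lborel)"
      by (rule nn_integral_unit_cells[symmetric]) measurable
    also have "\<dots> = ennreal (exp (1/2)) * (\<integral>\<^sup>+ t. ?I t * ?R t \<partial>lborel)"
      by (rule nn_integral_cmult) measurable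
    also have "\<dots> \<le> ennreal (exp (1/2)) * (ennreal C * (\<integral>\<^sup>+ q. ennreal ((cmod (F q))\<^sup>2) \<partial>frequency_space) ^ 4)"
      by (intro mult_left_mono bound F) auto
    finally show ?thesis using C by (simp add: ennreal_mult mult.assoc)
  qed
  then show ?thesis using C by (intro that[of "exp (1/2) * C"]) auto
qed

section \<open>Square-integrable functions\<close>

text \<open>The square of the norm, kept without the root. The triangle inequality is replaced by (a
  + b)^2 <= 2 a^2 + 2 b^2, whose loss of a constant does not affect limits.\<close>

definition sq_norm :: "'a measure \<Rightarrow> ('a \<Rightarrow> complex) \<Rightarrow> ennreal" where
  "sq_norm M f = (\<integral>\<^sup>+ x. ennreal ((cmod (f x))\<^sup>2) \<partial>M)"

definition L2 :: "'a measure \<Rightarrow> ('a \<Rightarrow> complex) set" where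
  "L2 M = {f \<in> borel_measurable M. sq_norm M f < \<infinity>}"

lemma L2_measurable: "f \<in> L2 M \<Longrightarrow> f \<in> borel_measurable M"
  and L2_sq_norm_finite: "f \<in> L2 M \<Longrightarrow> sq_norm M f < \<infinity>"
  by (auto simp: L2_def)

lemma sq_norm_mono: "(\<And>x. cmod (f x) \<le> cmod (g x)) \<Longrightarrow> sq_norm M f \<le> sq_norm M g"
  unfolding sq_norm_def by (intro nn_integral_mono ennreal_leI power_mono) auto

lemma cmod_add_sq_le: "(cmod (a + b))\<^sup>2 \<le> 2 * (cmod a)\<^sup>2 + 2 * (cmod b)\<^sup>2"
proof -
  have "(cmod (a + b))\<^sup>2 \<le> (cmod a + cmod b)\<^sup>2" by (intro power_mono norm_triangle_ineq) auto
  also have "\<dots> \<le> 2 * (cmod a)\<^sup>2 + 2 * (cmod b)\<^sup>2"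
    using sum_squares_bound[of "cmod a" "cmod b"] by (simp add: power2_sum)
  finally show ?thesis .
qed

lemma sq_norm_add_le:
  assumes [measurable]: "f \<in> borel_measurable M" "g \<in> borel_measurable M"
  shows "sq_norm M (\<lambda>x. f x + g x) \<le> 2 * sq_norm M f + 2 * sq_norm M g"
proof -
  have "sq_norm M (\<lambda>x. f x + g x) \<le> (\<integral>\<^sup>+ x. 2 * ennreal ((cmod (f x))\<^sup>2) + 2 * ennreal ((cmod (g x))\<^sup>2) \<partial>M)"
    unfolding sq_norm_def
  proof (rule nn_integral_mono)
    fix x
    have "ennreal ((cmod (f x + g x))\<^sup>2) \<le> ennreal (2 * (cmod (f x))\<^sup>2 + 2 * (cmod (g x))\<^sup>2)"
      by (intro ennreal_leI cmod_add_sq_le)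
    then show "ennreal ((cmod (f x + g x))\<^sup>2) \<le> 2 * ennreal ((cmod (f x))\<^sup>2) + 2 * ennreal ((cmod (g x))\<^sup>2)"
      by (simp add: ennreal_mult)
  qed
  then show ?thesis by (simp add: sq_norm_def nn_integral_add nn_integral_cmult)
qed

lemma sq_norm_minus_commute: "sq_norm M (\<lambda>x. f x - g x) = sq_norm M (\<lambda>x. g x - f x)"
  by (simp add: sq_norm_def norm_minus_commute)

lemma sq_norm_diff_le:
  assumes [measurable]: "f \<in> borel_measurable M" "g \<in> borel_measurable M"
  shows "sq_norm M (\<lambda>x. f x - g x) \<le> 2 * sq_norm M f + 2 * sq_norm M g"
  using sq_norm_add_le[of f M "\<lambda>x. - g x"] by (simp add: sq_norm_def)

lemma sq_norm_triangle_le: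
  assumes [measurable]: "f \<in> borel_measurable M" "g \<in> borel_measurable M" "h \<in> borel_measurable M"
  shows "sq_norm M (\<lambda>x. f x - h x) \<le> 2 * sq_norm M (\<lambda>x. f x - g x) + 2 * sq_norm M (\<lambda>x. g x - h x)"
  using sq_norm_add_le[of "\<lambda>x. f x - g x" M "\<lambda>x. g x - h x"] by simp

lemma L2_diff: "f \<in> L2 M \<Longrightarrow> g \<in> L2 M \<Longrightarrow> (\<lambda>x. f x - g x) \<in> L2 M"
  using sq_norm_diff_le[of f M g]
  by (auto simp: L2_def ennreal_mult_less_top intro: le_less_trans)

lemma L2_bound:
  assumes "g \<in> L2 M" "f \<in> borel_measurable M" "\<And>x. cmod (f x) \<le> cmod (g x)"
  shows "f \<in> L2 M"
  using assms sq_norm_mono[of f g M] by (auto simp: L2_def intro: le_less_trans)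

lemma sq_norm_eq_0_iff:
  assumes [measurable]: "f \<in> borel_measurable M"
  shows "sq_norm M f = 0 \<longleftrightarrow> (AE x in M. f x = 0)"
  unfolding sq_norm_def by (subst nn_integral_0_iff_AE) auto

section \<open>Pairings and completeness\<close>

lemma integrable_L2_mult:
  assumes "f \<in> L2 M" "g \<in> L2 M"
  shows "integrable M (\<lambda>x. f x * g x)"
proof (rule integrableI_bounded)
  note [measurable] = assms[THEN L2_measurable]
  show "(\<lambda>x. f x * g x) \<in> borel_measurable M" by measurable
  have "(\<integral>\<^sup>+ x. ennreal (norm (f x * g x)) \<partial>M) \<le> (\<integral>\<^sup>+ x. ennreal ((cmod (f x))\<^sup>2) + ennreal ((cmod (g x))\<^sup>2) \<partial>M)"
  proof (rule nn_integral_mono)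
    fix x
    have "2 * (cmod (f x) * cmod (g x)) \<le> (cmod (f x))\<^sup>2 + (cmod (g x))\<^sup>2"
      using sum_squares_bound[of "cmod (f x)" "cmod (g x)"] by simp
    moreover have "0 \<le> cmod (f x) * cmod (g x)" by simp
    ultimately have "norm (f x * g x) \<le> (cmod (f x))\<^sup>2 + (cmod (g x))\<^sup>2"
      unfolding norm_mult by linarith
    then show "ennreal (norm (f x * g x)) \<le> ennreal ((cmod (f x))\<^sup>2) + ennreal ((cmod (g x))\<^sup>2)"
      by (simp flip: ennreal_plus)
  qed
  also have "\<dots> = sq_norm M f + sq_norm M g" unfolding sq_norm_def by (rule nn_integral_add) auto
  also have "\<dots> < \<infinity>" using assms by (auto simp: L2_def)
  finally show "(\<integral>\<^sup>+ x. ennreal (norm (f x * g x)) \<partial>M) < \<infinity>" .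
qed

lemma ennreal_mult_plus_mult:
  "0 \<le> a \<Longrightarrow> 0 \<le> b \<Longrightarrow> 0 \<le> c \<Longrightarrow> 0 \<le> d \<Longrightarrow> ennreal (a * b + c * d) = ennreal a * ennreal b + ennreal c * ennreal d"
  by (simp add: ennreal_mult)

text \<open>Young's inequality with a free parameter takes the place of Cauchy-Schwarz, so that no
  roots of extended reals occur.\<close>

lemma ennreal_cmod_integral_mult_le:
  assumes f: "f \<in> L2 M" and g: "g \<in> L2 M" and e: "0 < e"
  shows "ennreal (cmod (\<integral>x. f x * g x \<partial>M)) \<le> ennreal (1 / (2 * e)) * sq_norm M f + ennreal (e / 2) * sq_norm M g"
proof -
  note [measurable] = f[THEN L2_measurable] g[THEN L2_measurable]
  have "ennreal (cmod (\<integral>x. f x * g x \<partial>M)) \<le> (\<integral>\<^sup>+ x. ennreal (norm (f x * g x)) \<partial>M)"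
    by (intro integral_norm_bound_ennreal integrable_L2_mult f g)
  also have "\<dots> \<le> (\<integral>\<^sup>+ x. ennreal (1 / (2 * e)) * ennreal ((cmod (f x))\<^sup>2) + ennreal (e / 2) * ennreal ((cmod (g x))\<^sup>2) \<partial>M)"
  proof (rule nn_integral_mono)
    fix x
    let ?a = "cmod (f x)" and ?b = "cmod (g x)"
    have "0 \<le> (?a - e * ?b)\<^sup>2" by simp
    then have "?a * ?b \<le> 1 / (2 * e) * ?a\<^sup>2 + e / 2 * ?b\<^sup>2"
      using e by (simp add: power2_eq_square field_simps)
    then have "ennreal (norm (f x * g x)) \<le> ennreal (1 / (2 * e) * ?a\<^sup>2 + e / 2 * ?b\<^sup>2)"
      unfolding norm_mult by (rule ennreal_leI)
    also have "\<dots> = ennreal (1 / (2 * e)) * ennreal (?a\<^sup>2) + ennreal (e / 2) * ennreal (?b\<^sup>2)"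
      using e by (intro ennreal_mult_plus_mult) auto
    finally show "ennreal (norm (f x * g x)) \<le> \<dots>" .
  qed
  also have "\<dots> = ennreal (1 / (2 * e)) * sq_norm M f + ennreal (e / 2) * sq_norm M g"
    unfolding sq_norm_def by (simp add: nn_integral_add nn_integral_cmult)
  finally show ?thesis .
qed

lemma integral_mult_tendsto_0:
  assumes f: "\<And>n. f n \<in> L2 M" and g: "g \<in> L2 M" and lim: "(\<lambda>n. sq_norm M (f n)) \<longlonglongrightarrow> 0"
  shows "(\<lambda>n. \<integral>x. f n x * g x \<partial>M) \<longlonglongrightarrow> 0"
proof -
  define G where "G = enn2real (sq_norm M g)"
  have G: "sq_norm M g = ennreal G" "0 \<le> G" using L2_sq_norm_finite[OF g] by (auto simp: G_def)
  have "eventually (\<lambda>n. cmod (\<integral>x. f n x * g x \<partial>M) < d) sequentially" if d: "0 < d" for d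
  proof -
    \<comment> \<open>This makes the contribution of \<open>g\<close> at most d / 2; the added 1
      covers G = 0. Once the squared norm of \<open>f n\<close> is below e d / 2, its own
      contribution is at most d / 4.\<close>
    define e where "e = d / (G + 1)"
    have e: "0 < e" using d G by (simp add: e_def add_nonneg_pos)
    have eG: "e / 2 * G \<le> d / 2" using d G by (simp add: e_def field_simps)
    have "eventually (\<lambda>n. sq_norm M (f n) < ennreal (e * d / 2)) sequentially"
      using lim by (rule order_tendstoD) (use e d in auto)
    then show ?thesis
    proof eventually_elim
      case (elim n)
      have "ennreal (cmod (\<integral>x. f n x * g x \<partial>M)) \<le> ennreal (1 / (2 * e)) * sq_norm M (f n) + ennreal (e / 2) * ennreal G"
        using ennreal_cmod_integral_mult_le[OF f g e] G by simp
      also have "\<dots> \<le> ennreal (1 / (2 * e)) * ennreal (e * d / 2) + ennreal (e / 2) * ennreal G"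
        using elim by (intro add_mono mult_left_mono) auto
      also have "\<dots> = ennreal (1 / (2 * e) * (e * d / 2) + e / 2 * G)"
        using e d G by (intro ennreal_mult_plus_mult[symmetric]) auto
      finally have "ennreal (cmod (\<integral>x. f n x * g x \<partial>M)) \<le> ennreal (1 / (2 * e) * (e * d / 2) + e / 2 * G)" .
      moreover have q: "1 / (2 * e) * (e * d / 2) = d / 4" using e by (simp add: field_simps)
      have "1 / (2 * e) * (e * d / 2) + e / 2 * G \<le> d / 4 + d / 2" by (rule add_mono[OF eq_refl[OF q] eG])
      then have "ennreal (1 / (2 * e) * (e * d / 2) + e / 2 * G) \<le> ennreal (d / 4 + d / 2)" by (rule ennreal_leI)
      ultimately have "ennreal (cmod (\<integral>x. f n x * g x \<partial>M)) \<le> ennreal (d / 4 + d / 2)" by (meson order.trans)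
      then have "cmod (\<integral>x. f n x * g x \<partial>M) \<le> d / 4 + d / 2" using d by (simp add: ennreal_le_iff)
      then show ?case using d by simp
    qed
  qed
  then show ?thesis by (intro tendstoI) (simp add: dist_norm)
qed

lemma integral_mult_tendsto:
  assumes f: "\<And>n. f n \<in> L2 M" and h: "h \<in> L2 M" and g: "g \<in> L2 M"
    and lim: "(\<lambda>n. sq_norm M (\<lambda>x. f n x - h x)) \<longlonglongrightarrow> 0"
  shows "(\<lambda>n. \<integral>x. f n x * g x \<partial>M) \<longlonglongrightarrow> (\<integral>x. h x * g x \<partial>M)"
proof -
  have "(\<lambda>n. \<integral>x. (f n x - h x) * g x \<partial>M) \<longlonglongrightarrow> 0"
    by (rule integral_mult_tendsto_0[OF L2_diff[OF f h] g lim])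
  moreover have "(\<integral>x. (f n x - h x) * g x \<partial>M) = (\<integral>x. f n x * g x \<partial>M) - (\<integral>x. h x * g x \<partial>M)" for n
    using integrable_L2_mult[OF f g] integrable_L2_mult[OF h g] by (simp add: left_diff_distrib)
  ultimately show ?thesis using LIM_zero_cancel by fastforce
qed

lemma ennreal_tendsto_0_iff_less:
  fixes f :: "nat \<Rightarrow> ennreal"
  shows "f \<longlonglongrightarrow> 0 \<longleftrightarrow> (\<forall>e>0. eventually (\<lambda>n. f n < ennreal e) sequentially)"
proof
  assume *: "\<forall>e>0. eventually (\<lambda>n. f n < ennreal e) sequentially"
  show "f \<longlonglongrightarrow> 0"
  proof (rule order_tendstoI)
    fix a :: ennreal assume "0 < a"
    show "eventually (\<lambda>n. f n < a) sequentially"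
    proof (cases a)
      case (real r)
      then show ?thesis using * \<open>0 < a\<close> by simp
    next
      case top
      from * have "eventually (\<lambda>n. f n < ennreal 1) sequentially" using zero_less_one by blast
      then show ?thesis by eventually_elim (auto simp: top intro: less_trans)
    qed
  qed simp
qed (auto intro: order_tendstoD)

text \<open>Riesz-Fischer: a rapidly Cauchy subsequence converges almost everywhere, and Fatou's
  lemma turns this into convergence in norm of the whole sequence.\<close>

lemma L2_complete:
  assumes f: "\<And>n::nat. f n \<in> L2 M"
    and cauchy: "\<And>e. 0 < e \<Longrightarrow> \<exists>N. \<forall>m\<ge>N. \<forall>n\<ge>N. sq_norm M (\<lambda>x. f m x - f n x) \<le> ennreal e"
  obtains h where "h \<in> L2 M" "(\<lambda>n. sq_norm M (\<lambda>x. f n x - h x)) \<longlonglongrightarrow> 0"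
proof -
  note [measurable] = f[THEN L2_measurable]
  from cauchy have "\<forall>k. \<exists>N. \<forall>m\<ge>N. \<forall>n\<ge>N. sq_norm M (\<lambda>x. f m x - f n x) \<le> ennreal ((1/4) ^ k)" by simp
  then obtain N where N: "\<And>k m n. N k \<le> m \<Longrightarrow> N k \<le> n \<Longrightarrow> sq_norm M (\<lambda>x. f m x - f n x) \<le> ennreal ((1/4) ^ k)"
    by metis
  \<comment> \<open>Summing all earlier thresholds makes \<open>r\<close> monotone and at least
    \<open>N k\<close>; the summand \<open>k\<close> makes it unbounded.\<close>
  define r where "r k = (\<Sum>i\<le>k. N i) + k" for k
  have r_ge: "N k \<le> r k" for k unfolding r_def by (simp add: trans_le_add1 member_le_sum)
  have r_Suc: "r k \<le> r (Suc k)" for k unfolding r_def by simp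
  have k_le: "k \<le> r k" for k unfolding r_def by simp
  define d where "d k x = f (r (Suc k)) x - f (r k) x" for k x
  have [measurable]: "d k \<in> borel_measurable M" for k unfolding d_def[abs_def] by measurable
  have dk: "sq_norm M (d k) \<le> ennreal ((1/4) ^ k)" for k
    unfolding d_def[abs_def] using r_ge[of k] r_Suc[of k] by (intro N) auto
  \<comment> \<open>The weight \<open>2 ^ k\<close> still leaves a convergent series of integrals,
    since the squared norms are at most 4^(-k). Where \<open>?S\<close> is finite, the increments
    are of order 2^(-k/2) and hence summable.\<close>
  let ?S = "\<lambda>x. \<Sum>k. ennreal (2 ^ k) * ennreal ((cmod (d k x))\<^sup>2)"
  have "(\<integral>\<^sup>+ x. ?S x \<partial>M) = (\<Sum>k. ennreal (2 ^ k) * sq_norm M (d k))"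
    unfolding sq_norm_def by (subst nn_integral_suminf) (auto simp: nn_integral_cmult)
  also have "\<dots> \<le> (\<Sum>k. ennreal ((1/2) ^ k))"
  proof (rule suminf_le)
    fix k
    have "ennreal (2 ^ k) * sq_norm M (d k) \<le> ennreal (2 ^ k) * ennreal ((1/4) ^ k)"
      by (intro mult_left_mono dk) auto
    also have "\<dots> = ennreal ((1/2) ^ k)"
      by (subst ennreal_mult[symmetric]) (auto simp flip: power_mult_distrib)
    finally show "ennreal (2 ^ k) * sq_norm M (d k) \<le> ennreal ((1/2) ^ k)" .
  qed auto
  also have "\<dots> < \<infinity>" by (subst suminf_ennreal2) (auto intro: summable_geometric)
  finally have "AE x in M. ?S x \<noteq> \<infinity>" by (intro nn_integral_PInf_AE) auto
  then have conv: "AE x in M. convergent (\<lambda>k. f (r k) x)"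
  proof eventually_elim
    case (elim x)
    define S where "S = enn2real (?S x)"
    have S: "?S x = ennreal S" "0 \<le> S" using elim by (auto simp: S_def less_top)
    have "cmod (d k x) \<le> sqrt S * (1 / sqrt 2) ^ k" for k
    proof -
      have "ennreal (2 ^ k) * ennreal ((cmod (d k x))\<^sup>2) \<le> ?S x"
        using sum_le_suminf[of "\<lambda>k. ennreal (2 ^ k) * ennreal ((cmod (d k x))\<^sup>2)" "{k}"] by simp
      then have "ennreal (2 ^ k * (cmod (d k x))\<^sup>2) \<le> ennreal S" unfolding S by (simp add: ennreal_mult)
      then have "2 ^ k * (cmod (d k x))\<^sup>2 \<le> S" using S(2) by (simp add: ennreal_le_iff)
      then have "sqrt (2 ^ k * (cmod (d k x))\<^sup>2) \<le> sqrt S" by (rule real_sqrt_le_mono)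
      then show ?thesis by (simp add: real_sqrt_mult real_sqrt_power power_divide field_simps)
    qed
    moreover have "summable (\<lambda>k. sqrt S * (1 / sqrt 2) ^ k)" by (intro summable_mult summable_geometric) simp
    ultimately have "summable (\<lambda>k. d k x)" by (intro summable_comparison_test[of "\<lambda>k. d k x" "\<lambda>k. sqrt S * (1 / sqrt 2) ^ k"]) auto
    then have "convergent (\<lambda>n. \<Sum>k<n. d k x)" by (simp add: summable_iff_convergent)
    moreover have "(\<Sum>k<n. d k x) = f (r n) x - f (r 0) x" for n
      unfolding d_def by (rule sum_lessThan_telescope)
    ultimately have "convergent (\<lambda>n. f (r n) x - f (r 0) x)" by simp
    then show ?case by (simp add: convergent_diff_const_right_iff)
  qed
  \<comment> \<open>On the null set without convergence \<open>lim\<close> is some default value;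
    the limit function is measurable all the same.\<close>
  define h where "h x = lim (\<lambda>k. f (r k) x)" for x
  have [measurable]: "h \<in> borel_measurable M" unfolding h_def[abs_def] by measurable
  have fatou: "sq_norm M (\<lambda>x. f n x - h x) \<le> ennreal ((1/4) ^ k)" if "N k \<le> n" for n k
  proof -
    have "sq_norm M (\<lambda>x. f n x - h x) \<le> (\<integral>\<^sup>+ x. liminf (\<lambda>j. ennreal ((cmod (f n x - f (r j) x))\<^sup>2)) \<partial>M)"
      unfolding sq_norm_def
    proof (rule nn_integral_mono_AE)
      show "AE x in M. ennreal ((cmod (f n x - h x))\<^sup>2) \<le> liminf (\<lambda>j. ennreal ((cmod (f n x - f (r j) x))\<^sup>2))"
        using conv
      proof eventually_elim
        case (elim x)
        then have "(\<lambda>j. f (r j) x) \<longlonglongrightarrow> h x" unfolding h_def by (simp add: convergent_LIMSEQ_iff)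
        then have "(\<lambda>j. ennreal ((cmod (f n x - f (r j) x))\<^sup>2)) \<longlonglongrightarrow> ennreal ((cmod (f n x - h x))\<^sup>2)"
          by (intro tendsto_intros)
        from lim_imp_Liminf[OF _ this] show ?case by simp
      qed
    qed
    also have "\<dots> \<le> liminf (\<lambda>j. sq_norm M (\<lambda>x. f n x - f (r j) x))"
      unfolding sq_norm_def by (rule nn_integral_liminf) measurable
    also have "\<dots> \<le> liminf (\<lambda>j::nat. ennreal ((1/4) ^ k))"
    proof (rule Liminf_mono)
      show "eventually (\<lambda>j. sq_norm M (\<lambda>x. f n x - f (r j) x) \<le> ennreal ((1/4) ^ k)) sequentially"
        using eventually_ge_at_top[of "N k"]
        by eventually_elim (use that k_le in \<open>auto intro!: N intro: order.trans\<close>)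
    qed
    finally show ?thesis by (simp add: Liminf_const)
  qed
  have lim: "(\<lambda>n. sq_norm M (\<lambda>x. f n x - h x)) \<longlonglongrightarrow> 0"
    unfolding ennreal_tendsto_0_iff_less
  proof (intro allI impI)
    fix e :: real assume e: "0 < e"
    obtain k where "(1/4) ^ k < e" using real_arch_pow_inv[OF e, of "1/4"] by auto
    then have "ennreal ((1/4) ^ k) < ennreal e" using e by (intro ennreal_lessI)
    then show "eventually (\<lambda>n. sq_norm M (\<lambda>x. f n x - h x) < ennreal e) sequentially"
      using fatou[of k] unfolding eventually_sequentially by (meson le_less_trans)
  qed
  have "h \<in> L2 M"
  proof -
    have "(\<lambda>x. f (N 0) x - h x) \<in> L2 M"
      using fatou[of 0 "N 0"] by (auto simp: L2_def intro: le_less_trans)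
    from L2_diff[OF f[of "N 0"] this] show ?thesis by simp
  qed
  with lim show ?thesis using that by blast
qed

lemma L2_tendsto_cauchy:
  assumes f: "\<And>n::nat. f n \<in> L2 M" and h: "h \<in> L2 M"
    and lim: "(\<lambda>n. sq_norm M (\<lambda>x. f n x - h x)) \<longlonglongrightarrow> 0" and e: "0 < e"
  shows "\<exists>N. \<forall>m\<ge>N. \<forall>n\<ge>N. sq_norm M (\<lambda>x. f m x - f n x) \<le> ennreal e"
proof -
  note [measurable] = f[THEN L2_measurable] h[THEN L2_measurable]
  have "eventually (\<lambda>n. sq_norm M (\<lambda>x. f n x - h x) < ennreal (e / 4)) sequentially"
    using lim by (rule order_tendstoD) (use e in auto)
  then obtain N where N: "\<And>n. N \<le> n \<Longrightarrow> sq_norm M (\<lambda>x. f n x - h x) < ennreal (e / 4)"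
    by (auto simp: eventually_sequentially)
  have "sq_norm M (\<lambda>x. f m x - f n x) \<le> ennreal e" if "N \<le> m" "N \<le> n" for m n
  proof -
    have "sq_norm M (\<lambda>x. f m x - f n x) \<le> 2 * sq_norm M (\<lambda>x. f m x - h x) + 2 * sq_norm M (\<lambda>x. h x - f n x)"
      by (rule sq_norm_triangle_le) measurable
    also have "\<dots> \<le> 2 * ennreal (e / 4) + 2 * ennreal (e / 4)"
      using N[OF that(1)] N[OF that(2)]
      by (intro add_mono mult_left_mono) (auto simp: sq_norm_minus_commute[of M h])
    also have "\<dots> = ennreal 2 * ennreal (e / 4) + ennreal 2 * ennreal (e / 4)" by simp
    also have "\<dots> = ennreal e" using e
      by (simp flip: ennreal_mult ennreal_plus del: ennreal_numeral)
    finally show ?thesis .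
  qed
  then show ?thesis by blast
qed

section \<open>Translation between the norm of the statement and its square\<close>

lemma Lp_norm_2_eq: "Lp_norm 2 M f = ennreal_powr (sq_norm M f) (1 / 2)"
proof -
  have "cmod w powr 2 = (cmod w)\<^sup>2" for w by (cases "w = 0") (auto simp: powr_numeral)
  then show ?thesis by (simp add: Lp_norm_def sq_norm_def)
qed

lemma ennreal_powr_half_less_iff:
  assumes "0 < e"
  shows "ennreal_powr x (1 / 2) < ennreal e \<longleftrightarrow> x < ennreal (e\<^sup>2)"
proof (cases x)
  case (real r)
  have "sqrt r < e \<longleftrightarrow> r < e\<^sup>2" using assms real
    by (metis abs_of_pos real_sqrt_abs real_sqrt_less_iff)
  then show ?thesis using assms real by (simp add: ennreal_powr_def powr_half_sqrt ennreal_less_iff)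
qed (simp add: ennreal_powr_def)

lemma Lp_norm_2_tendsto_0_iff:
  "(\<lambda>n. Lp_norm 2 M (f n)) \<longlonglongrightarrow> 0 \<longleftrightarrow> (\<lambda>n. sq_norm M (f n)) \<longlonglongrightarrow> 0"
proof
  assume "(\<lambda>n. Lp_norm 2 M (f n)) \<longlonglongrightarrow> 0"
  then have "eventually (\<lambda>n. Lp_norm 2 M (f n) < ennreal (sqrt e)) sequentially" if "0 < e" for e
    using that by (simp add: ennreal_tendsto_0_iff_less)
  then show "(\<lambda>n. sq_norm M (f n)) \<longlonglongrightarrow> 0"
    by (simp add: ennreal_tendsto_0_iff_less Lp_norm_2_eq ennreal_powr_half_less_iff)
next
  assume "(\<lambda>n. sq_norm M (f n)) \<longlonglongrightarrow> 0"
  then show "(\<lambda>n. Lp_norm 2 M (f n)) \<longlonglongrightarrow> 0"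
    by (simp add: ennreal_tendsto_0_iff_less Lp_norm_2_eq ennreal_powr_half_less_iff)
qed

lemma Lp_space_2_eq: "Lp_space 2 M = L2 M"
proof -
  have "ennreal_powr x (1 / 2) < \<infinity> \<longleftrightarrow> x < \<infinity>" for x
    by (auto simp: ennreal_powr_def less_top)
  then show ?thesis by (simp add: Lp_space_def L2_def Lp_norm_2_eq)
qed

section \<open>Vanishing of Gaussian and Fourier integrals\<close>

lemma AE_eq_0_if_set_integrals_0:
  fixes m :: "'a \<Rightarrow> complex"
  assumes m: "integrable M m" and z: "\<And>A. A \<in> sets M \<Longrightarrow> (LINT x:A|M. m x) = 0"
  shows "AE x in M. m x = 0"
proof -
  have 0: "(LINT x:A|M. (0::real)) = 0" for A by (simp add: set_lebesgue_integral_def)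
  have si: "set_integrable M A m" if "A \<in> sets M" for A
    using m that unfolding set_integrable_def by (rule integrable_mult_indicator[rotated])
  have "AE x in M. Re (m x) = 0"
  proof (rule density_unique_real)
    fix A assume A: "A \<in> sets M"
    have "(LINT x:A|M. Re (m x)) = Re (LINT x:A|M. m x)"
      using si[OF A] unfolding set_lebesgue_integral_def set_integrable_def by (subst integral_Re[symmetric]) auto
    then show "(LINT x:A|M. Re (m x)) = (LINT x:A|M. 0)" by (simp add: z[OF A] 0)
  qed (use m in auto)
  moreover have "AE x in M. Im (m x) = 0"
  proof (rule density_unique_real)
    fix A assume A: "A \<in> sets M"
    have "(LINT x:A|M. Im (m x)) = Im (LINT x:A|M. m x)"
      using si[OF A] unfolding set_lebesgue_integral_def set_integrable_def by (subst integral_Im[symmetric]) auto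
    then show "(LINT x:A|M. Im (m x)) = (LINT x:A|M. 0)" by (simp add: z[OF A] 0)
  qed (use m in auto)
  ultimately show ?thesis by eventually_elim (simp add: complex_eq_iff)
qed

text \<open>A Dynkin argument: open intervals form an intersection-stable generator of the Borel
  sets, and the sets with vanishing integral are closed under complements and countable disjoint
  unions.\<close>

lemma AE_eq_0_if_interval_integrals_0:
  fixes m :: "real \<Rightarrow> complex"
  assumes m: "integrable lborel m" and z: "\<And>a b. a < b \<Longrightarrow> (LINT x:{a<..<b}|lborel. m x) = 0"
  shows "AE x in lborel. m x = 0"
proof (rule AE_eq_0_if_set_integrals_0[OF m])
  have si: "set_integrable lborel A m" if "A \<in> sets borel" for A
    using m that unfolding set_integrable_def by (intro integrable_mult_indicator) auto
  have gen: "sets (borel :: real measure) = sigma_sets UNIV (range (\<lambda>(a, b). {a<..<b}))"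
    using arg_cong[OF borel_eq_box[where 'a = real], of sets] by (simp add: box_real)
  \<comment> \<open>The complement step of the induction subtracts from the integral over the whole
    line, so that integral has to vanish first.\<close>
  have total: "(LINT x:UNIV|lborel. m x) = 0"
  proof -
    have "(\<lambda>n. LINT x:{- real (Suc n)<..<real (Suc n)}|lborel. m x) \<longlonglongrightarrow> (LINT x:UNIV|lborel. m x)"
      unfolding set_lebesgue_integral_def
    proof (rule integral_dominated_convergence[where w = "\<lambda>x. norm (m x)"])
      show "AE x in lborel. (\<lambda>n. indicat_real {- real (Suc n)<..<real (Suc n)} x *\<^sub>R m x) \<longlonglongrightarrow> indicat_real UNIV x *\<^sub>R m x"
      proof (rule AE_I2)
        fix x :: real
        obtain N :: nat where N: "\<bar>x\<bar> < real N" using reals_Archimedean2 by blast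
        have "eventually (\<lambda>n. indicat_real {- real (Suc n)<..<real (Suc n)} x *\<^sub>R m x = m x) sequentially"
          using eventually_ge_at_top[of N] by eventually_elim (use N in \<open>auto simp: indicator_def\<close>)
        then show "(\<lambda>n. indicat_real {- real (Suc n)<..<real (Suc n)} x *\<^sub>R m x) \<longlonglongrightarrow> indicat_real UNIV x *\<^sub>R m x"
          by (simp add: tendsto_eventually)
      qed
    qed (use m in \<open>auto split: split_indicator\<close>)
    moreover have "(LINT x:{- real (Suc n)<..<real (Suc n)}|lborel. m x) = 0" for n
      by (rule z) simp
    ultimately show ?thesis by (simp add: LIMSEQ_const_iff)
  qed
  fix A :: "real set" assume "A \<in> sets lborel"
  then have A: "A \<in> sigma_sets UNIV (range (\<lambda>(a, b). {a<..<b}))" by (simp add: gen)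
  have "Int_stable (range (\<lambda>(a, b). {a<..<b::real}))"
  proof (rule Int_stableI)
    fix A B assume "A \<in> range (\<lambda>(a, b). {a<..<b::real})" "B \<in> range (\<lambda>(a, b). {a<..<b::real})"
    then obtain a b c d where "A = {a<..<b}" "B = {c<..<d}" by auto
    then have "A \<inter> B = (\<lambda>(a, b). {a<..<b}) (max a c, min b d)" by auto
    then show "A \<inter> B \<in> range (\<lambda>(a, b). {a<..<b::real})" by blast
  qed
  moreover have "range (\<lambda>(a, b). {a<..<b::real}) \<subseteq> Pow UNIV" by simp
  moreover note A
  ultimately show "(LINT x:A|lborel. m x) = 0"
  proof (induction rule: sigma_sets_induct_disjoint)
    case (basic A)
    then obtain a b where A: "A = {a<..<b}" by auto
    show ?case
    proof (cases "a < b")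
      case False
      then show ?thesis by (simp add: A set_lebesgue_integral_def)
    qed (simp add: A z)
  next
    case empty
    then show ?case by (simp add: set_lebesgue_integral_def)
  next
    case (compl A)
    then have A: "A \<in> sets borel" by (simp add: gen)
    then have A': "UNIV - A \<in> sets borel" by auto
    have "(LINT x:(A \<union> (UNIV - A))|lborel. m x) = (LINT x:A|lborel. m x) + (LINT x:(UNIV - A)|lborel. m x)"
      by (rule set_integral_Un) (use si A A' in auto)
    then show ?case using compl total by simp
  next
    case (union B)
    then have B: "B i \<in> sets borel" for i by (auto simp: gen)
    have "(LINT x:(\<Union>i. B i)|lborel. m x) = (\<Sum>i. LINT x:B i|lborel. m x)"
    proof (rule lebesgue_integral_countable_add)
      show "set_integrable lborel (\<Union>i. B i) m" using B by (intro si) auto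
    qed (use B union.hyps(1) in \<open>auto simp: disjoint_family_on_def\<close>)
    then show ?case using union by simp
  qed
qed

lemma integrable_gauss_weight_shift:
  assumes "0 < \<sigma>"
  shows "integrable lborel (\<lambda>x. gauss_weight \<sigma> (x - a))"
  using lborel_integrable_real_affine[OF integrable_gauss_weight[OF assms], of 1 "- a"] by simp

text \<open>Integrating the hypothesis over centres in an interval shows that \<open>m\<close> is
  orthogonal to the mollified indicator of the interval. As sigma tends to 0 this becomes the
  indicator away from the two end points.\<close>

lemma AE_eq_0_if_gauss_integrals_0:
  fixes m :: "real \<Rightarrow> complex"
  assumes m: "integrable lborel m"
    and z: "\<And>a \<sigma>. 0 < \<sigma> \<Longrightarrow> (\<integral>x. m x * of_real (gauss_weight \<sigma> (x - a)) \<partial>lborel) = 0"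
  shows "AE x in lborel. m x = 0"
proof (rule AE_eq_0_if_interval_integrals_0[OF m])
  fix a b :: real assume "a < b"
  note [measurable] = borel_measurable_integrable[OF m]
  let ?J = "indicat_real {a<..<b}"
  let ?w = "\<lambda>(x, \<eta>). of_real (cmod (m x)) * complex_of_real (gauss_weight 1 \<eta>)"
  \<comment> \<open>The mollification after the substitution x + sigma eta for the centre. In this
    form sigma = 0 makes sense and gives a product, and the dominating function \<open>?w\<close> is
    the same for all sigma.\<close>
  define H where "H \<sigma> p = m (fst p) * of_real (?J (fst p + \<sigma> * snd p) * gauss_weight 1 (snd p))" for \<sigma> p
  have w: "integrable (lborel \<Otimes>\<^sub>M lborel) ?w"
    using m integrable_gauss_weight[of 1] by (intro integrable_pair_mult sigma_finite_lborel) auto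
  have Hw: "norm (H \<sigma> p) \<le> norm (?w p)" for \<sigma> p
    by (auto simp: H_def norm_mult case_prod_unfold split: split_indicator)
  have Hm [measurable]: "H \<sigma> \<in> borel_measurable (lborel \<Otimes>\<^sub>M lborel)" for \<sigma>
    unfolding H_def[abs_def] by measurable
  have Hi: "integrable (lborel \<Otimes>\<^sub>M lborel) (H \<sigma>)" for \<sigma>
    by (rule Bochner_Integration.integrable_bound[OF w]) (use Hw in auto)
  have H0: "(\<integral>p. H \<sigma> p \<partial>(lborel \<Otimes>\<^sub>M lborel)) = 0" if \<sigma>: "0 < \<sigma>" for \<sigma>
  proof -
    let ?G = "\<lambda>x x\<^sub>0. m x * of_real (?J x\<^sub>0 * gauss_weight \<sigma> (x - x\<^sub>0))"
    have Gi: "integrable (lborel \<Otimes>\<^sub>M lborel) (\<lambda>(x\<^sub>0, x). ?G x x\<^sub>0)"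
    proof (rule Bochner_Integration.integrable_bound)
      have "integrable lborel (\<lambda>x\<^sub>0. complex_of_real (?J x\<^sub>0))" using \<open>a < b\<close> by (intro integrable_of_real integrable_real_indicator) auto
      then show "integrable (lborel \<Otimes>\<^sub>M lborel) (\<lambda>(x\<^sub>0, x). complex_of_real (?J x\<^sub>0) * m x)"
        by (intro integrable_pair_mult sigma_finite_lborel m)
      show "AE p in lborel \<Otimes>\<^sub>M lborel. norm (case p of (x\<^sub>0, x) \<Rightarrow> ?G x x\<^sub>0) \<le> norm (case p of (x\<^sub>0, x) \<Rightarrow> complex_of_real (?J x\<^sub>0) * m x)"
        by (intro AE_I2) (auto simp: norm_mult gauss_weight_le_1 mult_left_le split: split_indicator)
    qed measurable
    have "(\<integral>p. H \<sigma> p \<partial>(lborel \<Otimes>\<^sub>M lborel)) = (\<integral>x. \<integral>\<eta>. H \<sigma> (x, \<eta>) \<partial>lborel \<partial>lborel)"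
      by (rule lborel_pair.integral_fst'[symmetric, OF Hi])
    also have "\<dots> = (\<integral>x. of_real (1 / \<sigma>) * (\<integral>x\<^sub>0. ?G x x\<^sub>0 \<partial>lborel) \<partial>lborel)"
    proof (rule Bochner_Integration.integral_cong[OF refl])
      fix x :: real
      have "(\<integral>x\<^sub>0. ?G x x\<^sub>0 \<partial>lborel) = \<bar>\<sigma>\<bar> *\<^sub>R (\<integral>\<eta>. ?G x (x + \<sigma> * \<eta>) \<partial>lborel)"
        using \<sigma> by (intro lborel_integral_real_affine) auto
      also have "\<dots> = of_real \<sigma> * (\<integral>\<eta>. H \<sigma> (x, \<eta>) \<partial>lborel)"
        using \<sigma> by (simp add: H_def gauss_weight_def scaleR_conv_of_real)
      finally show "(\<integral>\<eta>. H \<sigma> (x, \<eta>) \<partial>lborel) = of_real (1 / \<sigma>) * (\<integral>x\<^sub>0. ?G x x\<^sub>0 \<partial>lborel)"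
        using \<sigma> by (simp add: field_simps)
    qed
    also have "\<dots> = of_real (1 / \<sigma>) * (\<integral>x. (\<integral>x\<^sub>0. ?G x x\<^sub>0 \<partial>lborel) \<partial>lborel)" by simp
    also have "(\<integral>x. (\<integral>x\<^sub>0. ?G x x\<^sub>0 \<partial>lborel) \<partial>lborel) = (\<integral>x\<^sub>0. (\<integral>x. ?G x x\<^sub>0 \<partial>lborel) \<partial>lborel)"
      by (rule lborel_pair.Fubini_integral) (use Gi in simp)
    also have "\<dots> = (\<integral>x\<^sub>0. of_real (?J x\<^sub>0) * (\<integral>x. m x * of_real (gauss_weight \<sigma> (x - x\<^sub>0)) \<partial>lborel) \<partial>lborel)"
      by (intro Bochner_Integration.integral_cong refl) (simp add: mult.left_commute flip: integral_mult_right_zero)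
    also have "\<dots> = 0" using z[OF \<sigma>] by simp
    finally show ?thesis by simp
  qed
  have "(\<lambda>n. \<integral>p. H (inverse (real (Suc n))) p \<partial>(lborel \<Otimes>\<^sub>M lborel)) \<longlonglongrightarrow> (\<integral>p. H 0 p \<partial>(lborel \<Otimes>\<^sub>M lborel))"
  proof (rule integral_dominated_convergence[where w = "\<lambda>p. norm (?w p)"])
    show "integrable (lborel \<Otimes>\<^sub>M lborel) (\<lambda>p. norm (?w p))" using w by (rule integrable_norm)
    \<comment> \<open>At the end points of the interval the sign of \<open>snd p\<close> decides the
      limit of the indicator, so they are excluded.\<close>
    have "AE p in lborel \<Otimes>\<^sub>M lborel. fst p \<noteq> a \<and> fst p \<noteq> b"
    proof (rule lborel_pair.AE_pair_measure)
      have "AE x in lborel. (x::real) \<noteq> a" "AE x in lborel. (x::real) \<noteq> b" by (rule AE_lborel_singleton)+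
      then show "AE x in lborel. AE y in lborel. fst (x, y) \<noteq> a \<and> fst (x, y) \<noteq> b"
        by eventually_elim simp
    qed measurable
    then show "AE p in lborel \<Otimes>\<^sub>M lborel. (\<lambda>n. H (inverse (real (Suc n))) p) \<longlonglongrightarrow> H 0 p"
    proof eventually_elim
      case (elim p)
      have t: "(\<lambda>n. fst p + inverse (real (Suc n)) * snd p) \<longlonglongrightarrow> fst p + 0 * snd p"
        by (intro tendsto_intros LIMSEQ_inverse_real_of_nat)
      have "eventually (\<lambda>n. ?J (fst p + inverse (real (Suc n)) * snd p) = ?J (fst p)) sequentially"
      proof (cases "a < fst p \<and> fst p < b")
        case True
        then have "eventually (\<lambda>n. a < fst p + inverse (real (Suc n)) * snd p \<and> fst p + inverse (real (Suc n)) * snd p < b) sequentially"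
          using order_tendstoD[OF t, of a] order_tendstoD[OF t, of b] by (intro eventually_conj) auto
        then show ?thesis by eventually_elim (use True in \<open>auto simp: indicator_def\<close>)
      next
        case False
        then have "fst p < a \<or> b < fst p" using elim by auto
        then have "eventually (\<lambda>n. fst p + inverse (real (Suc n)) * snd p < a \<or> b < fst p + inverse (real (Suc n)) * snd p) sequentially"
          using order_tendstoD[OF t, of a] order_tendstoD[OF t, of b] by (auto elim: eventually_mono)
        then show ?thesis by eventually_elim (use False in \<open>auto simp: indicator_def\<close>)
      qed
      then have "eventually (\<lambda>n. H (inverse (real (Suc n))) p = H 0 p) sequentially"
        by eventually_elim (simp add: H_def)
      then show ?case by (rule tendsto_eventually)
    qed
  qed (use Hw in auto)
  moreover have "(\<integral>p. H (inverse (real (Suc n))) p \<partial>(lborel \<Otimes>\<^sub>M lborel)) = 0" for n by (rule H0) simp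
  ultimately have "(\<integral>p. H 0 p \<partial>(lborel \<Otimes>\<^sub>M lborel)) = 0" by (simp add: LIMSEQ_const_iff)
  moreover have "(\<integral>p. H 0 p \<partial>(lborel \<Otimes>\<^sub>M lborel)) = (\<integral>x. ?J x *\<^sub>R m x \<partial>lborel) * of_real (\<integral>\<eta>. gauss_weight 1 \<eta> \<partial>lborel)"
  proof -
    have 1: "integrable lborel (\<lambda>x. ?J x *\<^sub>R m x)" using m by (intro integrable_mult_indicator) auto
    have 2: "integrable lborel (\<lambda>x. complex_of_real (gauss_weight 1 x))" using integrable_gauss_weight[of 1] by simp
    have 3: "H 0 = (\<lambda>(x, \<eta>). (?J x *\<^sub>R m x) * complex_of_real (gauss_weight 1 \<eta>))"
      by (auto simp: H_def scaleR_conv_of_real)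
    show ?thesis
      unfolding 3 integral_pair_mult[OF sigma_finite_lborel sigma_finite_lborel 1 2] integral_complex_of_real ..
  qed
  moreover have "(\<integral>\<eta>. gauss_weight 1 \<eta> \<partial>lborel) = sqrt (2 * pi)"
    using gauss_weight_eq_normal_density[of 1] by simp
  ultimately show "(LINT x:{a<..<b}|lborel. m x) = 0" by (simp add: set_lebesgue_integral_def)
qed

text \<open>Completing the square. Because a product of two Gaussians is a multiple of a Gaussian,
  testing \<open>n * gauss_weight 1\<close> against Gaussians amounts to testing \<open>n\<close>
  against Gaussians.\<close>

lemma gauss_weight_product:
  assumes \<tau>: "0 < \<tau>"
  shows "gauss_weight 1 x * gauss_weight \<tau> (x - a) =
    exp (- a\<^sup>2 / (2 * (1 + \<tau>\<^sup>2))) * gauss_weight (\<tau> / sqrt (1 + \<tau>\<^sup>2)) (x - a / (1 + \<tau>\<^sup>2))"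
proof -
  define q where "q = 1 + \<tau>\<^sup>2"
  have q: "0 < q" "\<tau>\<^sup>2 = q - 1" "0 < \<tau>\<^sup>2" using \<tau> by (auto simp: q_def add_pos_pos)
  have "((x - a / q) / (\<tau> / sqrt q))\<^sup>2 = (x - a / q)\<^sup>2 * q / \<tau>\<^sup>2"
    using q by (simp add: power_divide power_mult_distrib)
  also have "a\<^sup>2 / q + \<dots> = x\<^sup>2 + ((x - a) / \<tau>)\<^sup>2"
  proof -
    have qu: "q * (x - a / q) = q * x - a"
      using less_imp_neq[OF q(1), symmetric] by (simp add: right_diff_distrib)
    have "(a\<^sup>2 / q + (x - a / q)\<^sup>2 * q / \<tau>\<^sup>2) * (q * \<tau>\<^sup>2) = a\<^sup>2 * \<tau>\<^sup>2 + (q * (x - a / q))\<^sup>2"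
      using less_imp_neq[OF q(1), symmetric] \<tau> unfolding distrib_right power_mult_distrib by (simp add: power2_eq_square[of q])
    also have "\<dots> = a\<^sup>2 * \<tau>\<^sup>2 + (q * x - a)\<^sup>2" unfolding qu ..
    also have "\<dots> = (x\<^sup>2 + ((x - a) / \<tau>)\<^sup>2) * (q * \<tau>\<^sup>2)"
      using q \<tau> by (simp add: power_divide distrib_right) (simp add: q(2) power2_eq_square algebra_simps)
    finally show ?thesis using q \<tau> by simp
  qed
  finally have e: "a\<^sup>2 / q + ((x - a / q) / (\<tau> / sqrt q))\<^sup>2 = x\<^sup>2 + ((x - a) / \<tau>)\<^sup>2" .
  show ?thesis
    unfolding gauss_weight_def q_def[symmetric] exp_add[symmetric]
    using e by (intro arg_cong[where f = exp]) (simp add: field_simps)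
qed

lemma gauss_weight_L2: "0 < \<sigma> \<Longrightarrow> (\<lambda>x. complex_of_real (gauss_weight \<sigma> (x - a))) \<in> L2 lborel"
proof -
  assume \<sigma>: "0 < \<sigma>"
  have "sq_norm lborel (\<lambda>x. complex_of_real (gauss_weight \<sigma> (x - a))) \<le> (\<integral>\<^sup>+ x. ennreal (gauss_weight \<sigma> (x - a)) \<partial>lborel)"
    unfolding sq_norm_def by (intro nn_integral_mono ennreal_leI)
      (auto simp: power2_eq_square gauss_weight_le_1 mult_left_le)
  also have "\<dots> < \<infinity>" using integrable_gauss_weight_shift[OF \<sigma>, of a] by (simp add: nn_integral_eq_integral)
  finally show ?thesis by (simp add: L2_def)
qed

text \<open>Multiplication by one fixed Gaussian turns a square-integrable function into an
  integrable one, and since that Gaussian is strictly positive, no zeros are added.\<close>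

lemma L2_AE_eq_0_if_gauss_integrals_0:
  assumes n: "n \<in> L2 lborel"
    and z: "\<And>a \<sigma>. 0 < \<sigma> \<Longrightarrow> (\<integral>x. n x * of_real (gauss_weight \<sigma> (x - a)) \<partial>lborel) = 0"
  shows "AE x in lborel. n x = 0"
proof -
  have gL2: "(\<lambda>x. complex_of_real (gauss_weight 1 x)) \<in> L2 lborel"
    using gauss_weight_L2[of 1 0] by simp
  have "AE x in lborel. n x * of_real (gauss_weight 1 x) = 0"
  proof (rule AE_eq_0_if_gauss_integrals_0[OF integrable_L2_mult[OF n gL2]])
    fix a \<sigma> :: real assume \<sigma>: "0 < \<sigma>"
    let ?c = "complex_of_real (exp (- a\<^sup>2 / (2 * (1 + \<sigma>\<^sup>2))))"
    have "(\<integral>x. n x * of_real (gauss_weight 1 x) * of_real (gauss_weight \<sigma> (x - a)) \<partial>lborel) =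
       (\<integral>x. ?c * (n x * of_real (gauss_weight (\<sigma> / sqrt (1 + \<sigma>\<^sup>2)) (x - a / (1 + \<sigma>\<^sup>2)))) \<partial>lborel)"
      using gauss_weight_product[OF \<sigma>, of _ a]
      by (intro Bochner_Integration.integral_cong refl) (simp only: mult.assoc of_real_mult[symmetric] mult.left_commute[of ?c])
    also have "\<dots> = 0" using z[of "\<sigma> / sqrt (1 + \<sigma>\<^sup>2)"] \<sigma> by (simp add: add_pos_pos)
    finally show "(\<integral>x. n x * of_real (gauss_weight 1 x) * of_real (gauss_weight \<sigma> (x - a)) \<partial>lborel) = 0" .
  qed
  then show ?thesis by eventually_elim (auto simp: gauss_weight_def)
qed

section \<open>Uniqueness of Fourier coefficients on the circle\<close>

inductive trigonometric_polynomial :: "(real \<Rightarrow> complex) \<Rightarrow> bool" where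
  monomial: "trigonometric_polynomial (\<lambda>y. c * cis (of_int k * y))"
| add: "trigonometric_polynomial f \<Longrightarrow> trigonometric_polynomial g \<Longrightarrow> trigonometric_polynomial (\<lambda>y. f y + g y)"

lemma trigonometric_polynomial_mult:
  assumes "trigonometric_polynomial f" "trigonometric_polynomial g"
  shows "trigonometric_polynomial (\<lambda>y. f y * g y)"
  using assms
proof (induction arbitrary: g rule: trigonometric_polynomial.induct)
  case (monomial c k)
  from monomial show ?case
  proof (induction rule: trigonometric_polynomial.induct)
    case (monomial d l)
    have "(\<lambda>y. c * cis (of_int k * y) * (d * cis (of_int l * y))) = (\<lambda>y. (c * d) * cis (of_int (k + l) * y))"
    proof
      fix y
      have "cis (of_int k * y) * cis (of_int l * y) = cis (of_int (k + l) * y)" by (simp add: cis_mult distrib_right)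
      then show "c * cis (of_int k * y) * (d * cis (of_int l * y)) = c * d * cis (of_int (k + l) * y)"
        by (metis mult.assoc mult.left_commute)
    qed
    then show ?case by (simp only: trigonometric_polynomial.monomial)
  next
    case (add f g)
    then show ?case by (simp add: distrib_left trigonometric_polynomial.add)
  qed
next
  case (add f h)
  then show ?case by (simp add: distrib_right trigonometric_polynomial.add)
qed

lemma trigonometric_polynomial_of_real_polynomial:
  assumes "real_polynomial_function p"
  shows "trigonometric_polynomial (\<lambda>y. of_real (p (cis y)))"
  using assms
proof (induction rule: real_polynomial_function.induct)
  case (linear p)
  interpret bounded_linear p by fact
  \<comment> \<open>A real-linear \<open>p\<close> takes the value cos y p(1) + sin y p(i) at
    \<open>cis y\<close>; cosine and sine are then written through the modes 1 and -1.\<close>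
  have "of_real (p (cis y)) = ((of_real (p 1) - \<i> * of_real (p \<i>)) / 2) * cis (of_int 1 * y) +
     ((of_real (p 1) + \<i> * of_real (p \<i>)) / 2) * cis (of_int (- 1) * y)" for y
  proof -
    have "cis y = cos y *\<^sub>R 1 + sin y *\<^sub>R \<i>" by (simp add: complex_eq_iff)
    then have "p (cis y) = cos y * p 1 + sin y * p \<i>" by (simp only: add scaleR real_scaleR_def)
    then show ?thesis by (simp add: complex_eq_iff field_simps)
  qed
  then show ?case by (simp only:) (intro trigonometric_polynomial.intros)
next
  case (const c)
  show ?case using trigonometric_polynomial.monomial[of "of_real c" 0] by simp
next
  case (add f g)
  then show ?case by (simp add: trigonometric_polynomial.add)
next
  case (mult f g)
  then show ?case by (simp add: trigonometric_polynomial_mult)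
qed

lemma trigonometric_polynomial_integral_0:
  assumes "trigonometric_polynomial f" and m: "integrable circle m"
    and z: "\<And>k. (\<integral>y. m y * cis (of_int k * y) \<partial>circle) = 0"
  shows "integrable circle (\<lambda>y. m y * f y) \<and> (\<integral>y. m y * f y \<partial>circle) = 0"
  using assms(1)
proof (induction rule: trigonometric_polynomial.induct)
  case (monomial c k)
  note [measurable] = borel_measurable_integrable[OF m]
  have [measurable]: "(\<lambda>y. cis (of_int k * y)) \<in> borel_measurable circle" by (intro measurable_circle) measurable
  have "integrable circle (\<lambda>y. m y * cis (of_int k * y))"
    by (rule Bochner_Integration.integrable_bound[OF m]) (auto simp: norm_mult)
  then have "integrable circle (\<lambda>y. c * (m y * cis (of_int k * y)))" by simp
  moreover have "(\<integral>y. c * (m y * cis (of_int k * y)) \<partial>circle) = 0" by (simp add: z)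
  ultimately show ?case by (simp add: mult.left_commute)
next
  case (add f g)
  then show ?case by (simp add: distrib_left)
qed

text \<open>Working with functions of \<open>cis y\<close> builds periodicity in, so
  Stone-Weierstrass on the unit circle applies. The approximating polynomials are trigonometric
  polynomials in \<open>y\<close> and integrate to 0 against \<open>m\<close>, and the error is
  controlled by the integral of the modulus of \<open>m\<close>.\<close>

lemma continuous_integral_circle_0:
  fixes F :: "complex \<Rightarrow> real"
  assumes m: "integrable circle m" and F: "continuous_on UNIV F"
    and z: "\<And>k. (\<integral>y. m y * cis (of_int k * y) \<partial>circle) = 0"
  shows "(\<integral>y. m y * of_real (F (cis y)) \<partial>circle) = 0"
proof -
  note [measurable] = borel_measurable_integrable[OF m]
  have cF: "continuous_on (sphere 0 1) F" using F continuous_on_subset by blast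
  have Fm: "(\<lambda>y. F (cis y)) \<in> borel_measurable borel"
    by (rule borel_measurable_continuous_onI) (auto intro!: continuous_on_compose2[OF F] continuous_intros)
  have Fc [measurable]: "(\<lambda>y. F (cis y)) \<in> borel_measurable circle" by (rule measurable_circle[OF Fm])
  obtain B where B: "\<And>z. z \<in> sphere 0 1 \<Longrightarrow> \<bar>F z\<bar> \<le> B"
    using compact_imp_bounded[OF compact_continuous_image[OF cF compact_sphere]] unfolding bounded_iff by fastforce
  have iF: "integrable circle (\<lambda>y. m y * of_real (F (cis y)))"
  proof (rule Bochner_Integration.integrable_bound)
    show "integrable circle (\<lambda>y. of_real B * m y)" using m by simp
    have "norm (m y * of_real (F (cis y))) \<le> norm (of_real B * m y)" for y
    proof -
      have "\<bar>F (cis y)\<bar> \<le> \<bar>B\<bar>" using B[of "cis y"] by simp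
      then have "cmod (m y) * \<bar>F (cis y)\<bar> \<le> cmod (m y) * \<bar>B\<bar>" by (rule mult_left_mono) simp
      then show ?thesis by (simp add: norm_mult mult.commute)
    qed
    then show "AE y in circle. norm (m y * of_real (F (cis y))) \<le> norm (of_real B * m y)" by simp
  qed measurable
  define I where "I = (\<integral>y. cmod (m y) \<partial>circle)"
  have I: "0 \<le> I" by (simp add: I_def)
  have "cmod (\<integral>y. m y * of_real (F (cis y)) \<partial>circle) \<le> e * I" if e: "0 < e" for e
  proof -
    obtain p where p: "real_polynomial_function p" "\<And>z. z \<in> sphere 0 1 \<Longrightarrow> \<bar>F z - p z\<bar> < e"
      using Stone_Weierstrass_real_polynomial_function[OF compact_sphere cF e] by blast
    have ip: "integrable circle (\<lambda>y. m y * of_real (p (cis y)))" "(\<integral>y. m y * of_real (p (cis y)) \<partial>circle) = 0"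
      using trigonometric_polynomial_integral_0[OF trigonometric_polynomial_of_real_polynomial[OF p(1)] m z] by auto
    have "(\<integral>y. m y * of_real (F (cis y)) \<partial>circle) = (\<integral>y. m y * of_real (F (cis y)) - m y * of_real (p (cis y)) \<partial>circle)"
      using iF ip by simp
    also have "cmod \<dots> \<le> (\<integral>y. e * cmod (m y) \<partial>circle)"
    proof (rule order.trans[OF integral_norm_bound integral_mono])
      show "integrable circle (\<lambda>y. cmod (m y * of_real (F (cis y)) - m y * of_real (p (cis y))))" using iF ip(1) by simp
      show "integrable circle (\<lambda>y. e * cmod (m y))" using m by simp
      fix y
      have "m y * of_real (F (cis y)) - m y * of_real (p (cis y)) = m y * of_real (F (cis y) - p (cis y))"
        by (simp add: right_diff_distrib)
      then have "cmod (m y * of_real (F (cis y)) - m y * of_real (p (cis y))) = cmod (m y) * \<bar>F (cis y) - p (cis y)\<bar>"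
        by (simp only: norm_mult norm_of_real)
      also have "\<dots> \<le> cmod (m y) * e" using p(2)[of "cis y"] by (intro mult_left_mono) auto
      finally show "cmod (m y * of_real (F (cis y)) - m y * of_real (p (cis y))) \<le> e * cmod (m y)" by (simp add: mult.commute)
    qed
    also have "\<dots> = e * I" by (simp add: I_def)
    finally show ?thesis .
  qed
  note small = this
  have "cmod (\<integral>y. m y * of_real (F (cis y)) \<partial>circle) \<le> 0"
  proof (rule field_le_epsilon)
    fix e :: real assume "0 < e"
    \<comment> \<open>Division by I + 1 avoids a case distinction on I = 0.\<close>
    then have "cmod (\<integral>y. m y * of_real (F (cis y)) \<partial>circle) \<le> e / (I + 1) * I" using I by (intro small) auto
    also have "\<dots> \<le> e" using I \<open>0 < e\<close> by (simp add: field_simps)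
    finally show "cmod (\<integral>y. m y * of_real (F (cis y)) \<partial>circle) \<le> 0 + e" by simp
  qed
  then show ?thesis by simp
qed

lemma space_circle [simp]: "space circle = {0..<2 * pi}"
  by (simp add: circle_def space_restrict_space)

text \<open>The bound on the modulus of \<open>d\<close> excludes points that are close to the
  centre of the arc only modulo 2 pi.\<close>

lemma cos_gt_iff_arc:
  fixes d \<delta> :: real
  assumes "0 < \<delta>" "\<delta> \<le> pi" "\<bar>d\<bar> \<le> 2 * pi - \<delta>"
  shows "cos \<delta> < cos d \<longleftrightarrow> \<bar>d\<bar> < \<delta>"
proof -
  have cd: "cos d = cos \<bar>d\<bar>" by (simp add: abs_if)
  consider "\<bar>d\<bar> < \<delta>" | "\<delta> \<le> \<bar>d\<bar>" "\<bar>d\<bar> \<le> pi" | "pi < \<bar>d\<bar>" by linarith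
  then show ?thesis
  proof cases
    case 1
    then show ?thesis using assms cos_monotone_0_pi[of "\<bar>d\<bar>" \<delta>] by (simp add: cd del: cos_abs_real)
  next
    case 2
    then have "cos \<bar>d\<bar> \<le> cos \<delta>" using assms by (intro cos_monotone_0_pi_le) auto
    then show ?thesis using 2 by (simp add: cd del: cos_abs_real)
  next
    case 3
    have "cos (2 * pi - \<bar>d\<bar>) \<le> cos \<delta>" using assms 3 by (intro cos_monotone_0_pi_le) auto
    then have "cos \<bar>d\<bar> \<le> cos \<delta>" by (simp add: cos_diff del: cos_abs_real)
    then show ?thesis using 3 assms by (simp add: cd del: cos_abs_real)
  qed
qed

text \<open>Inside the fundamental domain the interval is where cos (y - c) exceeds cos delta, for
  its midpoint c and half-length delta. Ramps of \<open>n\<close> times the difference, cut off to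
  [0, 1], are continuous on the circle and converge to the indicator.\<close>

lemma arc_integral_0:
  assumes m: "integrable circle m" and z: "\<And>k. (\<integral>y. m y * cis (of_int k * y) \<partial>circle) = 0"
    and ab: "0 \<le> a" "a < b" "b \<le> 2 * pi"
  shows "(\<integral>y. m y * of_real (indicator {a<..<b} y) \<partial>circle) = 0"
proof -
  note [measurable] = borel_measurable_integrable[OF m]
  define c \<delta> where "c = (a + b) / 2" and "\<delta> = (b - a) / 2"
  define F where "F n w = min 1 (max 0 (real n * (Re (w * cis (- c)) - cos \<delta>)))" for n w
  have F: "continuous_on UNIV (F n)" for n
    unfolding F_def[abs_def] by (intro continuous_intros)
  have Fm [measurable]: "(\<lambda>y. F n (cis y)) \<in> borel_measurable circle" for n
    by (intro measurable_circle borel_measurable_continuous_onI) (auto intro!: continuous_on_compose2[OF F] continuous_intros)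
  have im: "indicator {a<..<b} \<in> borel_measurable circle" by (intro measurable_circle) measurable
  have "(\<lambda>n. \<integral>y. m y * of_real (F n (cis y)) \<partial>circle) \<longlonglongrightarrow> (\<integral>y. m y * of_real (indicator {a<..<b} y) \<partial>circle)"
  proof (rule integral_dominated_convergence[where w = "\<lambda>y. cmod (m y)"])
    show "AE y in circle. (\<lambda>n. m y * of_real (F n (cis y))) \<longlonglongrightarrow> m y * of_real (indicator {a<..<b} y)"
    proof (rule AE_I2)
      fix y assume "y \<in> space circle"
      then have y: "0 \<le> y" "y < 2 * pi" by auto
      have cy: "Re (cis y * cis (- c)) = cos (y - c)" by (simp add: cis_mult)
      have iff: "cos \<delta> < cos (y - c) \<longleftrightarrow> y \<in> {a<..<b}"
      proof -
        have "cos \<delta> < cos (y - c) \<longleftrightarrow> \<bar>y - c\<bar> < \<delta>"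
        proof (rule cos_gt_iff_arc)
          show "0 < \<delta>" "\<delta> \<le> pi" using ab by (auto simp: \<delta>_def)
          show "\<bar>y - c\<bar> \<le> 2 * pi - \<delta>" unfolding c_def \<delta>_def using ab y by (simp add: abs_le_iff field_simps)
        qed
        also have "\<dots> \<longleftrightarrow> y \<in> {a<..<b}" by (auto simp: c_def \<delta>_def abs_less_iff field_simps)
        finally show ?thesis .
      qed
      have "(\<lambda>n. F n (cis y)) \<longlonglongrightarrow> indicator {a<..<b} y"
      proof (cases "y \<in> {a<..<b}")
        case True
        then have pos: "0 < cos (y - c) - cos \<delta>" using iff by simp
        obtain N where "1 / (cos (y - c) - cos \<delta>) < real N" using reals_Archimedean2 by blast
        then have N: "1 < real N * (cos (y - c) - cos \<delta>)" using pos by (simp add: field_simps)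
        have "eventually (\<lambda>n. F n (cis y) = 1) sequentially"
          using eventually_ge_at_top[of N]
        proof eventually_elim
          case (elim n)
          then have "real N * (cos (y - c) - cos \<delta>) \<le> real n * (cos (y - c) - cos \<delta>)"
            using pos by (intro mult_right_mono) auto
          then show ?case using N unfolding F_def cy by simp
        qed
        then show ?thesis using True by (simp add: tendsto_eventually)
      next
        case False
        then have "cos (y - c) - cos \<delta> \<le> 0" using iff by (metis diff_le_0_iff_le not_le)
        then have "real n * (cos (y - c) - cos \<delta>) \<le> 0" for n by (simp add: mult_nonneg_nonpos)
        then have "F n (cis y) = 0" for n unfolding F_def cy by (simp add: max_absorb1)
        then show ?thesis using False by simp
      qed
      then show "(\<lambda>n. m y * of_real (F n (cis y))) \<longlonglongrightarrow> m y * of_real (indicator {a<..<b} y)"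
        by (intro tendsto_intros)
    qed
    show "AE y in circle. norm (m y * of_real (F n (cis y))) \<le> cmod (m y)" for n
      by (intro AE_I2) (auto simp: norm_mult F_def intro!: mult_left_le)
    show "(\<lambda>y. m y * of_real (indicator {a<..<b} y)) \<in> borel_measurable circle" using im by measurable
  qed (use m in auto)
  then show ?thesis
    using continuous_integral_circle_0[OF m F z] by (simp add: LIMSEQ_const_iff)
qed

lemma AE_eq_0_if_fourier_coefficients_0:
  assumes m: "integrable circle m" and z: "\<And>k. (\<integral>y. m y * cis (of_int k * y) \<partial>circle) = 0"
  shows "AE y in circle. m y = 0"
proof -
  let ?D = "{0..<2 * pi}"
  have restr: "(\<integral>y. f y \<partial>circle) = (\<integral>y. indicat_real ?D y *\<^sub>R f y \<partial>lborel)" for f :: "real \<Rightarrow> complex"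
    unfolding circle_def by (subst integral_restrict_space) auto
  have mi: "integrable lborel (\<lambda>y. indicat_real ?D y *\<^sub>R m y)"
    using m unfolding circle_def by (subst (asm) integrable_restrict_space) auto
  have "AE y in lborel. indicat_real ?D y *\<^sub>R m y = 0"
  proof (rule AE_eq_0_if_interval_integrals_0[OF mi])
    fix a b :: real assume "a < b"
    \<comment> \<open>The interval is clipped to the fundamental domain. The clipped open interval
      omits the point 0, so the two integrands agree only almost everywhere.\<close>
    define a' b' where "a' = max a 0" and "b' = min b (2 * pi)"
    have "(LINT y:{a<..<b}|lborel. indicat_real ?D y *\<^sub>R m y) = (\<integral>y. indicat_real {a'<..<b'} y *\<^sub>R (indicat_real ?D y *\<^sub>R m y) \<partial>lborel)"
      unfolding set_lebesgue_integral_def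
    proof (rule integral_cong_AE)
      have "AE y in lborel. (y::real) \<noteq> 0" by (rule AE_lborel_singleton)
      then show "AE y in lborel. indicat_real {a<..<b} y *\<^sub>R indicat_real ?D y *\<^sub>R m y = indicat_real {a'<..<b'} y *\<^sub>R indicat_real ?D y *\<^sub>R m y"
        by eventually_elim (auto simp: a'_def b'_def split: split_indicator)
    next
      note [measurable] = borel_measurable_integrable[OF mi]
      show "(\<lambda>y. indicat_real {a<..<b} y *\<^sub>R indicat_real ?D y *\<^sub>R m y) \<in> borel_measurable lborel"
        "(\<lambda>y. indicat_real {a'<..<b'} y *\<^sub>R indicat_real ?D y *\<^sub>R m y) \<in> borel_measurable lborel"
        by (intro borel_measurable_scaleR borel_measurable_integrable[OF mi]; simp)+
    qed
    also have "\<dots> = (\<integral>y. m y * of_real (indicat_real {a'<..<b'} y) \<partial>circle)"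
      unfolding restr by (intro Bochner_Integration.integral_cong refl) (auto split: split_indicator)
    also have "\<dots> = 0"
    proof (cases "a' < b'")
      case True
      then show ?thesis by (intro arc_integral_0[OF m z]) (auto simp: a'_def b'_def)
    qed simp
    finally show "(LINT y:{a<..<b}|lborel. indicat_real ?D y *\<^sub>R m y) = 0" .
  qed
  then show ?thesis
    unfolding circle_def by (subst AE_restrict_space_iff) (auto elim!: eventually_mono split: split_indicator_asm)
qed

section \<open>Separating families on the cylinder and on frequency space\<close>

lemma cylinder_slice_measurable [measurable]: "(\<lambda>y. (x, y)) \<in> measurable circle cylinder"
  unfolding cylinder_eq by (rule measurable_Pair1') simp

lemma frequency_slice_measurable [measurable]: "(\<lambda>\<xi>. (\<xi>, k)) \<in> measurable borel frequency_space"
proof -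
  have "(\<lambda>\<xi>. (\<xi>, k)) \<in> measurable lborel frequency_space"
    unfolding frequency_space_def by (rule measurable_Pair2') simp
  then show ?thesis by simp
qed

lemma nn_integral_cylinder:
  "f \<in> borel_measurable cylinder \<Longrightarrow> (\<integral>\<^sup>+ z. f z \<partial>cylinder) = (\<integral>\<^sup>+ x. \<integral>\<^sup>+ y. f (x, y) \<partial>circle \<partial>lborel)"
  unfolding cylinder_eq by (rule nn_integral_pair_measure[OF sigma_finite_circle])

text \<open>Test data on a single line of frequency space. With Gaussian \<open>a\<close> these
  functions are separating, by \<open>L2_frequency_AE_eq_0\<close>, and their inverse transforms are
  explicit.\<close>

definition mode_function :: "int \<Rightarrow> (real \<Rightarrow> complex) \<Rightarrow> real \<times> int \<Rightarrow> complex" where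
  "mode_function k a q = a (fst q) * of_real (indicator {k} (snd q))"

lemma integrable_mode_function:
  assumes "integrable lborel a"
  shows "integrable frequency_space (mode_function k a)"
proof -
  have C: "sigma_finite_measure (count_space (UNIV :: int set))" by (rule sigma_finite_measure_count_space)
  have i: "integrable (count_space (UNIV :: int set)) (\<lambda>l. complex_of_real (indicator {k} l))"
    by (intro integrable_of_real integrable_real_indicator) auto
  have e: "mode_function k a = (\<lambda>(\<xi>, l). a \<xi> * of_real (indicator {k} l))" by (auto simp: mode_function_def)
  show ?thesis
    unfolding e frequency_space_def by (rule integrable_pair_mult[OF sigma_finite_lborel C assms i])
qed

lemma mode_function_integral:
  assumes b: "integrable frequency_space (\<lambda>q. mode_function k a q * b q)"
  shows "(\<integral>q. mode_function k a q * b q \<partial>frequency_space) = (\<integral>\<xi>. a \<xi> * b (\<xi>, k) \<partial>lborel)"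
proof -
  interpret C: sigma_finite_measure "count_space (UNIV :: int set)" by (rule sigma_finite_measure_count_space)
  interpret P: pair_sigma_finite "lborel :: real measure" "count_space (UNIV :: int set)" ..
  let ?g = "\<lambda>l. \<integral>\<xi>. mode_function k a (\<xi>, l) * b (\<xi>, l) \<partial>lborel"
  have "(\<integral>q. mode_function k a q * b q \<partial>frequency_space) = (\<integral>l. ?g l \<partial>count_space UNIV)"
    using P.integral_snd[of "\<lambda>\<xi> l. mode_function k a (\<xi>, l) * b (\<xi>, l)"] b
    by (simp add: frequency_space_def case_prod_beta')
  also have "\<dots> = (\<integral>l. indicator {k} l *\<^sub>R ?g k \<partial>count_space UNIV)"
    by (intro Bochner_Integration.integral_cong refl) (auto simp: mode_function_def split: split_indicator)
  also have "\<dots> = ?g k" by simp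
  finally show ?thesis by (simp add: mode_function_def)
qed

lemma mode_function_L2: "a \<in> L2 lborel \<Longrightarrow> mode_function k a \<in> L2 frequency_space"
proof -
  assume a: "a \<in> L2 lborel"
  then have [measurable]: "a \<in> borel_measurable borel" using L2_measurable[OF a] by simp
  have m [measurable]: "mode_function k a \<in> borel_measurable frequency_space"
  proof -
    have [measurable]: "(\<lambda>q. indicat_real {k} (snd q)) \<in> borel_measurable frequency_space"
      by (rule measurable_compose[OF measurable_frequency_space_components(2)]) simp
    show ?thesis unfolding mode_function_def[abs_def] by measurable
  qed
  have "sq_norm frequency_space (mode_function k a) = (\<integral>\<^sup>+ l. (\<integral>\<^sup>+ \<xi>. ennreal ((cmod (mode_function k a (\<xi>, l)))\<^sup>2) \<partial>lborel) \<partial>count_space UNIV)"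
    unfolding sq_norm_def by (rule nn_integral_frequency_space) measurable
  also have "\<dots> = (\<Sum>l\<in>{k}. (\<integral>\<^sup>+ \<xi>. ennreal ((cmod (mode_function k a (\<xi>, l)))\<^sup>2) \<partial>lborel))"
    by (rule nn_integral_count_space') (auto simp: mode_function_def)
  also have "\<dots> = sq_norm lborel a" by (simp add: mode_function_def sq_norm_def)
  also have "\<dots> < \<infinity>" by (rule L2_sq_norm_finite[OF a])
  finally show ?thesis using m by (simp add: L2_def)
qed

lemma L2_frequency_AE_eq_0:
  assumes N: "N \<in> L2 frequency_space"
    and z: "\<And>k a \<sigma>. 0 < \<sigma> \<Longrightarrow> (\<integral>q. mode_function k (\<lambda>\<xi>. of_real (gauss_weight \<sigma> (\<xi> - a))) q * N q \<partial>frequency_space) = 0"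
  shows "AE q in frequency_space. N q = 0"
proof -
  note [measurable] = L2_measurable[OF N]
  have slice: "sq_norm lborel (\<lambda>\<xi>. N (\<xi>, k)) \<le> sq_norm frequency_space N" for k
  proof -
    have "sq_norm frequency_space N = (\<integral>\<^sup>+ k. sq_norm lborel (\<lambda>\<xi>. N (\<xi>, k)) \<partial>count_space UNIV)"
      unfolding sq_norm_def by (rule nn_integral_frequency_space) measurable
    then show ?thesis using nn_integral_ge_point[of k UNIV "\<lambda>k. sq_norm lborel (\<lambda>\<xi>. N (\<xi>, k))"] by simp
  qed
  have "AE \<xi> in lborel. N (\<xi>, k) = 0" for k
  proof (rule L2_AE_eq_0_if_gauss_integrals_0)
    show "(\<lambda>\<xi>. N (\<xi>, k)) \<in> L2 lborel"
      using slice[of k] L2_sq_norm_finite[OF N] by (auto simp: L2_def intro: le_less_trans)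
    fix a \<sigma> :: real assume \<sigma>: "0 < \<sigma>"
    let ?g = "\<lambda>\<xi>. complex_of_real (gauss_weight \<sigma> (\<xi> - a))"
    have "(\<integral>q. mode_function k ?g q * N q \<partial>frequency_space) = (\<integral>\<xi>. ?g \<xi> * N (\<xi>, k) \<partial>lborel)"
      by (intro mode_function_integral integrable_L2_mult mode_function_L2 gauss_weight_L2 \<sigma> N)
    then show "(\<integral>\<xi>. N (\<xi>, k) * ?g \<xi> \<partial>lborel) = 0" using z[OF \<sigma>, of k a] by (simp add: mult.commute)
  qed
  then have "sq_norm lborel (\<lambda>\<xi>. N (\<xi>, k)) = 0" for k
    by (subst sq_norm_eq_0_iff) auto
  then have "sq_norm frequency_space N = 0"
    unfolding sq_norm_def by (subst nn_integral_frequency_space) auto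
  then show ?thesis by (subst (asm) sq_norm_eq_0_iff) auto
qed

text \<open>Two one-dimensional uniqueness results in turn. The \<open>k\<close>-th Fourier
  coefficient in \<open>y\<close> is square integrable in \<open>x\<close> and orthogonal to
  Gaussians, hence 0 almost everywhere. As there are countably many \<open>k\<close>, almost every
  slice has all its coefficients 0 and therefore vanishes.\<close>

lemma L2_cylinder_AE_eq_0:
  assumes D: "D \<in> L2 cylinder"
    and z: "\<And>k a \<sigma>. 0 < \<sigma> \<Longrightarrow> (\<integral>z. D z * (of_real (gauss_weight \<sigma> (fst z - a)) * cis (of_int k * snd z)) \<partial>cylinder) = 0"
  shows "AE z in cylinder. D z = 0"
proof -
  note [measurable] = L2_measurable[OF D]
  interpret C: finite_measure circle by (rule finite_measure_circle)
  interpret P: pair_sigma_finite "lborel :: real measure" circle ..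
  have cc: "emeasure circle (space circle) = ennreal (2 * pi)"
    unfolding circle_def by (simp add: emeasure_restrict_space space_restrict_space)
  have cm [measurable]: "(\<lambda>y. cis (of_int k * y)) \<in> borel_measurable circle" for k
    by (intro measurable_circle) measurable
  have sqD: "sq_norm cylinder D = (\<integral>\<^sup>+ x. sq_norm circle (\<lambda>y. D (x, y)) \<partial>lborel)"
    unfolding sq_norm_def by (rule nn_integral_cylinder) measurable
  define n where "n k x = (\<integral>y. D (x, y) * cis (of_int k * y) \<partial>circle)" for k x
  have D': "(\<lambda>(x, y). D (x, y)) \<in> borel_measurable (lborel \<Otimes>\<^sub>M circle)"
    using L2_measurable[OF D] by (simp add: cylinder_eq)
  have nm [measurable]: "n k \<in> borel_measurable borel" for k
  proof -
    have "(\<lambda>(x, y). D (x, y) * cis (of_int k * y)) \<in> borel_measurable (lborel \<Otimes>\<^sub>M circle)"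
      using D' measurable_compose[OF measurable_snd cm[of k], of "lborel :: real measure"] by (simp add: case_prod_unfold)
    then have "n k \<in> borel_measurable lborel" unfolding n_def[abs_def] by (rule C.borel_measurable_lebesgue_integral)
    then show ?thesis by simp
  qed
  \<comment> \<open>Cauchy-Schwarz on the circle, whose measure is 2 pi: square-integrable slices
    are integrable, so their Fourier coefficients are meaningful.\<close>
  have L1_le: "(\<integral>\<^sup>+ y. ennreal (cmod (D (x, y))) \<partial>circle)\<^sup>2 \<le> ennreal (2 * pi) * sq_norm circle (\<lambda>y. D (x, y))" for x
    using Cauchy_Schwarz_nn_integral[of "\<lambda>y. ennreal (cmod (D (x, y)))" circle "\<lambda>y. 1"] cc
    by (simp add: sq_norm_def ennreal_power mult.commute)
  have n_le: "ennreal ((cmod (n k x))\<^sup>2) \<le> ennreal (2 * pi) * sq_norm circle (\<lambda>y. D (x, y))" for k x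
  proof (cases "integrable circle (\<lambda>y. D (x, y) * cis (of_int k * y))")
    case True
    have "ennreal (cmod (n k x)) \<le> (\<integral>\<^sup>+ y. ennreal (cmod (D (x, y))) \<partial>circle)"
      using integral_norm_bound_ennreal[OF True] by (simp add: n_def norm_mult)
    then have "(ennreal (cmod (n k x)))\<^sup>2 \<le> (\<integral>\<^sup>+ y. ennreal (cmod (D (x, y))) \<partial>circle)\<^sup>2" by (rule power_mono) simp
    then show ?thesis using L1_le[of x] by (simp add: ennreal_power)
  \<comment> \<open>For a non-integrable slice the Bochner integral defaults to 0, so the bound
    holds there as well.\<close>
  qed (simp add: n_def not_integrable_integral_eq)
  have n0: "AE x in lborel. n k x = 0" for k
  proof (rule L2_AE_eq_0_if_gauss_integrals_0)
    have "sq_norm lborel (n k) \<le> (\<integral>\<^sup>+ x. ennreal (2 * pi) * sq_norm circle (\<lambda>y. D (x, y)) \<partial>lborel)"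
      unfolding sq_norm_def[of lborel] by (intro nn_integral_mono n_le)
    also have "\<dots> = ennreal (2 * pi) * sq_norm cylinder D"
      unfolding sqD unfolding sq_norm_def by (rule nn_integral_cmult) (use D' in measurable)
    also have "\<dots> < \<infinity>" using L2_sq_norm_finite[OF D] by (simp add: ennreal_mult_less_top)
    finally show "n k \<in> L2 lborel" by (simp add: L2_def)
    fix a \<sigma> :: real assume \<sigma>: "0 < \<sigma>"
    let ?g = "\<lambda>x. complex_of_real (gauss_weight \<sigma> (x - a))"
    let ?f = "\<lambda>z. D z * (?g (fst z) * cis (of_int k * snd z))"
    have gL: "(\<lambda>z. ?g (fst z) * cis (of_int k * snd z)) \<in> L2 cylinder"
    proof -
      have "sq_norm cylinder (\<lambda>z. ?g (fst z) * cis (of_int k * snd z)) =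
        (\<integral>\<^sup>+ x. \<integral>\<^sup>+ y. ennreal ((cmod (?g x))\<^sup>2) \<partial>circle \<partial>lborel)"
        unfolding sq_norm_def by (subst nn_integral_cylinder) (auto simp: norm_mult)
      also have "\<dots> = sq_norm lborel ?g * ennreal (2 * pi)"
        unfolding sq_norm_def by (simp only: nn_integral_const cc) (rule nn_integral_multc, measurable)
      also have "\<dots> < \<infinity>" using L2_sq_norm_finite[OF gauss_weight_L2[OF \<sigma>, of a]] by (simp add: ennreal_mult_less_top)
      finally show ?thesis by (simp add: L2_def)
    qed
    have "(\<integral>z. ?f z \<partial>cylinder) = (\<integral>x. \<integral>y. ?f (x, y) \<partial>circle \<partial>lborel)"
      using P.integral_fst'[of ?f] integrable_L2_mult[OF D gL] by (simp add: cylinder_eq)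
    also have "\<dots> = (\<integral>x. n k x * ?g x \<partial>lborel)"
      unfolding n_def by (intro Bochner_Integration.integral_cong refl) (simp add: mult_ac flip: integral_mult_right_zero)
    finally show "(\<integral>x. n k x * ?g x \<partial>lborel) = 0" using z[OF \<sigma>, of a k] by simp
  qed
  have "AE x in lborel. sq_norm circle (\<lambda>y. D (x, y)) = 0"
  proof -
    have "AE x in lborel. \<forall>k. n k x = 0" using n0 by (simp add: AE_all_countable)
    moreover have "AE x in lborel. sq_norm circle (\<lambda>y. D (x, y)) \<noteq> \<infinity>"
    proof (rule nn_integral_PInf_AE)
      show "(\<lambda>x. sq_norm circle (\<lambda>y. D (x, y))) \<in> borel_measurable lborel" unfolding sq_norm_def using D' by measurable
      show "(\<integral>\<^sup>+ x. sq_norm circle (\<lambda>y. D (x, y)) \<partial>lborel) \<noteq> \<infinity>" using L2_sq_norm_finite[OF D] by (simp flip: sqD)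
    qed
    ultimately show ?thesis
    proof eventually_elim
      case (elim x)
      have "(\<integral>\<^sup>+ y. ennreal (cmod (D (x, y))) \<partial>circle)\<^sup>2 < \<infinity>"
        using L1_le[of x] elim(2) by (auto simp: ennreal_mult_less_top less_top intro: le_less_trans)
      then have "integrable circle (\<lambda>y. D (x, y))"
        by (intro integrableI_bounded) (auto simp: power_less_top_ennreal)
      then have "AE y in circle. D (x, y) = 0"
        using elim(1) by (intro AE_eq_0_if_fourier_coefficients_0) (auto simp: n_def)
      then show ?case by (subst sq_norm_eq_0_iff) auto
    qed
  qed
  then have "sq_norm cylinder D = 0" unfolding sqD by (subst nn_integral_0_iff_AE) (use D' in \<open>auto simp: sq_norm_def\<close>)
  then show ?thesis by (subst (asm) sq_norm_eq_0_iff) auto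
qed

section \<open>Plancherel's theorem on the cylinder\<close>

definition inverse_fourier :: "(real \<times> int \<Rightarrow> complex) \<Rightarrow> real \<times> real \<Rightarrow> complex" where
  "inverse_fourier F z = free_wave F 0 z / of_real (2 * pi)"

lemma phase_0: "phase 0 z q = fst q * fst z + of_int (snd q) * snd z"
  by (simp add: phase_def)

lemma fourier_integral_eq:
  "fourier_integral f q = (\<integral>z. f z * cnj (cis (phase 0 z q)) \<partial>cylinder) / of_real (2 * pi)"
  unfolding fourier_integral_def
  by (simp add: case_prod_unfold phase_0 cis_cnj mult.commute[of "f _"])

lemma inverse_fourier_measurable [measurable]:
  "F \<in> borel_measurable frequency_space \<Longrightarrow> inverse_fourier F \<in> borel_measurable cylinder"
  unfolding inverse_fourier_def[abs_def]
  by (intro borel_measurable_divide free_wave_measurable) simp_all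

lemma fourier_integral_measurable [measurable]:
  "f \<in> borel_measurable cylinder \<Longrightarrow> fourier_integral f \<in> borel_measurable frequency_space"
proof -
  assume [measurable]: "f \<in> borel_measurable cylinder"
  interpret sigma_finite_measure cylinder by (rule sigma_finite_cylinder)
  show ?thesis unfolding fourier_integral_eq[abs_def] by measurable
qed

lemma integrable_mult_cis:
  assumes "integrable M f" "g \<in> borel_measurable M"
  shows "integrable M (\<lambda>x. f x * cis (g x))"
  using assms by (intro Bochner_Integration.integrable_bound[OF assms(1)]) (auto simp: norm_mult)

lemma fourier_adjoint:
  assumes h: "integrable cylinder h" and F: "integrable frequency_space F"
  shows "(\<integral>q. fourier_integral h q * cnj (F q) \<partial>frequency_space) = (\<integral>z. h z * cnj (inverse_fourier F z) \<partial>cylinder)"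
proof -
  interpret C: sigma_finite_measure cylinder by (rule sigma_finite_cylinder)
  interpret Q: sigma_finite_measure frequency_space by (rule sigma_finite_frequency_space)
  interpret P: pair_sigma_finite cylinder frequency_space ..
  note [measurable] = borel_measurable_integrable[OF h] borel_measurable_integrable[OF F]
  let ?G = "\<lambda>z q. h z * cnj (F q) * cnj (cis (phase 0 z q))"
  have i: "integrable (cylinder \<Otimes>\<^sub>M frequency_space) (\<lambda>(z, q). ?G z q)"
  proof (rule Bochner_Integration.integrable_bound)
    show "integrable (cylinder \<Otimes>\<^sub>M frequency_space) (\<lambda>(z, q). h z * cnj (F q))"
      using F by (intro integrable_pair_mult sigma_finite_cylinder sigma_finite_frequency_space h) simp
  qed (auto simp: norm_mult case_prod_unfold)
  have "(\<integral>q. fourier_integral h q * cnj (F q) \<partial>frequency_space) = (\<integral>q. (\<integral>z. ?G z q \<partial>cylinder) / of_real (2 * pi) \<partial>frequency_space)"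
    unfolding fourier_integral_eq
    by (intro Bochner_Integration.integral_cong refl) (simp add: mult_ac flip: integral_mult_right_zero)
  also have "\<dots> = (\<integral>q. (\<integral>z. ?G z q \<partial>cylinder) \<partial>frequency_space) / of_real (2 * pi)" by simp
  also have "(\<integral>q. (\<integral>z. ?G z q \<partial>cylinder) \<partial>frequency_space) = (\<integral>z. (\<integral>q. ?G z q \<partial>frequency_space) \<partial>cylinder)"
    by (rule P.Fubini_integral[OF i])
  also have "\<dots> / of_real (2 * pi) = (\<integral>z. (\<integral>q. ?G z q \<partial>frequency_space) / of_real (2 * pi) \<partial>cylinder)" by simp
  also have "\<dots> = (\<integral>z. h z * cnj (inverse_fourier F z) \<partial>cylinder)"
  proof (rule Bochner_Integration.integral_cong[OF refl])
    fix z
    have "cnj (\<integral>q. F q * cis (phase 0 z q) \<partial>frequency_space) = (\<integral>q. cnj (F q) * cnj (cis (phase 0 z q)) \<partial>frequency_space)"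
    proof -
      have "(\<integral>q. cnj (F q * cis (phase 0 z q)) \<partial>frequency_space) = cnj (\<integral>q. F q * cis (phase 0 z q) \<partial>frequency_space)"
        by (simp del: complex_cnj_mult)
      then show ?thesis by simp
    qed
    then show "(\<integral>q. ?G z q \<partial>frequency_space) / of_real (2 * pi) = h z * cnj (inverse_fourier F z)"
      by (simp add: inverse_fourier_def free_wave_def mult.assoc)
  qed
  finally show ?thesis .
qed

text \<open>The Schur test for single plane waves, with a Gaussian weight in \<open>x\<close>. The
  kernel lives on equal modes and its row integral is (2 pi)^2, a factor 2 pi from each variable;
  this is exactly cancelled by the normalisation of \<open>inverse_fourier\<close>. Fatou's lemma
  removes the weight.\<close>

lemma inverse_fourier_bessel:
  assumes F: "integrable frequency_space F"
  shows "sq_norm cylinder (inverse_fourier F) \<le> sq_norm frequency_space F"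
proof -
  note [measurable] = borel_measurable_integrable[OF F]
  have weighted: "(\<integral>\<^sup>+ z. ennreal (gauss_weight \<sigma> (fst z)) * ennreal ((cmod (free_wave F 0 z))\<^sup>2) \<partial>cylinder)
     \<le> ennreal ((2 * pi)\<^sup>2) * sq_norm frequency_space F" if \<sigma>: "0 < \<sigma>" for \<sigma>
    unfolding free_wave_def sq_norm_def
  proof (rule schur_extension_bound[where k = "\<lambda>q q'. ennreal (gauss_kernel \<sigma> (fst q - fst q') * (2 * pi * indicator {0} (snd q - snd q')))"])
    show "integrable cylinder (\<lambda>z. gauss_weight \<sigma> (fst z))"
    proof -
      have "integrable cylinder (\<lambda>z. complex_of_real (gauss_weight \<sigma> (fst z)))"
        using integral_gauss_cylinder(1)[OF \<sigma>, of 0 0] by simp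
      then show ?thesis by (simp only: complex_of_real_integrable_eq)
    qed
    show "(\<lambda>(x, v). cis (phase 0 v x)) \<in> borel_measurable (frequency_space \<Otimes>\<^sub>M cylinder)" by measurable
    have ind: "(\<lambda>p. indicat_real {0} (snd (fst p) - snd (snd p))) \<in> borel_measurable (frequency_space \<Otimes>\<^sub>M frequency_space)"
    proof -
      have "(\<lambda>p. indicat_real {0} (of_int (snd (fst p)) - of_int (snd (snd p)) :: real)) \<in> borel_measurable (frequency_space \<Otimes>\<^sub>M frequency_space)"
        by measurable
      then show ?thesis by (rule measurable_cong[THEN iffD1, rotated]) (auto simp: indicator_def)
    qed
    then show "(\<lambda>(q, q'). ennreal (gauss_kernel \<sigma> (fst q - fst q') * (2 * pi * indicator {0} (snd q - snd q')))) \<in> borel_measurable (frequency_space \<Otimes>\<^sub>M frequency_space)"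
      unfolding case_prod_unfold by measurable
    show "ennreal (gauss_kernel \<sigma> (fst x - fst y) * (2 * pi * indicator {0} (snd x - snd y))) = ennreal (gauss_kernel \<sigma> (fst y - fst x) * (2 * pi * indicator {0} (snd y - snd x)))" for x y :: "real \<times> int"
      using gauss_kernel_minus[of \<sigma> "fst x - fst y"] by (simp add: indicator_def)
    show "(\<integral>\<^sup>+ y. ennreal (gauss_kernel \<sigma> (fst x - fst y) * (2 * pi * indicator {0} (snd x - snd y))) \<partial>frequency_space) \<le> ennreal ((2 * pi)\<^sup>2)" for x
    proof -
      have m: "(\<lambda>y. ennreal (gauss_kernel \<sigma> (fst x - fst y) * (2 * pi * indicator {0} (snd x - snd y)))) \<in> borel_measurable frequency_space"
      proof -
        have "(\<lambda>y. indicat_real {0} (of_int (snd x) - of_int (snd y) :: real)) \<in> borel_measurable frequency_space" by measurable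
        then have "(\<lambda>y. indicat_real {0} (snd x - snd y)) \<in> borel_measurable frequency_space"
          by (rule measurable_cong[THEN iffD1, rotated]) (auto simp: indicator_def)
        then show ?thesis by measurable
      qed
      have "(\<integral>\<^sup>+ y. ennreal (gauss_kernel \<sigma> (fst x - fst y) * (2 * pi * indicator {0} (snd x - snd y))) \<partial>frequency_space) =
        (\<integral>\<^sup>+ k. \<integral>\<^sup>+ \<xi>. ennreal (gauss_kernel \<sigma> (fst x - \<xi>) * (2 * pi * indicator {0} (snd x - k))) \<partial>lborel \<partial>count_space UNIV)"
        using nn_integral_frequency_space[OF m] by simp
      also have "\<dots> = (\<Sum>k\<in>{snd x}. \<integral>\<^sup>+ \<xi>. ennreal (gauss_kernel \<sigma> (fst x - \<xi>) * (2 * pi * indicator {0} (snd x - k))) \<partial>lborel)"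
        by (rule nn_integral_count_space') auto
      also have "\<dots> = (\<integral>\<^sup>+ \<xi>. ennreal (gauss_kernel \<sigma> (fst x - \<xi>)) * ennreal (2 * pi) \<partial>lborel)"
        using \<sigma> by (simp add: ennreal_mult gauss_kernel_nonneg)
      also have "\<dots> = ennreal (2 * pi) * ennreal (2 * pi)"
        by (subst nn_integral_multc) (auto simp: nn_integral_gauss_kernel_diff[OF \<sigma>])
      also have "\<dots> = ennreal ((2 * pi)\<^sup>2)"
        unfolding power2_eq_square by (rule ennreal_mult[symmetric]) auto
      finally show ?thesis by simp
    qed
    show "ennreal (cmod (\<integral>v. of_real (gauss_weight \<sigma> (fst v)) * (cis (phase 0 v x) * cnj (cis (phase 0 v y))) \<partial>cylinder))
       \<le> ennreal (gauss_kernel \<sigma> (fst x - fst y) * (2 * pi * indicator {0} (snd x - snd y)))" for x y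
    proof -
      have "(\<integral>v. of_real (gauss_weight \<sigma> (fst v)) * (cis (phase 0 v x) * cnj (cis (phase 0 v y))) \<partial>cylinder) =
        (\<integral>v. of_real (gauss_weight \<sigma> (fst v)) * cis ((fst x - fst y) * fst v + of_int (snd x - snd y) * snd v) \<partial>cylinder)"
        by (simp add: cis_cnj cis_mult phase_0 algebra_simps)
      also have "\<dots> = of_real (gauss_kernel \<sigma> (fst x - fst y) * (2 * pi * indicator {0} (snd x - snd y)))"
        by (rule integral_gauss_cylinder(2)[OF \<sigma>])
      finally show ?thesis using \<sigma> by (simp only: norm_of_real) (simp add: gauss_kernel_nonneg)
    qed
  qed (use F in \<open>simp_all add: sigma_finite_frequency_space sigma_finite_cylinder\<close>)
  have "(\<integral>\<^sup>+ z. ennreal ((cmod (free_wave F 0 z))\<^sup>2) \<partial>cylinder) =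
     (\<integral>\<^sup>+ z. liminf (\<lambda>n. ennreal (gauss_weight (real (Suc n)) (fst z)) * ennreal ((cmod (free_wave F 0 z))\<^sup>2)) \<partial>cylinder)"
  proof (rule nn_integral_cong)
    fix z :: "real \<times> real"
    have "(\<lambda>n. ennreal ((cmod (free_wave F 0 z))\<^sup>2) * ennreal (gauss_weight (real (Suc n)) (fst z))) \<longlonglongrightarrow> ennreal ((cmod (free_wave F 0 z))\<^sup>2) * ennreal 1"
      by (intro ennreal_tendsto_cmult tendsto_ennrealI gauss_weight_tendsto_1) auto
    from lim_imp_Liminf[OF _ this]
    show "ennreal ((cmod (free_wave F 0 z))\<^sup>2) = liminf (\<lambda>n. ennreal (gauss_weight (real (Suc n)) (fst z)) * ennreal ((cmod (free_wave F 0 z))\<^sup>2))"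
      by (simp add: mult.commute)
  qed
  also have "\<dots> \<le> liminf (\<lambda>n. \<integral>\<^sup>+ z. ennreal (gauss_weight (real (Suc n)) (fst z)) * ennreal ((cmod (free_wave F 0 z))\<^sup>2) \<partial>cylinder)"
    by (rule nn_integral_liminf) measurable
  also have "\<dots> \<le> liminf (\<lambda>n::nat. ennreal ((2 * pi)\<^sup>2) * sq_norm frequency_space F)"
    by (intro Liminf_mono always_eventually allI weighted) auto
  finally have w: "(\<integral>\<^sup>+ z. ennreal ((cmod (free_wave F 0 z))\<^sup>2) \<partial>cylinder) \<le> ennreal ((2 * pi)\<^sup>2) * sq_norm frequency_space F"
    by (simp add: Liminf_const)
  have "sq_norm cylinder (inverse_fourier F) = ennreal (1 / (2 * pi)\<^sup>2) * (\<integral>\<^sup>+ z. ennreal ((cmod (free_wave F 0 z))\<^sup>2) \<partial>cylinder)"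
  proof -
    have "(cmod (inverse_fourier F z))\<^sup>2 = 1 / (2 * pi)\<^sup>2 * (cmod (free_wave F 0 z))\<^sup>2" for z
      by (simp add: inverse_fourier_def norm_divide power_divide)
    then have "sq_norm cylinder (inverse_fourier F) = (\<integral>\<^sup>+ z. ennreal (1 / (2 * pi)\<^sup>2) * ennreal ((cmod (free_wave F 0 z))\<^sup>2) \<partial>cylinder)"
      unfolding sq_norm_def by (simp only: ennreal_mult zero_le_power2 zero_le_divide_1_iff)
    also have "\<dots> = ennreal (1 / (2 * pi)\<^sup>2) * (\<integral>\<^sup>+ z. ennreal ((cmod (free_wave F 0 z))\<^sup>2) \<partial>cylinder)"
      by (rule nn_integral_cmult) measurable
    finally show ?thesis .
  qed
  also have "\<dots> \<le> ennreal (1 / (2 * pi)\<^sup>2) * (ennreal ((2 * pi)\<^sup>2) * sq_norm frequency_space F)"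
    by (intro mult_left_mono w) auto
  also have "\<dots> = sq_norm frequency_space F"
    by (subst mult.assoc[symmetric], subst ennreal_mult[symmetric]) auto
  finally show ?thesis .
qed

lemma L2_truncation:
  assumes f: "f \<in> L2 M" and S: "\<And>n::nat. S n \<in> sets M" "\<And>n. emeasure M (S n) < \<infinity>"
    and ev: "\<And>x. x \<in> space M \<Longrightarrow> eventually (\<lambda>n. x \<in> S n) sequentially"
  shows "integrable M (\<lambda>x. indicator (S n) x * f x)"
    and "(\<lambda>x. indicator (S n) x * f x) \<in> L2 M"
    and "(\<lambda>n. sq_norm M (\<lambda>x. indicator (S n) x * f x - f x)) \<longlonglongrightarrow> 0"
proof -
  note [measurable] = L2_measurable[OF f] S(1)
  show t: "(\<lambda>x. indicator (S n) x * f x) \<in> L2 M" for n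
    by (rule L2_bound[OF f]) (auto simp: norm_mult split: split_indicator)
  have i: "(\<lambda>x. indicator (S n) x :: complex) \<in> L2 M"
  proof -
    have "sq_norm M (\<lambda>x. indicator (S n) x) = (\<integral>\<^sup>+ x. indicator (S n) x \<partial>M)"
      unfolding sq_norm_def by (intro nn_integral_cong) (auto split: split_indicator)
    then show ?thesis using S by (simp add: L2_def)
  qed
  show "integrable M (\<lambda>x. indicator (S n) x * f x)" by (rule integrable_L2_mult[OF i f])
  have "(\<lambda>n. \<integral>\<^sup>+ x. ennreal ((cmod (indicator (S n) x * f x - f x))\<^sup>2) \<partial>M) \<longlonglongrightarrow> (\<integral>\<^sup>+ x. 0 \<partial>M)"
  proof (rule nn_integral_dominated_convergence[where w = "\<lambda>x. ennreal ((cmod (f x))\<^sup>2)"])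
    show "(\<integral>\<^sup>+ x. ennreal ((cmod (f x))\<^sup>2) \<partial>M) < \<infinity>" using L2_sq_norm_finite[OF f] by (simp add: sq_norm_def)
    show "AE x in M. ennreal ((cmod (indicator (S n) x * f x - f x))\<^sup>2) \<le> ennreal ((cmod (f x))\<^sup>2)" for n
      by (intro AE_I2) (auto split: split_indicator)
    show "AE x in M. (\<lambda>n. ennreal ((cmod (indicator (S n) x * f x - f x))\<^sup>2)) \<longlonglongrightarrow> 0"
    proof (rule AE_I2)
      fix x assume "x \<in> space M"
      have "eventually (\<lambda>n. ennreal ((cmod (indicator (S n) x * f x - f x))\<^sup>2) = 0) sequentially"
        using ev[OF \<open>x \<in> space M\<close>] by eventually_elim simp
      then show "(\<lambda>n. ennreal ((cmod (indicator (S n) x * f x - f x))\<^sup>2)) \<longlonglongrightarrow> 0" by (rule tendsto_eventually)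
    qed
  qed measurable
  then show "(\<lambda>n. sq_norm M (\<lambda>x. indicator (S n) x * f x - f x)) \<longlonglongrightarrow> 0" by (simp add: sq_norm_def)
qed

definition frequency_box :: "nat \<Rightarrow> (real \<times> int) set" where
  "frequency_box n = {- real n..real n} \<times> {- int n..int n}"

text \<open>The bound is on \<open>x\<close> alone, as in the truncations of
  \<open>fourier_transform\<close>; the circle direction already has finite measure.\<close>

definition cylinder_box :: "nat \<Rightarrow> (real \<times> real) set" where
  "cylinder_box n = {z \<in> space cylinder. fst z \<in> {- real n..real n}}"

lemma frequency_box_props:
  shows "frequency_box n \<in> sets frequency_space" "emeasure frequency_space (frequency_box n) < \<infinity>"
    "eventually (\<lambda>n. q \<in> frequency_box n) sequentially"
proof -
  interpret C: sigma_finite_measure "count_space (UNIV :: int set)" by (rule sigma_finite_measure_count_space)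
  show "frequency_box n \<in> sets frequency_space" unfolding frequency_box_def frequency_space_def by simp
  show "emeasure frequency_space (frequency_box n) < \<infinity>"
    unfolding frequency_box_def frequency_space_def
    by (subst C.emeasure_pair_measure_Times) (auto simp: ennreal_mult_less_top of_nat_less_top)
  obtain N where N: "\<bar>fst q\<bar> + \<bar>of_int (snd q)\<bar> \<le> real N" using real_arch_simple by blast
  show "eventually (\<lambda>n. q \<in> frequency_box n) sequentially"
    using eventually_ge_at_top[of N]
  proof eventually_elim
    case (elim n)
    have "\<bar>real_of_int (snd q)\<bar> \<le> real N" using N by linarith
    then have "\<bar>snd q\<bar> \<le> int N" by linarith
    then show ?case using N elim by (cases q) (auto simp: frequency_box_def)
  qed
qed

lemma cylinder_box_props:
  shows "cylinder_box n \<in> sets cylinder" "emeasure cylinder (cylinder_box n) < \<infinity>"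
    "z \<in> space cylinder \<Longrightarrow> eventually (\<lambda>n. z \<in> cylinder_box n) sequentially"
proof -
  interpret C: finite_measure circle by (rule finite_measure_circle)
  show "cylinder_box n \<in> sets cylinder" unfolding cylinder_box_def by measurable
  have e: "cylinder_box n = {- real n..real n} \<times> space circle"
    by (auto simp: cylinder_box_def cylinder_eq space_pair_measure)
  have fin: "emeasure circle (space circle) < \<infinity>"
    using C.emeasure_finite[of "space circle"] by (metis less_top infinity_ennreal_def)
  show "emeasure cylinder (cylinder_box n) < \<infinity>"
    unfolding e unfolding cylinder_eq
    by (subst C.emeasure_pair_measure_Times) (use fin in \<open>auto simp: ennreal_mult_less_top simp del: space_circle\<close>)
  assume z: "z \<in> space cylinder"
  obtain N where N: "\<bar>fst z\<bar> \<le> real N" using real_arch_simple by blast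
  show "eventually (\<lambda>n. z \<in> cylinder_box n) sequentially"
    using eventually_ge_at_top[of N] by eventually_elim (use N z in \<open>auto simp: cylinder_box_def\<close>)
qed

lemmas frequency_truncation = L2_truncation[of _ frequency_space frequency_box, OF _ frequency_box_props]
lemmas cylinder_truncation = L2_truncation[of _ cylinder cylinder_box, OF _ cylinder_box_props]

text \<open>Duality with \<open>inverse_fourier_bessel\<close>. The transform of an integrable
  function is bounded, so its truncation to a frequency box is integrable and square integrable.
  Pairing the transform with this truncation gives X <= Y / 2 + X / 2 for the squared norms, and
  Fatou's lemma removes the box.\<close>

lemma fourier_integral_bessel:
  assumes h: "integrable cylinder h"
  shows "sq_norm frequency_space (fourier_integral h) \<le> sq_norm cylinder h"
proof (cases "sq_norm cylinder h < \<infinity>")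
  case True
  note [measurable] = borel_measurable_integrable[OF h] frequency_box_props(1)
  have hL: "h \<in> L2 cylinder" using True by (simp add: L2_def)
  define B where "B = (\<integral>z. cmod (h z) \<partial>cylinder) / (2 * pi)"
  have B: "cmod (fourier_integral h q) \<le> B" for q
  proof -
    have "cmod (\<integral>z. h z * cnj (cis (phase 0 z q)) \<partial>cylinder) \<le> (\<integral>z. cmod (h z * cnj (cis (phase 0 z q))) \<partial>cylinder)"
      by (rule integral_norm_bound)
    then show ?thesis unfolding fourier_integral_eq B_def
      by (simp add: norm_divide norm_mult divide_right_mono)
  qed
  let ?F = "\<lambda>n q. indicator (frequency_box n) q * fourier_integral h q"
  have box: "integrable frequency_space (indicator (frequency_box n) :: _ \<Rightarrow> real)" for n
    by (intro integrable_real_indicator frequency_box_props)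
  have F1: "integrable frequency_space (?F n)" for n
  proof (rule Bochner_Integration.integrable_bound)
    show "integrable frequency_space (\<lambda>q. B * indicator (frequency_box n) q)" using box by simp
    show "AE q in frequency_space. norm (?F n q) \<le> norm (B * indicator (frequency_box n) q)"
      by (intro AE_I2) (auto simp: norm_mult split: split_indicator intro: order.trans[OF B abs_ge_self])
  qed measurable
  have F2: "?F n \<in> L2 frequency_space" for n
  proof -
    have "sq_norm frequency_space (?F n) \<le> (\<integral>\<^sup>+ q. ennreal (B\<^sup>2) * indicator (frequency_box n) q \<partial>frequency_space)"
      unfolding sq_norm_def
      using B by (intro nn_integral_mono) (auto split: split_indicator intro!: ennreal_leI power_mono)
    also have "\<dots> < \<infinity>"
      using frequency_box_props by (subst nn_integral_cmult_indicator) (auto simp: ennreal_mult_less_top)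
    finally show ?thesis by (simp add: L2_def)
  qed
  have F_le: "sq_norm frequency_space (?F n) \<le> sq_norm cylinder h" for n
  proof -
    let ?X = "sq_norm frequency_space (?F n)" and ?Y = "sq_norm cylinder h"
    have inv: "inverse_fourier (?F n) \<in> L2 cylinder"
      using inverse_fourier_bessel[OF F1, of n] L2_sq_norm_finite[OF F2, of n] borel_measurable_integrable[OF F1]
      by (auto simp: L2_def intro: le_less_trans)
    have sq: "fourier_integral h q * cnj (?F n q) = of_real ((cmod (?F n q))\<^sup>2)" for q
      by (auto simp: complex_norm_square[symmetric] split: split_indicator)
    have iF: "integrable frequency_space (\<lambda>q. (cmod (?F n q))\<^sup>2)"
      using L2_sq_norm_finite[OF F2[of n]] by (intro integrableI_nonneg) (auto simp: sq_norm_def)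
    have "?X = ennreal (\<integral>q. (cmod (?F n q))\<^sup>2 \<partial>frequency_space)"
      unfolding sq_norm_def by (rule nn_integral_eq_integral[OF iF]) simp
    also have "\<dots> = ennreal (cmod (\<integral>q. fourier_integral h q * cnj (?F n q) \<partial>frequency_space))"
      unfolding sq integral_complex_of_real norm_of_real by simp
    also have "\<dots> = ennreal (cmod (\<integral>z. h z * cnj (inverse_fourier (?F n) z) \<partial>cylinder))"
      by (subst fourier_adjoint[OF h F1]) simp
    also have "\<dots> \<le> ennreal (1 / (2 * 1)) * ?Y + ennreal (1 / 2) * sq_norm cylinder (\<lambda>z. cnj (inverse_fourier (?F n) z))"
    proof (rule ennreal_cmod_integral_mult_le[OF hL])
      show "(\<lambda>z. cnj (inverse_fourier (?F n) z)) \<in> L2 cylinder"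
        using inv by (auto simp: L2_def sq_norm_def)
    qed simp
    also have "\<dots> \<le> ennreal (1 / 2) * ?Y + ennreal (1 / 2) * ?X"
      using inverse_fourier_bessel[OF F1, of n] by (intro add_mono mult_left_mono) (auto simp: sq_norm_def)
    finally have le: "?X \<le> ennreal (1 / 2) * ?Y + ennreal (1 / 2) * ?X" .
    \<comment> \<open>Both squared norms are finite, so they can be treated as reals and the term X
      / 2 absorbed on the left.\<close>
    obtain x y where xy: "?X = ennreal x" "0 \<le> x" "?Y = ennreal y" "0 \<le> y"
      using L2_sq_norm_finite[OF F2[of n]] True by (metis less_top_ennreal infinity_ennreal_def)
    have "ennreal x \<le> ennreal (1 / 2 * y + 1 / 2 * x)"
      using le xy ennreal_mult_plus_mult[of "1/2" y "1/2" x] by simp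
    then have "x \<le> 1 / 2 * y + 1 / 2 * x" using xy by (subst (asm) ennreal_le_iff) auto
    then show ?thesis using xy by (simp add: ennreal_leI)
  qed
  have "sq_norm frequency_space (fourier_integral h) \<le> (\<integral>\<^sup>+ q. liminf (\<lambda>n. ennreal ((cmod (?F n q))\<^sup>2)) \<partial>frequency_space)"
    unfolding sq_norm_def
  proof (rule nn_integral_mono)
    fix q
    have "eventually (\<lambda>n. ennreal ((cmod (?F n q))\<^sup>2) = ennreal ((cmod (fourier_integral h q))\<^sup>2)) sequentially"
      using frequency_box_props(3)[of q] by eventually_elim simp
    then have "(\<lambda>n. ennreal ((cmod (?F n q))\<^sup>2)) \<longlonglongrightarrow> ennreal ((cmod (fourier_integral h q))\<^sup>2)" by (rule tendsto_eventually)
    from lim_imp_Liminf[OF _ this] show "ennreal ((cmod (fourier_integral h q))\<^sup>2) \<le> liminf (\<lambda>n. ennreal ((cmod (?F n q))\<^sup>2))" by simp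
  qed
  also have "\<dots> \<le> liminf (\<lambda>n. sq_norm frequency_space (?F n))"
    unfolding sq_norm_def by (rule nn_integral_liminf) measurable
  also have "\<dots> \<le> liminf (\<lambda>n::nat. sq_norm cylinder h)"
    by (intro Liminf_mono always_eventually allI F_le)
  finally show ?thesis by (simp add: Liminf_const)
qed (simp add: less_top[symmetric])

lemma fourier_integral_cong:
  "(\<And>z. z \<in> space cylinder \<Longrightarrow> f z = g z) \<Longrightarrow> fourier_integral f = fourier_integral g"
  unfolding fourier_integral_eq[abs_def]
  by (intro ext arg_cong2[where f = "(/)"] Bochner_Integration.integral_cong refl) simp

lemma fourier_integral_diff:
  assumes f: "integrable cylinder f" and g: "integrable cylinder g"
  shows "fourier_integral (\<lambda>z. f z - g z) q = fourier_integral f q - fourier_integral g q"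
proof -
  have i: "integrable cylinder (\<lambda>z. h z * cnj (cis (phase 0 z q)))" if h: "integrable cylinder h" for h
    using borel_measurable_integrable[OF h]
    by (intro Bochner_Integration.integrable_bound[OF h]) (auto simp: norm_mult)
  show ?thesis
    unfolding fourier_integral_eq using i[OF f] i[OF g]
    by (simp add: left_diff_distrib diff_divide_distrib)
qed

lemma phase_slice_measurable: "phase t z \<in> borel_measurable frequency_space"
  unfolding phase_def[abs_def] by measurable

lemma inverse_fourier_diff:
  assumes F: "integrable frequency_space F" and G: "integrable frequency_space G"
  shows "inverse_fourier (\<lambda>q. F q - G q) z = inverse_fourier F z - inverse_fourier G z"
  using integrable_mult_cis[OF F phase_slice_measurable[of 0 z]] integrable_mult_cis[OF G phase_slice_measurable[of 0 z]]
  by (simp add: inverse_fourier_def free_wave_def left_diff_distrib diff_divide_distrib)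

lemma fourier_integral_L2: "integrable cylinder h \<Longrightarrow> h \<in> L2 cylinder \<Longrightarrow> fourier_integral h \<in> L2 frequency_space"
  using fourier_integral_bessel[of h] fourier_integral_measurable[of h]
  by (auto simp: L2_def intro: le_less_trans)

lemma inverse_fourier_L2:
  "integrable frequency_space F \<Longrightarrow> F \<in> L2 frequency_space \<Longrightarrow> inverse_fourier F \<in> L2 cylinder"
  using inverse_fourier_bessel[of F] inverse_fourier_measurable[of F]
  by (auto simp: L2_def intro: le_less_trans)

section \<open>The extended Fourier transform: injectivity and surjectivity\<close>

abbreviation truncated :: "nat \<Rightarrow> (real \<times> real \<Rightarrow> complex) \<Rightarrow> real \<times> real \<Rightarrow> complex" where
  "truncated n f \<equiv> \<lambda>z. indicator (cylinder_box n) z * f z"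

text \<open>Opens the choice operator in the definition: Bessel's inequality makes the transforms of
  the truncations a Cauchy sequence, so by completeness a limit exists and the chosen function is
  one.\<close>

lemma fourier_transform_limit:
  assumes f: "f \<in> L2 cylinder"
  shows "fourier_transform f \<in> L2 frequency_space"
    and "(\<lambda>n. sq_norm frequency_space (\<lambda>q. fourier_integral (truncated n f) q - fourier_transform f q)) \<longlonglongrightarrow> 0"
proof -
  note T = cylinder_truncation[OF f]
  have trunc_eq: "fourier_integral (\<lambda>(x, y). indicator {- real n..real n} x * f (x, y)) = fourier_integral (truncated n f)" for n
    by (rule fourier_integral_cong) (auto simp: cylinder_box_def split: split_indicator)
  have aL2: "fourier_integral (truncated n f) \<in> L2 frequency_space" for n
    by (intro fourier_integral_L2 T)
  obtain F where F: "F \<in> L2 frequency_space" "(\<lambda>n. sq_norm frequency_space (\<lambda>q. fourier_integral (truncated n f) q - F q)) \<longlonglongrightarrow> 0"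
  proof (rule L2_complete[of "\<lambda>n. fourier_integral (truncated n f)", OF aL2])
    fix e :: real assume "0 < e"
    then obtain N where N: "\<And>m n. N \<le> m \<Longrightarrow> N \<le> n \<Longrightarrow> sq_norm cylinder (\<lambda>z. truncated m f z - truncated n f z) \<le> ennreal e"
      using L2_tendsto_cauchy[OF T(2) f T(3), of e] by auto
    have "sq_norm frequency_space (\<lambda>q. fourier_integral (truncated m f) q - fourier_integral (truncated n f) q) \<le> ennreal e"
      if "N \<le> m" "N \<le> n" for m n
    proof -
      have "sq_norm frequency_space (\<lambda>q. fourier_integral (truncated m f) q - fourier_integral (truncated n f) q) =
        sq_norm frequency_space (fourier_integral (\<lambda>z. truncated m f z - truncated n f z))"
        by (intro arg_cong[where f = "sq_norm frequency_space"] ext fourier_integral_diff[symmetric] T(1))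
      also have "\<dots> \<le> sq_norm cylinder (\<lambda>z. truncated m f z - truncated n f z)"
        by (intro fourier_integral_bessel Bochner_Integration.integrable_diff T(1))
      also have "\<dots> \<le> ennreal e" by (rule N[OF that])
      finally show ?thesis .
    qed
    then show "\<exists>N. \<forall>m\<ge>N. \<forall>n\<ge>N. sq_norm frequency_space (\<lambda>q. fourier_integral (truncated m f) q - fourier_integral (truncated n f) q) \<le> ennreal e"
      by blast
  qed blast
  let ?P = "\<lambda>F. F \<in> Lp_space 2 frequency_space \<and>
     (\<lambda>n::nat. Lp_norm 2 frequency_space (\<lambda>q. fourier_integral (\<lambda>(x, y). indicator {- real n..real n} x * f (x, y)) q - F q)) \<longlonglongrightarrow> 0"
  have "?P F" using F by (simp add: Lp_space_2_eq Lp_norm_2_tendsto_0_iff trunc_eq)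
  from someI[of ?P, OF this] have "?P (fourier_transform f)" unfolding fourier_transform_def .
  then show "fourier_transform f \<in> L2 frequency_space"
    "(\<lambda>n. sq_norm frequency_space (\<lambda>q. fourier_integral (truncated n f) q - fourier_transform f q)) \<longlonglongrightarrow> 0"
    by (simp_all add: Lp_space_2_eq Lp_norm_2_tendsto_0_iff trunc_eq)
qed

text \<open>The factor 2 is the loss in \<open>sq_norm_add_le\<close>; boundedness is all that the
  final estimate draws from it.\<close>

lemma fourier_transform_sq_norm_le:
  assumes f: "f \<in> L2 cylinder"
  shows "sq_norm frequency_space (fourier_transform f) \<le> 2 * sq_norm cylinder f"
proof -
  note T = cylinder_truncation[OF f] and L = fourier_transform_limit[OF f]
  let ?F = "fourier_transform f" and ?a = "\<lambda>n. fourier_integral (truncated n f)"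
  note [measurable] = L2_measurable[OF L(1)]
  have [measurable]: "?a n \<in> borel_measurable frequency_space" for n
    by (intro L2_measurable fourier_integral_L2 T)
  have le: "sq_norm frequency_space ?F \<le> 2 * sq_norm frequency_space (\<lambda>q. ?a n q - ?F q) + 2 * sq_norm cylinder f" for n
  proof -
    have "sq_norm frequency_space ?F = sq_norm frequency_space (\<lambda>q. (?F q - ?a n q) + ?a n q)" by simp
    also have "\<dots> \<le> 2 * sq_norm frequency_space (\<lambda>q. ?F q - ?a n q) + 2 * sq_norm frequency_space (?a n)"
      by (rule sq_norm_add_le) measurable
    also have "\<dots> \<le> 2 * sq_norm frequency_space (\<lambda>q. ?a n q - ?F q) + 2 * sq_norm cylinder f"
    proof (intro add_mono mult_left_mono)
      have "sq_norm frequency_space (?a n) \<le> sq_norm cylinder (truncated n f)" by (intro fourier_integral_bessel T)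
      also have "\<dots> \<le> sq_norm cylinder f" by (rule sq_norm_mono) (auto simp: norm_mult split: split_indicator)
      finally show "sq_norm frequency_space (?a n) \<le> sq_norm cylinder f" .
    qed (simp_all add: sq_norm_minus_commute[of _ ?F])
    finally show ?thesis .
  qed
  have "(\<lambda>n. 2 * sq_norm frequency_space (\<lambda>q. ?a n q - ?F q) + 2 * sq_norm cylinder f) \<longlonglongrightarrow> 2 * 0 + 2 * sq_norm cylinder f"
    by (intro tendsto_add ennreal_tendsto_cmult L(2) tendsto_const) auto
  then have "sq_norm frequency_space ?F \<le> 2 * 0 + 2 * sq_norm cylinder f"
    by (rule LIMSEQ_le_const) (use le in blast)
  then show ?thesis by simp
qed

lemma L2_cnj: "f \<in> L2 M \<Longrightarrow> (\<lambda>x. cnj (f x)) \<in> L2 M"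
  by (auto simp: L2_def sq_norm_def)

text \<open>The adjoint relation of \<open>fourier_adjoint\<close> survives the limit of
  truncations. It makes the chosen representative accessible through pairings with explicit
  functions.\<close>

lemma fourier_transform_pairing:
  assumes f: "f \<in> L2 cylinder" and p: "integrable frequency_space p" "p \<in> L2 frequency_space"
  shows "(\<integral>q. fourier_transform f q * cnj (p q) \<partial>frequency_space) = (\<integral>z. f z * cnj (inverse_fourier p z) \<partial>cylinder)"
proof -
  note T = cylinder_truncation[OF f] and L = fourier_transform_limit[OF f]
  have "(\<lambda>n. \<integral>q. fourier_integral (truncated n f) q * cnj (p q) \<partial>frequency_space) \<longlonglongrightarrow> (\<integral>q. fourier_transform f q * cnj (p q) \<partial>frequency_space)"
    by (intro integral_mult_tendsto fourier_integral_L2 T L L2_cnj p)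
  moreover have "(\<lambda>n. \<integral>z. truncated n f z * cnj (inverse_fourier p z) \<partial>cylinder) \<longlonglongrightarrow> (\<integral>z. f z * cnj (inverse_fourier p z) \<partial>cylinder)"
    by (intro integral_mult_tendsto T f L2_cnj inverse_fourier_L2 p)
  moreover have "(\<integral>q. fourier_integral (truncated n f) q * cnj (p q) \<partial>frequency_space) =
      (\<integral>z. truncated n f z * cnj (inverse_fourier p z) \<partial>cylinder)" for n
    by (rule fourier_adjoint[OF T(1) p(1)])
  ultimately show ?thesis using LIMSEQ_unique by simp
qed

lemma gauss_kernel_eq_weight: "0 < \<sigma> \<Longrightarrow> gauss_kernel \<sigma> x = \<sigma> * sqrt (2 * pi) * gauss_weight (1 / \<sigma>) x"
  by (simp add: gauss_kernel_def gauss_weight_def mult.commute)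

lemma integrable_gauss_kernel_cis:
  assumes "0 < \<sigma>"
  shows "integrable lborel (\<lambda>x. of_real (gauss_kernel \<sigma> x) * cis (p * x))"
proof -
  have "integrable lborel (\<lambda>x. of_real (\<sigma> * sqrt (2 * pi)) * (of_real (gauss_weight (1 / \<sigma>) x) * cis (p * x)))"
    using assms by (intro integrable_mult_right integrable_cis_gauss_weight) simp
  then show ?thesis using assms by (simp add: gauss_kernel_eq_weight mult.assoc)
qed

lemma cis_integral_gauss_kernel:
  assumes \<sigma>: "0 < \<sigma>"
  shows "(\<integral>x. of_real (gauss_kernel \<sigma> x) * cis (p * x) \<partial>lborel) = of_real (2 * pi * gauss_weight \<sigma> p)"
proof -
  have "(\<integral>x. of_real (gauss_kernel \<sigma> x) * cis (p * x) \<partial>lborel) =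
     (\<integral>x. of_real (\<sigma> * sqrt (2 * pi)) * (of_real (gauss_weight (1 / \<sigma>) x) * cis (p * x)) \<partial>lborel)"
    using \<sigma> by (simp add: gauss_kernel_eq_weight mult.assoc)
  also have "\<dots> = of_real (\<sigma> * sqrt (2 * pi)) * of_real (gauss_kernel (1 / \<sigma>) p)"
    using \<sigma> by (subst integral_mult_right_zero) (simp add: cis_integral_gauss_weight)
  also have "\<dots> = of_real (\<sigma> * sqrt (2 * pi) * gauss_kernel (1 / \<sigma>) p)" by (simp only: of_real_mult)
  also have "\<sigma> * sqrt (2 * pi) * gauss_kernel (1 / \<sigma>) p = 2 * pi * gauss_weight \<sigma> p"
    using \<sigma> by (simp add: gauss_kernel_def gauss_weight_def mult.commute)
  finally show ?thesis .
qed

lemma inverse_fourier_mode_function: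
  assumes a: "integrable lborel a"
  shows "inverse_fourier (mode_function k a) z = (\<integral>\<xi>. a \<xi> * cis (\<xi> * fst z) \<partial>lborel) * cis (of_int k * snd z) / of_real (2 * pi)"
proof -
  have "(\<integral>q. mode_function k a q * cis (phase 0 z q) \<partial>frequency_space) = (\<integral>\<xi>. a \<xi> * cis (phase 0 z (\<xi>, k)) \<partial>lborel)"
    by (intro mode_function_integral integrable_mult_cis integrable_mode_function a phase_slice_measurable)
  also have "\<dots> = (\<integral>\<xi>. a \<xi> * cis (\<xi> * fst z) * cis (of_int k * snd z) \<partial>lborel)"
    by (simp add: phase_0 cis_mult[symmetric] mult.assoc)
  finally show ?thesis by (simp add: inverse_fourier_def free_wave_def)
qed

text \<open>By the pairing, functions with equal transforms have equal integrals against all inverse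
  transforms of test data. These include every Gaussian in \<open>x\<close> times a mode in
  \<open>y\<close>, a separating family by \<open>L2_cylinder_AE_eq_0\<close>.\<close>

lemma fourier_transform_inject:
  assumes g: "g \<in> L2 cylinder" and h: "h \<in> L2 cylinder"
    and eq: "AE q in frequency_space. fourier_transform g q = fourier_transform h q"
  shows "AE z in cylinder. g z = h z"
proof -
  have "AE z in cylinder. g z - h z = 0"
  proof (rule L2_cylinder_AE_eq_0[OF L2_diff[OF g h]])
    fix k :: int and a \<sigma> :: real assume \<sigma>: "0 < \<sigma>"
    \<comment> \<open>Chosen so that the inverse transform is the Gaussian of scale sigma centred at
      \<open>a\<close>; the mode is \<open>- k\<close> because the pairing conjugates.\<close>
    let ?a = "\<lambda>\<xi>. of_real (gauss_kernel \<sigma> \<xi>) * cis (- a * \<xi>)"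
    let ?p = "mode_function (- k) ?a"
    have ia: "integrable lborel ?a" by (rule integrable_gauss_kernel_cis[OF \<sigma>])
    have aL2: "?a \<in> L2 lborel"
    proof -
      have w: "(\<lambda>\<xi>. complex_of_real (gauss_weight (1 / \<sigma>) \<xi>)) \<in> L2 lborel"
        using gauss_weight_L2[of "1 / \<sigma>" 0] \<sigma> by simp
      have "sq_norm lborel ?a = ennreal ((\<sigma> * sqrt (2 * pi))\<^sup>2) * sq_norm lborel (\<lambda>\<xi>. complex_of_real (gauss_weight (1 / \<sigma>) \<xi>))"
        unfolding sq_norm_def using \<sigma>
        by (subst nn_integral_cmult[symmetric])
          (auto simp: gauss_kernel_eq_weight norm_mult power_mult_distrib simp flip: ennreal_mult)
      then show ?thesis using L2_sq_norm_finite[OF w] by (auto simp: L2_def ennreal_mult_less_top)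
    qed
    have p: "integrable frequency_space ?p" "?p \<in> L2 frequency_space"
      by (intro integrable_mode_function ia, intro mode_function_L2 aL2)
    have inv: "inverse_fourier ?p z = of_real (gauss_weight \<sigma> (fst z - a)) * cis (of_int (- k) * snd z)" for z
    proof -
      have "(\<integral>\<xi>. ?a \<xi> * cis (\<xi> * fst z) \<partial>lborel) = (\<integral>\<xi>. of_real (gauss_kernel \<sigma> \<xi>) * cis ((fst z - a) * \<xi>) \<partial>lborel)"
        by (simp add: mult.assoc cis_mult algebra_simps)
      then show ?thesis
        unfolding inverse_fourier_mode_function[OF ia] cis_integral_gauss_kernel[OF \<sigma>] by simp
    qed
    have "(\<integral>z. g z * cnj (inverse_fourier ?p z) \<partial>cylinder) = (\<integral>z. h z * cnj (inverse_fourier ?p z) \<partial>cylinder)"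
      unfolding fourier_transform_pairing[OF g p, symmetric] fourier_transform_pairing[OF h p, symmetric]
    proof (rule integral_cong_AE)
      show "AE q in frequency_space. fourier_transform g q * cnj (?p q) = fourier_transform h q * cnj (?p q)"
        using eq by eventually_elim simp
    qed (use fourier_transform_limit(1)[OF g] fourier_transform_limit(1)[OF h] p(2) in \<open>auto dest!: L2_measurable\<close>)
    moreover have "integrable cylinder (\<lambda>z. g z * cnj (inverse_fourier ?p z))" "integrable cylinder (\<lambda>z. h z * cnj (inverse_fourier ?p z))"
      by (intro integrable_L2_mult g h L2_cnj inverse_fourier_L2 p)+
    ultimately have "(\<integral>z. (g z - h z) * cnj (inverse_fourier ?p z) \<partial>cylinder) = 0"
      by (simp add: left_diff_distrib)
    then show "(\<integral>z. (g z - h z) * (of_real (gauss_weight \<sigma> (fst z - a)) * cis (of_int k * snd z)) \<partial>cylinder) = 0"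
      unfolding inv by (simp add: cis_cnj)
  qed
  then show ?thesis by simp
qed

text \<open>Fourier inversion by direct computation for Gaussian data on one mode. These are the
  test functions by which \<open>fourier_transform_surj\<close> identifies a transform.\<close>

lemma fourier_integral_gauss:
  fixes k :: int and a \<sigma> :: real and q :: "real \<times> int"
  assumes \<sigma>: "0 < \<sigma>"
  defines "w \<equiv> mode_function k (\<lambda>\<xi>. of_real (gauss_weight \<sigma> (\<xi> - a)))"
  shows "integrable frequency_space w" "w \<in> L2 frequency_space" "integrable cylinder (inverse_fourier w)"
    and "fourier_integral (inverse_fourier w) q = w q"
proof -
  have i: "integrable lborel (\<lambda>\<xi>. complex_of_real (gauss_weight \<sigma> (\<xi> - a)))"
    by (intro integrable_of_real integrable_gauss_weight_shift \<sigma>)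
  show "integrable frequency_space w" unfolding w_def by (rule integrable_mode_function[OF i])
  show "w \<in> L2 frequency_space" unfolding w_def by (intro mode_function_L2 gauss_weight_L2 \<sigma>)
  have inv: "inverse_fourier w z = (of_real (gauss_kernel \<sigma> (fst z)) * cis (a * fst z)) * (cis (of_int k * snd z) / of_real (2 * pi))" for z
  proof -
    have "(\<integral>\<xi>. of_real (gauss_weight \<sigma> (\<xi> - a)) * cis (\<xi> * fst z) \<partial>lborel) =
      \<bar>1\<bar> *\<^sub>R (\<integral>\<xi>. of_real (gauss_weight \<sigma> (a + 1 * \<xi> - a)) * cis ((a + 1 * \<xi>) * fst z) \<partial>lborel)"
      by (rule lborel_integral_real_affine) simp
    also have "\<dots> = (\<integral>\<xi>. cis (a * fst z) * (of_real (gauss_weight \<sigma> \<xi>) * cis (fst z * \<xi>)) \<partial>lborel)"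
    proof -
      have "cis ((a + 1 * \<xi>) * fst z) = cis (a * fst z) * cis (fst z * \<xi>)" for \<xi>
        by (simp add: cis_mult algebra_simps)
      then show ?thesis by (simp only: mult_1 add_diff_cancel_left' abs_one scaleR_one mult.left_commute)
    qed
    also have "\<dots> = cis (a * fst z) * of_real (gauss_kernel \<sigma> (fst z))"
      by (subst integral_mult_right_zero) (simp only: cis_integral_gauss_weight[OF \<sigma>])
    finally show ?thesis unfolding w_def inverse_fourier_mode_function[OF i] by (simp add: mult_ac)
  qed
  let ?f = "\<lambda>b x. complex_of_real (gauss_kernel \<sigma> x) * cis (b * x)"
  have if': "integrable lborel (?f b)" for b by (rule integrable_gauss_kernel_cis[OF \<sigma>])
  have ic: "integrable circle (\<lambda>y. cis (of_int l * y) / of_real (2 * pi))" for l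
    using integrable_cis_circle by simp
  note P = sigma_finite_lborel sigma_finite_circle
  have inv': "inverse_fourier w = (\<lambda>(x, y). ?f a x * (cis (of_int k * y) / of_real (2 * pi)))"
    by (auto simp: inv)
  show "integrable cylinder (inverse_fourier w)"
    unfolding inv' cylinder_eq by (rule integrable_pair_mult[OF P if' ic])
  have "(\<integral>z. inverse_fourier w z * cnj (cis (phase 0 z q)) \<partial>cylinder) =
     (\<integral>(x, y). ?f (a - fst q) x * (cis (of_int (k - snd q) * y) / of_real (2 * pi)) \<partial>cylinder)"
  proof (rule Bochner_Integration.integral_cong[OF refl])
    fix z :: "real \<times> real"
    have "cis (a * fst z) * cis (of_int k * snd z) * cnj (cis (phase 0 z q)) = cis ((a - fst q) * fst z) * cis (of_int (k - snd q) * snd z)"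
      by (simp add: cis_cnj cis_mult phase_0 algebra_simps)
    then show "inverse_fourier w z * cnj (cis (phase 0 z q)) = (case z of (x, y) \<Rightarrow> ?f (a - fst q) x * (cis (of_int (k - snd q) * y) / of_real (2 * pi)))"
      by (simp add: inv case_prod_unfold mult.assoc)
  qed
  also have "\<dots> = of_real (2 * pi * gauss_weight \<sigma> (a - fst q)) * ((\<integral>y. cis (of_int (k - snd q) * y) \<partial>circle) / of_real (2 * pi))"
    unfolding cylinder_eq integral_pair_mult[OF P if' ic] cis_integral_gauss_kernel[OF \<sigma>] by simp
  also have "\<dots> = of_real (2 * pi) * w q"
    unfolding integral_cis_circle w_def mode_function_def
    by (auto simp: gauss_weight_def power2_commute[of a] power_divide split: split_indicator)
  finally show "fourier_integral (inverse_fourier w) q = w q" unfolding fourier_integral_eq by simp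
qed

abbreviation frequency_truncated :: "nat \<Rightarrow> (real \<times> int \<Rightarrow> complex) \<Rightarrow> real \<times> int \<Rightarrow> complex" where
  "frequency_truncated n F \<equiv> \<lambda>q. indicator (frequency_box n) q * F q"

text \<open>The preimage is the limit of the inverse transforms of truncations of \<open>F\<close>.
  Its transform is compared with \<open>F\<close> by pairing with a Gaussian mode, moved across by
  \<open>fourier_adjoint\<close> and inverted explicitly. The convergence is part of the conclusion
  because the quartic bound reaches the limit through these approximants.\<close>

lemma fourier_transform_surj:
  assumes F: "F \<in> L2 frequency_space"
  obtains g where "g \<in> L2 cylinder" "AE q in frequency_space. fourier_transform g q = F q"
    "(\<lambda>n. sq_norm cylinder (\<lambda>z. inverse_fourier (frequency_truncated n F) z - g z)) \<longlonglongrightarrow> 0"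
proof -
  note T = frequency_truncation[OF F]
  let ?g = "\<lambda>n. inverse_fourier (frequency_truncated n F)"
  have gL2: "?g n \<in> L2 cylinder" for n by (intro inverse_fourier_L2 T)
  obtain g where g: "g \<in> L2 cylinder" "(\<lambda>n. sq_norm cylinder (\<lambda>z. ?g n z - g z)) \<longlonglongrightarrow> 0"
  proof (rule L2_complete[of ?g, OF gL2])
    fix e :: real assume "0 < e"
    then obtain N where N: "\<And>m n. N \<le> m \<Longrightarrow> N \<le> n \<Longrightarrow> sq_norm frequency_space (\<lambda>z. frequency_truncated m F z - frequency_truncated n F z) \<le> ennreal e"
      using L2_tendsto_cauchy[OF T(2) F T(3), of e] by auto
    have "sq_norm cylinder (\<lambda>q. ?g m q - ?g n q) \<le> ennreal e" if "N \<le> m" "N \<le> n" for m n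
    proof -
      have "sq_norm cylinder (\<lambda>q. ?g m q - ?g n q) =
        sq_norm cylinder (inverse_fourier (\<lambda>q. frequency_truncated m F q - frequency_truncated n F q))"
        by (intro arg_cong[where f = "sq_norm cylinder"] ext inverse_fourier_diff[symmetric] T(1))
      also have "\<dots> \<le> sq_norm frequency_space (\<lambda>q. frequency_truncated m F q - frequency_truncated n F q)"
        by (intro inverse_fourier_bessel Bochner_Integration.integrable_diff T(1))
      also have "\<dots> \<le> ennreal e" by (rule N[OF that])
      finally show ?thesis .
    qed
    then show "\<exists>N. \<forall>m\<ge>N. \<forall>n\<ge>N. sq_norm cylinder (\<lambda>q. ?g m q - ?g n q) \<le> ennreal e" by blast
  qed blast
  note L = fourier_transform_limit(1)[OF g(1)]
  have "AE q in frequency_space. fourier_transform g q - F q = 0"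
  proof (rule L2_frequency_AE_eq_0[OF L2_diff[OF L F]])
    fix k :: int and a \<sigma> :: real assume \<sigma>: "0 < \<sigma>"
    define w where "w = mode_function k (\<lambda>\<xi>. of_real (gauss_weight \<sigma> (\<xi> - a)))"
    note w = fourier_integral_gauss[OF \<sigma>, of k a, folded w_def]
    have cw: "cnj (w q) = w q" for q by (simp add: w_def mode_function_def)
    have "(\<integral>z. ?g n z * cnj (inverse_fourier w z) \<partial>cylinder) = (\<integral>q. frequency_truncated n F q * cnj (w q) \<partial>frequency_space)" for n
    proof -
      have "cnj (\<integral>q. fourier_integral (inverse_fourier w) q * cnj (frequency_truncated n F q) \<partial>frequency_space) =
        cnj (\<integral>z. inverse_fourier w z * cnj (?g n z) \<partial>cylinder)"
        by (subst fourier_adjoint[OF w(3) T(1)]) simp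
      moreover have "cnj (\<integral>q. fourier_integral (inverse_fourier w) q * cnj (frequency_truncated n F q) \<partial>frequency_space) =
        (\<integral>q. frequency_truncated n F q * cnj (w q) \<partial>frequency_space)"
        unfolding w(4) Bochner_Integration.integral_cnj[symmetric] by (simp add: mult.commute)
      moreover have "cnj (\<integral>z. inverse_fourier w z * cnj (?g n z) \<partial>cylinder) = (\<integral>z. ?g n z * cnj (inverse_fourier w z) \<partial>cylinder)"
        unfolding Bochner_Integration.integral_cnj[symmetric] by (simp add: mult.commute)
      ultimately show ?thesis by simp
    qed
    moreover have "(\<lambda>n. \<integral>z. ?g n z * cnj (inverse_fourier w z) \<partial>cylinder) \<longlonglongrightarrow> (\<integral>z. g z * cnj (inverse_fourier w z) \<partial>cylinder)"
      by (intro integral_mult_tendsto gL2 g L2_cnj inverse_fourier_L2 w)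
    moreover have "(\<lambda>n. \<integral>q. frequency_truncated n F q * cnj (w q) \<partial>frequency_space) \<longlonglongrightarrow> (\<integral>q. F q * cnj (w q) \<partial>frequency_space)"
      by (intro integral_mult_tendsto T F L2_cnj w)
    ultimately have "(\<integral>z. g z * cnj (inverse_fourier w z) \<partial>cylinder) = (\<integral>q. F q * cnj (w q) \<partial>frequency_space)"
      using LIMSEQ_unique by simp
    then have "(\<integral>q. fourier_transform g q * w q \<partial>frequency_space) = (\<integral>q. F q * w q \<partial>frequency_space)"
      using fourier_transform_pairing[OF g(1) w(1,2)] by (simp add: cw)
    moreover have "integrable frequency_space (\<lambda>q. w q * fourier_transform g q)" "integrable frequency_space (\<lambda>q. w q * F q)"
      by (intro integrable_L2_mult L F w)+
    ultimately show "(\<integral>q. w q * (fourier_transform g q - F q) \<partial>frequency_space) = 0"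
      by (simp add: right_diff_distrib mult.commute)
  qed
  then have "AE q in frequency_space. fourier_transform g q = F q" by simp
  with g show ?thesis using that by blast
qed

section \<open>The Strichartz estimate\<close>

text \<open>Convergence in the mean yields pointwise convergence only along a subsequence. A first
  subsequence therefore realises the lower limit of the integrals, a second one converges almost
  everywhere, and Fatou's lemma is applied along the latter.\<close>

lemma quartic_integral_liminf:
  fixes u :: "nat \<Rightarrow> 'a \<Rightarrow> complex"
  assumes u: "\<And>n. u n \<in> L2 M" and g: "g \<in> L2 M"
    and lim: "(\<lambda>n. sq_norm M (\<lambda>x. u n x - g x)) \<longlonglongrightarrow> 0"
  shows "(\<integral>\<^sup>+ x. ennreal (cmod (g x) ^ 4) \<partial>M) \<le> liminf (\<lambda>n. \<integral>\<^sup>+ x. ennreal (cmod (u n x) ^ 4) \<partial>M)"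
proof -
  note [measurable] = L2_measurable[OF u] L2_measurable[OF g]
  define a where "a n = (\<integral>\<^sup>+ x. ennreal (cmod (u n x) ^ 4) \<partial>M)" for n
  obtain r where r: "strict_mono r" "(a \<circ> r) \<longlonglongrightarrow> liminf a" using liminf_subseq_lim[of a] by blast
  let ?d = "\<lambda>n x. (cmod (u (r n) x - g x))\<^sup>2"
  have di: "integrable M (?d n)" for n
    using L2_sq_norm_finite[OF L2_diff[OF u g], of "r n"] by (intro integrableI_nonneg) (auto simp: sq_norm_def)
  have "(\<lambda>n. sq_norm M (\<lambda>x. u (r n) x - g x)) \<longlonglongrightarrow> 0"
    using LIMSEQ_subseq_LIMSEQ[OF lim r(1)] by (simp add: comp_def)
  then have "(\<lambda>n. ennreal (\<integral>x. ?d n x \<partial>M)) \<longlonglongrightarrow> 0"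
    unfolding sq_norm_def by (subst (asm) nn_integral_eq_integral[OF di]) auto
  then have "(\<lambda>n. \<integral>x. norm (?d n x) \<partial>M) \<longlonglongrightarrow> 0"
    by (subst (asm) ennreal_tendsto_0_iff) auto
  from tendsto_L1_AE_subseq[OF di this] obtain r' where r': "strict_mono r'" "AE x in M. (\<lambda>n. ?d (r' n) x) \<longlonglongrightarrow> 0" by blast
  have "(\<integral>\<^sup>+ x. ennreal (cmod (g x) ^ 4) \<partial>M) \<le> (\<integral>\<^sup>+ x. liminf (\<lambda>n. ennreal (cmod (u (r (r' n)) x) ^ 4)) \<partial>M)"
  proof (rule nn_integral_mono_AE)
    show "AE x in M. ennreal (cmod (g x) ^ 4) \<le> liminf (\<lambda>n. ennreal (cmod (u (r (r' n)) x) ^ 4))"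
      using r'(2)
    proof eventually_elim
      case (elim x)
      have "(\<lambda>n. sqrt (?d (r' n) x)) \<longlonglongrightarrow> sqrt 0" using elim by (intro tendsto_intros)
      then have "(\<lambda>n. u (r (r' n)) x - g x) \<longlonglongrightarrow> 0" by (simp add: tendsto_norm_zero_iff)
      then have "(\<lambda>n. u (r (r' n)) x) \<longlonglongrightarrow> g x" by (rule LIM_zero_cancel)
      then have "(\<lambda>n. ennreal (cmod (u (r (r' n)) x) ^ 4)) \<longlonglongrightarrow> ennreal (cmod (g x) ^ 4)"
        by (intro tendsto_intros)
      from lim_imp_Liminf[OF _ this] show ?case by simp
    qed
  qed
  also have "\<dots> \<le> liminf (\<lambda>n. a (r (r' n)))"
    unfolding a_def by (rule nn_integral_liminf) measurable
  also have "\<dots> = liminf a"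
  proof (rule lim_imp_Liminf)
    show "(\<lambda>n. a (r (r' n))) \<longlonglongrightarrow> liminf a"
      using LIMSEQ_subseq_LIMSEQ[OF r(2) r'(1)] by (simp add: comp_def)
  qed simp
  finally show ?thesis by (simp add: a_def[abs_def])
qed

text \<open>The infima over the tails from \<open>m\<close> and from \<open>n\<close> both bound
  every term beyond the larger index, so their product bounds the squares there. The square of the
  supremum is then a double supremum of such products.\<close>

lemma liminf_power2_le:
  fixes a :: "nat \<Rightarrow> ennreal"
  shows "(liminf a)\<^sup>2 \<le> liminf (\<lambda>n. (a n)\<^sup>2)"
proof -
  define b where "b n = (INF k\<in>{n..}. a k)" for n
  have "b m * b n \<le> liminf (\<lambda>n. (a n)\<^sup>2)" for m n
  proof -
    have "b m * b n \<le> (INF k\<in>{max m n..}. (a k)\<^sup>2)"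
      unfolding power2_eq_square b_def by (intro INF_greatest mult_mono INF_lower) auto
    also have "\<dots> \<le> liminf (\<lambda>n. (a n)\<^sup>2)" unfolding liminf_SUP_INF by (rule SUP_upper) simp
    finally show ?thesis .
  qed
  then have "(SUP n. SUP m. b m * b n) \<le> liminf (\<lambda>n. (a n)\<^sup>2)" by (intro SUP_least)
  moreover have "(SUP n. SUP m. b m * b n) = (SUP n. b n) * (SUP n. b n)"
    by (simp add: SUP_mult_left_ennreal SUP_mult_right_ennreal)
  ultimately show ?thesis by (simp add: liminf_SUP_INF power2_eq_square b_def)
qed

lemma infsum_ennreal_le_nn_integral:
  fixes f :: "'a \<Rightarrow> ennreal"
  shows "infsum f UNIV \<le> (\<integral>\<^sup>+ x. f x \<partial>count_space UNIV)"
proof -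
  have "infsum f UNIV = (SUP F\<in>{F. finite F \<and> F \<subseteq> UNIV}. sum f F)"
    by (rule nonneg_infsum_complete) simp
  also have "\<dots> \<le> (\<integral>\<^sup>+ x. f x \<partial>count_space UNIV)"
  proof (rule SUP_least)
    fix F :: "'a set" assume "F \<in> {F. finite F \<and> F \<subseteq> UNIV}"
    then have "sum f F = (\<integral>\<^sup>+ x. f x \<partial>count_space F)" by (simp add: nn_integral_count_space_finite)
    also have "\<dots> \<le> (\<integral>\<^sup>+ x. f x \<partial>count_space UNIV)"
    proof (cases "F = UNIV")
      case False
      have "f x * indicator F x \<le> f x" for x by (cases "x \<in> F") auto
      then show ?thesis using False by (simp add: nn_integral_count_space_indicator nn_integral_mono)
    qed simp
    finally show "sum f F \<le> (\<integral>\<^sup>+ x. f x \<partial>count_space UNIV)" .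
  qed
  finally show ?thesis .
qed

lemma ennreal_powr_mono: "x \<le> y \<Longrightarrow> 0 \<le> p \<Longrightarrow> ennreal_powr x p \<le> ennreal_powr y p"
  by (auto simp: ennreal_powr_def top_unique enn2real_mono less_top intro!: ennreal_leI powr_mono2)

definition dispersion :: "real \<Rightarrow> real \<times> int \<Rightarrow> complex" where
  "dispersion t = (\<lambda>(\<xi>, k). cis (- t * (\<xi>\<^sup>2 + (of_int k)\<^sup>2)))"

lemma dispersion_eq: "dispersion t q = cis (- t * energy q)"
  by (simp add: dispersion_def energy_def case_prod_unfold)

lemma dispersion_mult_L2:
  assumes F: "F \<in> L2 frequency_space"
  shows "(\<lambda>q. dispersion t q * F q) \<in> L2 frequency_space"
proof (rule L2_bound[OF F])
  note [measurable] = L2_measurable[OF F]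
  show "(\<lambda>q. dispersion t q * F q) \<in> borel_measurable frequency_space" unfolding dispersion_eq by measurable
qed (simp add: norm_mult dispersion_eq)

lemma inverse_fourier_dispersion:
  "inverse_fourier (\<lambda>q. dispersion t q * F q) z = free_wave F t z / of_real (2 * pi)"
  by (simp add: inverse_fourier_def free_wave_def dispersion_eq phase_def mult_ac cis_mult)

text \<open>Replaces the chosen value of the group by a concrete limit: surjectivity shows that the
  choice is not empty, injectivity that it agrees almost everywhere with the \<open>g\<close> built
  from truncated data. The approximants of \<open>g\<close> are free waves with integrable
  data.\<close>

lemma schrodinger_group_quartic_le:
  assumes f: "f \<in> L2 cylinder"
  shows "(\<integral>\<^sup>+ z. ennreal (cmod (schrodinger_group t f z) ^ 4) \<partial>cylinder) \<le>
    liminf (\<lambda>n. quartic_mass (frequency_truncated n (fourier_transform f)) t)"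
proof -
  let ?F = "fourier_transform f"
  note F = fourier_transform_limit(1)[OF f]
  note mF = dispersion_mult_L2[OF F, of t]
  obtain g where g: "g \<in> L2 cylinder" "AE q in frequency_space. fourier_transform g q = dispersion t q * ?F q"
    "(\<lambda>n. sq_norm cylinder (\<lambda>z. inverse_fourier (frequency_truncated n (\<lambda>q. dispersion t q * ?F q)) z - g z)) \<longlonglongrightarrow> 0"
    by (rule fourier_transform_surj[OF mF])
  define h where "h = schrodinger_group t f"
  have "h = (SOME g. g \<in> Lp_space 2 cylinder \<and> (AE q in frequency_space. fourier_transform g q = dispersion t q * ?F q))"
    by (simp add: h_def schrodinger_group_def fourier_multiplier_def dispersion_def)
  moreover have "g \<in> Lp_space 2 cylinder \<and> (AE q in frequency_space. fourier_transform g q = dispersion t q * ?F q)"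
    using g by (simp add: Lp_space_2_eq)
  ultimately have h: "h \<in> Lp_space 2 cylinder \<and> (AE q in frequency_space. fourier_transform h q = dispersion t q * ?F q)"
    using someI[of "\<lambda>g. g \<in> Lp_space 2 cylinder \<and> (AE q in frequency_space. fourier_transform g q = dispersion t q * ?F q)" g] by simp
  then have "AE z in cylinder. h z = g z"
    using g by (intro fourier_transform_inject) (auto simp: Lp_space_2_eq elim: AE_mp)
  then have "(\<integral>\<^sup>+ z. ennreal (cmod (h z) ^ 4) \<partial>cylinder) = (\<integral>\<^sup>+ z. ennreal (cmod (g z) ^ 4) \<partial>cylinder)"
    by (intro nn_integral_cong_AE) auto
  also have "\<dots> \<le> liminf (\<lambda>n. \<integral>\<^sup>+ z. ennreal (cmod (inverse_fourier (frequency_truncated n (\<lambda>q. dispersion t q * ?F q)) z) ^ 4) \<partial>cylinder)"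
    by (rule quartic_integral_liminf[OF _ g(1,3)]) (intro inverse_fourier_L2 frequency_truncation[OF mF])
  also have "\<dots> \<le> liminf (\<lambda>n. quartic_mass (frequency_truncated n ?F) t)"
  proof (intro Liminf_mono always_eventually allI)
    fix n
    have e: "inverse_fourier (frequency_truncated n (\<lambda>q. dispersion t q * ?F q)) z = free_wave (frequency_truncated n ?F) t z / of_real (2 * pi)" for z
      using inverse_fourier_dispersion[of t "frequency_truncated n ?F" z] by (simp add: mult.left_commute)
    \<comment> \<open>The normalising factor 1 / (2 pi) is at most 1 and is simply dropped.\<close>
    have "cmod (w / of_real (2 * pi)) \<le> cmod w" for w
    proof -
      have "cmod (w / of_real (2 * pi)) = cmod w / (2 * pi)" by (simp add: norm_divide)
      also have "\<dots> \<le> cmod w / 1" using pi_gt3 by (intro divide_left_mono) auto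
      finally show ?thesis by simp
    qed
    then show "(\<integral>\<^sup>+ z. ennreal (cmod (inverse_fourier (frequency_truncated n (\<lambda>q. dispersion t q * ?F q)) z) ^ 4) \<partial>cylinder) \<le> quartic_mass (frequency_truncated n ?F) t"
      unfolding e quartic_mass_def by (intro nn_integral_mono ennreal_leI power_mono) auto
  qed
  finally show ?thesis by (simp add: h_def)
qed

theorem theorem1p1:
  shows "\<exists>C::real. \<forall>f \<in> Lp_space 2 cylinder.
    mixed_norm 8 4 4 (\<lambda>t. schrodinger_group t f) \<le> ennreal C * Lp_norm 2 cylinder f"
proof -
  obtain C where C: "0 \<le> C" and
    bound: "\<And>F. integrable frequency_space F \<Longrightarrow>
      (\<integral>\<^sup>+ \<gamma>. (\<integral>\<^sup>+ s. quartic_mass F (of_int \<gamma> + s) * indicator {0..<1} s \<partial>lborel)\<^sup>2 \<partial>count_space (UNIV :: int set))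
      \<le> ennreal C * (sq_norm frequency_space F) ^ 4"
    unfolding sq_norm_def by (rule window_energy_bound) blast
  \<comment> \<open>The 16 is the fourth power of the 2 in
    \<open>fourier_transform_sq_norm_le\<close>. The eighth root turns the fourth power of the
    squared norm into the norm itself.\<close>
  have "mixed_norm 8 4 4 (\<lambda>t. schrodinger_group t f) \<le> ennreal ((16 * C) powr (1 / 8)) * Lp_norm 2 cylinder f"
    if "f \<in> Lp_space 2 cylinder" for f
  proof -
    have f: "f \<in> L2 cylinder" using that by (simp add: Lp_space_2_eq)
    let ?F = "fourier_transform f"
    note F = fourier_transform_limit(1)[OF f]
    note T = frequency_truncation[OF F]
    define J where "J t = (\<integral>\<^sup>+ z. ennreal (cmod (schrodinger_group t f z) ^ 4) \<partial>cylinder)" for t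
    define I where "I n t = quartic_mass (frequency_truncated n ?F) t" for n t
    have Im [measurable]: "I n \<in> borel_measurable borel" for n
      unfolding I_def[abs_def] using borel_measurable_integrable[OF T(1)] by measurable
    define A where "A n \<gamma> = (\<integral>\<^sup>+ s. I n (of_int \<gamma> + s) * indicator {0..<1} s \<partial>lborel)" for n and \<gamma> :: int
    have window: "(\<integral>\<^sup>+ s\<in>{0..<1}. J (of_int \<gamma> + s) \<partial>lborel) \<le> liminf (\<lambda>n. A n \<gamma>)" for \<gamma> :: int
    proof -
      \<comment> \<open>At each time the representative is chosen separately. Monotonicity of the
        integral asks no measurability of \<open>J\<close> in time, and Fatou's lemma is applied
        only to the measurable \<open>I n\<close>.\<close>
      have "(\<integral>\<^sup>+ s\<in>{0..<1}. J (of_int \<gamma> + s) \<partial>lborel) \<le> (\<integral>\<^sup>+ s. liminf (\<lambda>n. I n (of_int \<gamma> + s) * indicator {0..<1} s) \<partial>lborel)"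
      proof (rule nn_integral_mono)
        fix s :: real
        show "J (of_int \<gamma> + s) * indicator {0..<1} s \<le> liminf (\<lambda>n. I n (of_int \<gamma> + s) * indicator {0..<1} s)"
          using schrodinger_group_quartic_le[OF f, of "of_int \<gamma> + s"]
          by (cases "s \<in> {0..<1}") (simp_all add: J_def I_def Liminf_const)
      qed
      also have "\<dots> \<le> liminf (\<lambda>n. A n \<gamma>)" unfolding A_def by (rule nn_integral_liminf) measurable
      finally show ?thesis .
    qed
    have "(\<Sum>\<^sub>\<infinity>\<gamma>\<in>(UNIV :: int set). (\<integral>\<^sup>+ s\<in>{0..<1}. J (of_int \<gamma> + s) \<partial>lborel)\<^sup>2) \<le>
      (\<integral>\<^sup>+ \<gamma>. (\<integral>\<^sup>+ s\<in>{0..<1}. J (of_int \<gamma> + s) \<partial>lborel)\<^sup>2 \<partial>count_space (UNIV :: int set))"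
      by (rule infsum_ennreal_le_nn_integral)
    also have "\<dots> \<le> (\<integral>\<^sup>+ \<gamma>. liminf (\<lambda>n. (A n \<gamma>)\<^sup>2) \<partial>count_space (UNIV :: int set))"
      by (intro nn_integral_mono order.trans[OF power_mono[OF window] liminf_power2_le]) simp
    also have "\<dots> \<le> liminf (\<lambda>n. \<integral>\<^sup>+ \<gamma>. (A n \<gamma>)\<^sup>2 \<partial>count_space (UNIV :: int set))"
      by (rule nn_integral_liminf) simp
    also have "\<dots> \<le> liminf (\<lambda>n::nat. ennreal C * (2 * sq_norm cylinder f) ^ 4)"
    proof (intro Liminf_mono always_eventually allI)
      fix n
      have "(\<integral>\<^sup>+ \<gamma>. (A n \<gamma>)\<^sup>2 \<partial>count_space (UNIV :: int set)) \<le> ennreal C * (sq_norm frequency_space (frequency_truncated n ?F)) ^ 4"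
        unfolding A_def I_def by (rule bound[OF T(1)])
      also have "sq_norm frequency_space (frequency_truncated n ?F) \<le> sq_norm frequency_space ?F"
        by (rule sq_norm_mono) (auto simp: norm_mult split: split_indicator)
      then have "ennreal C * (sq_norm frequency_space (frequency_truncated n ?F)) ^ 4 \<le> ennreal C * (2 * sq_norm cylinder f) ^ 4"
        using fourier_transform_sq_norm_le[OF f] by (intro mult_left_mono power_mono) auto
      finally show "(\<integral>\<^sup>+ \<gamma>. (A n \<gamma>)\<^sup>2 \<partial>count_space (UNIV :: int set)) \<le> ennreal C * (2 * sq_norm cylinder f) ^ 4" .
    qed
    finally have total: "(\<Sum>\<^sub>\<infinity>\<gamma>\<in>(UNIV :: int set). (\<integral>\<^sup>+ s\<in>{0..<1}. J (of_int \<gamma> + s) \<partial>lborel)\<^sup>2) \<le> ennreal C * (2 * sq_norm cylinder f) ^ 4"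
      by (simp add: Liminf_const)
    obtain y where y: "sq_norm cylinder f = ennreal y" "0 \<le> y"
      using L2_sq_norm_finite[OF f] by (metis less_top_ennreal infinity_ennreal_def)
    have "ennreal C * (2 * sq_norm cylinder f) ^ 4 = ennreal ((16 * C) * y ^ 4)"
    proof -
      have "2 * ennreal y = ennreal (2 * y)" by (simp add: ennreal_mult')
      then show ?thesis using C y by (simp add: ennreal_power power_mult_distrib mult_ac flip: ennreal_mult)
    qed
    with total have "mixed_norm 8 4 4 (\<lambda>t. schrodinger_group t f) \<le> ennreal_powr (ennreal ((16 * C) * y ^ 4)) (1 / 8)"
      unfolding mixed_norm_8_4_4 J_def by (intro ennreal_powr_mono) auto
    also have "\<dots> = ennreal ((16 * C) powr (1 / 8) * y powr (1 / 2))"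
    proof -
      have "(y ^ 4) powr (1 / 8) = y powr (1 / 2)"
        using y by (cases "y = 0") (auto simp: powr_powr simp flip: powr_numeral)
      then show ?thesis using C y by (simp add: ennreal_powr_def powr_mult)
    qed
    also have "\<dots> = ennreal ((16 * C) powr (1 / 8)) * Lp_norm 2 cylinder f"
      using y by (simp add: Lp_norm_2_eq ennreal_powr_def ennreal_mult)
    finally show ?thesis .
  qed
  then show ?thesis by blast
qed

end
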